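(* Let $P\in\mathbb Z_+$, let $U\subseteq M$ be open, $l\in\mathbb C^\times$, and let $f:U\to\mathbb C$ be an eigenfunction of the Laplace-Beltrami operator with eigenvalue $\lambda=P(P-1)K$ (i.e. $-\Delta f=\lambda f$). Then the union of the following three sets is a basis of $V_U^{(3)}(l,f)$: $$\{h_+(-t_1)\cdots h_+(-t_{r/2})h_-(-t_{r/2+1})\cdots h_-(-t_r)f:\ r\ge0\text{ even},\ t_1\ge\cdots\ge t_{r/2}\ge1,\ t_{r/2+1}\ge\cdots\ge t_r\ge1\},$$ $$\{h_+(-t_1)\cdots h_+(-t_{r/2})h_-(-t_{r/2+1})\cdots h_-(-t_k)h_-(0)^{r-k}f:\ r\ge0\text{ even},\ \max(r-P+1,r/2)\le k\le r-1,\ t_1\ge\cdots\ge t_{r/2}\ge1,\ t_{r/2+1}\ge\cdots\ge t_k\ge1\},$$ $$\{h_-(-t_1)\cdots h_-(-t_{r/2})h_+(-t_{r/2+1})\cdots h_+(-t_k)h_+(0)^{r-k}f:\ r\ge0\text{ even},\ \max(r-P+1,r/2)\le k\le r-1,\ t_1\ge\cdots\ge t_{r/2}\ge1,\ t_{r/2+1}\ge\cdots\ge t_k\ge1\}.$$ In other words, there are at most $P-1$ consecutive $h_-(0)$ (resp. $h_+(0)$) at the rear of the elements of the second (resp. third) set.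
   Context: Geometry: $M$ is a two-dimensional, connected, complete, orientable Riemannian manifold of constant sectional curvature $K\neq0$; $E=\mathbb C\otimes_{\mathbb R}TM$ with complex-linearly extended Levi-Civita connection $\nabla$ and complex-bilinearly extended metric $(\cdot,\cdot)$. Fix $p\in M$, an orthonormal basis $e_1,e_2$ of $T_pM$, and $h_\pm=e_1\mp\sqrt{-1}e_2\in E_p$, so $(h_\pm,h_\pm)=0$, $(h_+,h_-)=2$. $\Pi(T(E))$ is the algebra of parallel sections of $T(E)=\bigoplus_kE^{\otimes k}$, identified by evaluation at $p$ with the subalgebra of the tensor algebra $T(E_p)$ spanned by the words $h_{i_1}\otimes\cdots\otimes h_{i_k}$ with as many $+$ as $-$. $X\in\Pi(E^{\otimes k})$ acts on $C^\infty(U)$ (complex valued) by $g\mapsto(\nabla^kg)(X)$, with $(\nabla^kg)(Z_1,\dots,Z_k)=(\nabla_{Z_1}(\nabla^{k-1}g))(Z_2,\dots,Z_k)$. Eigenfunctions are nonzero. Modes: for a left $T(E_p)$-module $S$ put $F(S)=T(\widehat E_{p,-})\otimes S$, $\widehat E_{p,-}=E_p\otimes t^{-1}\mathbb C[t^{-1}]$. For $a\in E_p$: $a(-m)$ ($m>0$) is left multiplication by $a\otimes t^{-m}$; $a(0)$ acts as $1\otimes a$ through $S$; $a(m)$ ($m>0$) kills $1\otimes S$ and satisfies $a(m)b(-n)=b(-n)a(m)+m(a,b)\delta_{m,n}l$. Set $a(x)=\sum_na(n)x^{-n-1}$; normal ordering ${:}\ {:}$ places negative modes first, then positive modes, then zero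 modes, preserving relative order in each group. $V=V(l,\mathbf 1)$ has basis the words $v=h_{i_1}(-m_1)\cdots h_{i_s}(-m_s)\mathbf 1$ with $m_j\in\mathbb Z_+$ and as many $+$ as $-$; it acts on $F(S)$ by $Y(v,x)={:}\prod_{j=1}^s\frac1{(m_j-1)!}\frac{d^{m_j-1}}{dx^{m_j-1}}h_{i_j}(x){:}=\sum_nv_nx^{-n-1}$ (product in the order $j=1,\dots,s$). $V_U(l,f)$ is the span of all $v_nf$ inside $F(S)$ with $S=T(E_p)\otimes_{\Pi(T(E))}C^\infty(U)$, where $f$ stands for $1\otimes(1\otimes f)$; it is graded by $\mathrm{wt}\,f=0$, each $h_\pm(-t)$ ($t>0$) adding $t$ and each $h_\pm(0)$ adding $0$. Submodules are graded subspaces stable under all $v_n$ ($v\in V,n\in\mathbb Z$). Quotients: identify $\pm$ with $\pm1$. For signs $j_1,\dots,j_r$ put $s_q=j_q+\cdots+j_r$ for $q\le r$, $s_{r+1}=0$, and $C_{j_1,\dots,j_r}(\lambda)=\prod_{q:\,|s_q|<|s_{q+1}|}\bigl(-\lambda+|s_{q+1}|(|s_{q+1}|-1)K\bigr)$. $V_U^{(1)}(l,f)$ is the quotient of $V_U(l,f)$ by the submodule generated by all $$h_{j_1}(-t_1)\cdots h_{j_k}(-t_k)h_{j_{k+1}}(0)\cdots h_{j_r}(0)f-C_{j_{k+1},\dots,j_r}(\lambda)\,h_{j_1}(-t_1)\cdots h_{j_k}(-t_k)h_{\epsilon}(0)^Nf,$$ where $t_1,\dots,t_k\in\mathbb Z_+$,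 $\sum_{q=1}^rj_q=0$, $N=|\sum_{q=k+1}^rj_q|$, $\epsilon=\mathrm{sgn}(\sum_{q=k+1}^rj_q)$ (no $h_\epsilon(0)$ if $N=0$). $V_U^{(2)}(l,f)$ is the quotient of $V_U^{(1)}(l,f)$ by the submodule generated by all $$h_{j_1}(-t_1)\cdots h_{j_k}(-t_k)h_{j_{k+1}}(0)\cdots h_{j_r}(0)f-h_{j_{\tau(1)}}(-t_{\tau(1)})\cdots h_{j_{\tau(k)}}(-t_{\tau(k)})h_{j_{k+1}}(0)\cdots h_{j_r}(0)f$$ with $t_1,\dots,t_k\in\mathbb{Z}_+$, $\sum_{q=1}^rj_q=0$, $\tau\in S_k$. Finally, for $\lambda=P(P-1)K$, $V_U^{(3)}(l,f)$ is the quotient of $V_U^{(2)}(l,f)$ by the submodule generated by all elements $$h_{j_1}(-t_1)\cdots h_{j_k}(-t_k)h_{j_{k+1}}(0)\cdots h_{j_r}(0)f,\qquad r\text{ even},\ r\ge k+P,\ k\geq r/2,$$ with $j_1=\cdots=j_{r/2}=-j_{r/2+1}=\cdots=-j_r$ and $t_1\ge\cdots\ge t_{r/2}\ge1$, $t_{r/2+1}\ge\cdots\ge t_k\ge1$. *)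

theory Defs
  imports
    "HOL-Analysis.Analysis"
    "HOL-Library.Poly_Mapping"
    "HOL-Combinatorics.Permutations"
begin

section \<open>Smooth functions on open subsets of the plane\<close>

text \<open>All sets \<open>S\<close> below are open in the applications.\<close>

primrec Ck_on :: "nat \<Rightarrow> (real^2) set \<Rightarrow> (real^2 \<Rightarrow> 'b::real_normed_vector) \<Rightarrow> bool" where
  "Ck_on 0 S u \<longleftrightarrow> continuous_on S u"
| "Ck_on (Suc k) S u \<longleftrightarrow> (\<forall>y\<in>S. u differentiable (at y)) \<and>
     (\<forall>i. Ck_on k S (\<lambda>y. frechet_derivative u (at y) (axis i 1)))"

definition smooth_on :: "(real^2) set \<Rightarrow> (real^2 \<Rightarrow> 'b::real_normed_vector) \<Rightarrow> bool" where
  "smooth_on S u \<longleftrightarrow> (\<forall>k. Ck_on k S u)"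


section \<open>Surfaces\<close>

text \<open>
  The underlying space of a surface is a (Hausdorff, second countable) type. A chart is a pair of
  its domain and its coordinate map; the coordinate map is irrelevant outside the domain.
  Geometric objects are given by their components in all charts of an atlas (not necessarily
  maximal). The components are functions on the surface, and \<open>pd c i\<close> is the coordinate vector
  field of index \<open>i\<close> of the chart \<open>c\<close>, acting on functions defined near a point of the domain.
\<close>

type_synonym 'm chart = "'m set \<times> ('m \<Rightarrow> real^2)"

definition local_rep :: "'m chart \<Rightarrow> ('m \<Rightarrow> 'b) \<Rightarrow> real^2 \<Rightarrow> 'b" where
  "local_rep c u = u \<circ> inv_into (fst c) (snd c)"

definition pd :: "'m chart \<Rightarrow> 2 \<Rightarrow> ('m \<Rightarrow> 'b::real_normed_vector) \<Rightarrow> 'm \<Rightarrow> 'b" where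
  "pd c i u x = frechet_derivative (local_rep c u) (at (snd c x)) (axis i 1)"

definition smooth_in_chart :: "'m chart \<Rightarrow> 'm set \<Rightarrow> ('m \<Rightarrow> 'b::real_normed_vector) \<Rightarrow> bool" where
  "smooth_in_chart c W u \<longleftrightarrow> smooth_on (snd c ` (fst c \<inter> W)) (local_rep c u)"

definition smooth_atlas :: "'m::topological_space chart set \<Rightarrow> bool" where
  "smooth_atlas A \<longleftrightarrow> (\<Union>c\<in>A. fst c) = UNIV \<and>
     (\<forall>c\<in>A. open (fst c) \<and> open (snd c ` fst c) \<and>
        homeomorphism (fst c) (snd c ` fst c) (snd c) (inv_into (fst c) (snd c))) \<and>
     (\<forall>c\<in>A. \<forall>d\<in>A. smooth_in_chart c (fst d) (snd d))"

text \<open>\<open>jac c d x a i\<close> is the derivative of the \<open>a\<close>-th coordinate of \<open>d\<close> along the \<open>i\<close>-th of \<open>c\<close>.\<close>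

definition jac :: "'m chart \<Rightarrow> 'm chart \<Rightarrow> 'm \<Rightarrow> 2 \<Rightarrow> 2 \<Rightarrow> real" where
  "jac c d x a i = pd c i (\<lambda>y. snd d y $ a) x"

type_synonym 'm metric = "'m chart \<Rightarrow> 'm \<Rightarrow> real^2^2"

definition gip :: "'m metric \<Rightarrow> 'm chart \<Rightarrow> 'm \<Rightarrow> real^2 \<Rightarrow> real^2 \<Rightarrow> real" where
  "gip g c x v w = (\<Sum>i\<in>UNIV. \<Sum>j\<in>UNIV. g c x $ i $ j * v $ i * w $ j)"

definition riemannian_surface :: "'m::topological_space chart set \<Rightarrow> 'm metric \<Rightarrow> bool" where
  "riemannian_surface A g \<longleftrightarrow> smooth_atlas A \<and>
     (\<forall>c\<in>A. (\<forall>i j. smooth_in_chart c UNIV (\<lambda>x. g c x $ i $ j)) \<and>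
        (\<forall>x\<in>fst c. (\<forall>v w. gip g c x v w = gip g c x w v) \<and> (\<forall>v. v \<noteq> 0 \<longrightarrow> gip g c x v v > 0)) \<and>
        (\<forall>d\<in>A. \<forall>x\<in>fst c \<inter> fst d. \<forall>i j.
           g c x $ i $ j =
             (\<Sum>a\<in>UNIV. \<Sum>b\<in>UNIV. jac c d x a i * jac c d x b j * g d x $ a $ b)))"

text \<open>Orientability: there is a nowhere vanishing continuous 2-form, with component \<open>\<omega> c\<close>
  in the chart \<open>c\<close>.\<close>

definition orientable_surface :: "'m::topological_space chart set \<Rightarrow> bool" where
  "orientable_surface A \<longleftrightarrow> (\<exists>\<omega> :: 'm chart \<Rightarrow> 'm \<Rightarrow> real. \<forall>c\<in>A.
     continuous_on (fst c) (\<omega> c) \<and> (\<forall>x\<in>fst c. \<omega> c x \<noteq> 0) \<and>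
     (\<forall>d\<in>A. \<forall>x\<in>fst c \<inter> fst d. \<omega> c x = det (\<chi> a i. jac c d x a i) * \<omega> d x))"


section \<open>Levi-Civita connection\<close>

text \<open>\<open>christoffel g c k i j\<close> is the component of index \<open>k\<close> of the covariant derivative of the
  \<open>j\<close>-th coordinate field along the \<open>i\<close>-th one.\<close>

definition christoffel :: "'m metric \<Rightarrow> 'm chart \<Rightarrow> 2 \<Rightarrow> 2 \<Rightarrow> 2 \<Rightarrow> 'm \<Rightarrow> real" where
  "christoffel g c k i j x = (\<Sum>m\<in>UNIV. matrix_inv (g c x) $ k $ m / 2 *
     (pd c i (\<lambda>y. g c y $ j $ m) x + pd c j (\<lambda>y. g c y $ i $ m) x - pd c m (\<lambda>y. g c y $ i $ j) x))"

text \<open>\<open>riem g c l k i j\<close> is the component of index \<open>l\<close> of \<open>R(\<partial>\<^sub>i,\<partial>\<^sub>j)\<partial>\<^sub>k\<close>, where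
  \<open>R(X,Y) = [\<nabla>\<^sub>X,\<nabla>\<^sub>Y] - \<nabla>\<^sub>[\<^sub>X\<^sub>,\<^sub>Y\<^sub>]\<close>; thus round spheres have positive sectional curvature.\<close>

definition riem :: "'m metric \<Rightarrow> 'm chart \<Rightarrow> 2 \<Rightarrow> 2 \<Rightarrow> 2 \<Rightarrow> 2 \<Rightarrow> 'm \<Rightarrow> real" where
  "riem g c l k i j x = pd c i (christoffel g c l j k) x - pd c j (christoffel g c l i k) x +
     (\<Sum>m\<in>UNIV. christoffel g c l i m x * christoffel g c m j k x -
                 christoffel g c l j m x * christoffel g c m i k x)"

definition riem_op :: "'m metric \<Rightarrow> 'm chart \<Rightarrow> 'm \<Rightarrow> real^2 \<Rightarrow> real^2 \<Rightarrow> real^2 \<Rightarrow> real^2" where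
  "riem_op g c x u v w =
     (\<chi> l. \<Sum>i\<in>UNIV. \<Sum>j\<in>UNIV. \<Sum>k\<in>UNIV. riem g c l k i j x * u $ i * v $ j * w $ k)"

definition sectional_curvature :: "'m metric \<Rightarrow> 'm chart \<Rightarrow> 'm \<Rightarrow> real^2 \<Rightarrow> real^2 \<Rightarrow> real" where
  "sectional_curvature g c x v w = gip g c x (riem_op g c x v w w) v /
     (gip g c x v v * gip g c x w w - (gip g c x v w)\<^sup>2)"

definition constant_curvature :: "'m chart set \<Rightarrow> 'm metric \<Rightarrow> real \<Rightarrow> bool" where
  "constant_curvature A g K \<longleftrightarrow> (\<forall>c\<in>A. \<forall>x\<in>fst c. \<forall>v w.
     gip g c x v v * gip g c x w w - (gip g c x v w)\<^sup>2 \<noteq> 0 \<longrightarrow> sectional_curvature g c x v w = K)"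

definition geodesic :: "'m::topological_space chart set \<Rightarrow> 'm metric \<Rightarrow> (real \<Rightarrow> 'm) \<Rightarrow> bool" where
  "geodesic A g \<gamma> \<longleftrightarrow> continuous_on UNIV \<gamma> \<and>
     (\<forall>c\<in>A. \<forall>t. \<gamma> t \<in> fst c \<longrightarrow>
        (let v = (\<lambda>s. vector_derivative (snd c \<circ> \<gamma>) (at s)) in
          (snd c \<circ> \<gamma>) differentiable (at t) \<and>
          (v has_vector_derivative
             (\<chi> k. - (\<Sum>i\<in>UNIV. \<Sum>j\<in>UNIV. christoffel g c k i j (\<gamma> t) * v t $ i * v t $ j))) (at t)))"

text \<open>Geodesic completeness: every initial velocity is that of a geodesic defined for all times.\<close>

definition complete_surface :: "'m::topological_space chart set \<Rightarrow> 'm metric \<Rightarrow> bool" where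
  "complete_surface A g \<longleftrightarrow> (\<forall>c\<in>A. \<forall>x\<in>fst c. \<forall>v.
     \<exists>\<gamma>. geodesic A g \<gamma> \<and> \<gamma> 0 = x \<and> ((snd c \<circ> \<gamma>) has_vector_derivative v) (at 0))"

text \<open>
  Components of a covariant tensor in a chart are indexed by lists of indices. The new index of
  a covariant derivative comes first.
\<close>

definition cov_deriv ::
    "'m metric \<Rightarrow> 'm chart \<Rightarrow> (2 list \<Rightarrow> 'm \<Rightarrow> complex) \<Rightarrow> 2 list \<Rightarrow> 'm \<Rightarrow> complex" where
  "cov_deriv g c T I x = (case I of [] \<Rightarrow> 0 | i # J \<Rightarrow>
     pd c i (T J) x -
     (\<Sum>a<length J. \<Sum>b\<in>UNIV. of_real (christoffel g c b i (J ! a) x) * T (J[a := b]) x))"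

primrec nabla_pow ::
    "'m metric \<Rightarrow> 'm chart \<Rightarrow> nat \<Rightarrow> ('m \<Rightarrow> complex) \<Rightarrow> 2 list \<Rightarrow> 'm \<Rightarrow> complex" where
  "nabla_pow g c 0 u = (\<lambda>I x. if I = [] then u x else 0)"
| "nabla_pow g c (Suc k) u = cov_deriv g c (nabla_pow g c k u)"

definition laplace_beltrami :: "'m metric \<Rightarrow> 'm chart \<Rightarrow> ('m \<Rightarrow> complex) \<Rightarrow> 'm \<Rightarrow> complex" where
  "laplace_beltrami g c u x =
     (\<Sum>i\<in>UNIV. \<Sum>j\<in>UNIV. of_real (matrix_inv (g c x) $ i $ j) * nabla_pow g c 2 u [i, j] x)"

text \<open>A function on \<open>U\<close> is represented by its extension by zero.\<close>

definition smooth_functions :: "'m chart set \<Rightarrow> 'm set \<Rightarrow> ('m \<Rightarrow> complex) set" where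
  "smooth_functions A U = {u. (\<forall>x. x \<notin> U \<longrightarrow> u x = 0) \<and> (\<forall>c\<in>A. smooth_in_chart c U u)}"

definition laplace_eigenfunction ::
    "'m chart set \<Rightarrow> 'm metric \<Rightarrow> 'm set \<Rightarrow> complex \<Rightarrow> ('m \<Rightarrow> complex) \<Rightarrow> bool" where
  "laplace_eigenfunction A g U lam u \<longleftrightarrow> u \<in> smooth_functions A U \<and> (\<exists>x\<in>U. u x \<noteq> 0) \<and>
     (\<forall>c\<in>A. \<forall>x\<in>fst c \<inter> U. - laplace_beltrami g c u x = lam * u x)"

text \<open>Parallel sections over the whole surface of the \<open>k\<close>-th tensor power of the complexified
  tangent bundle; \<open>X c x I\<close> are the components in the chart \<open>c\<close>.\<close>

definition parallel_section ::
    "'m chart set \<Rightarrow> 'm metric \<Rightarrow> nat \<Rightarrow> ('m chart \<Rightarrow> 'm \<Rightarrow> 2 list \<Rightarrow> complex) \<Rightarrow> bool" where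
  "parallel_section A g k X \<longleftrightarrow> (\<forall>c\<in>A. \<forall>I. length I = k \<longrightarrow>
     smooth_in_chart c UNIV (\<lambda>x. X c x I) \<and>
     (\<forall>d\<in>A. \<forall>x\<in>fst c \<inter> fst d.
        X d x I = (\<Sum>J | length J = k. (\<Prod>a<k. of_real (jac c d x (I ! a) (J ! a))) * X c x J)) \<and>
     (\<forall>x\<in>fst c. \<forall>i.
        pd c i (\<lambda>y. X c y I) x +
        (\<Sum>a<k. \<Sum>b\<in>UNIV. of_real (christoffel g c (I ! a) i b x) * X c x (I[a := b])) = 0))"

text \<open>\<open>acts_to A g U k X u u'\<close>: the function \<open>u'\<close> on \<open>U\<close> is \<open>(\<nabla>\<^sup>k u)(X)\<close>.\<close>

definition acts_to ::
    "'m chart set \<Rightarrow> 'm metric \<Rightarrow> 'm set \<Rightarrow> nat \<Rightarrow> ('m chart \<Rightarrow> 'm \<Rightarrow> 2 list \<Rightarrow> complex) \<Rightarrow>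
     ('m \<Rightarrow> complex) \<Rightarrow> ('m \<Rightarrow> complex) \<Rightarrow> bool" where
  "acts_to A g U k X u u' \<longleftrightarrow> (\<forall>c\<in>A. \<forall>x\<in>fst c \<inter> U.
     u' x = (\<Sum>I | length I = k. nabla_pow g c k u I x * X c x I))"


section \<open>Words in \<open>h\<^sub>+\<close> and \<open>h\<^sub>-\<close>\<close>

datatype sign = Plus | Minus

primrec sval :: "sign \<Rightarrow> int" where
  "sval Plus = 1"
| "sval Minus = - 1"

primrec neg :: "sign \<Rightarrow> sign" where
  "neg Plus = Minus"
| "neg Minus = Plus"

definition charge :: "sign list \<Rightarrow> int" where
  "charge w = (\<Sum>j\<leftarrow>w. sval j)"

text \<open>The (complex bilinear) metric on \<open>h\<^sub>+\<close>, \<open>h\<^sub>-\<close>.\<close>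

definition hpair :: "sign \<Rightarrow> sign \<Rightarrow> complex" where
  "hpair s s' = (if s = s' then 0 else 2)"

definition hvec :: "real^2 \<Rightarrow> real^2 \<Rightarrow> sign \<Rightarrow> 2 \<Rightarrow> complex" where
  "hvec e1 e2 s i = of_real (e1 $ i) - of_int (sval s) * \<i> * of_real (e2 $ i)"

definition word_tensor :: "real^2 \<Rightarrow> real^2 \<Rightarrow> sign list \<Rightarrow> 2 list \<Rightarrow> complex" where
  "word_tensor e1 e2 w I = (\<Prod>a<length w. hvec e1 e2 (w ! a) (I ! a))"


section \<open>The space \<open>F(S)\<close>\<close>

text \<open>
  Words in \<open>h\<^sub>\<plusminus>\<close> form a basis of \<open>T(E\<^sub>p)\<close>, and words in the modes \<open>h\<^sub>\<plusminus>(-m)\<close>, \<open>m \<ge> 1\<close>,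
  form one of the tensor algebra of their span; the pair \<open>(s, m)\<close> stands for \<open>h\<^sub>s(-m)\<close>. The triple \<open>(a, b, u)\<close> stands for
  \<open>a \<otimes> (b \<otimes> u)\<close>. The space \<open>F(S)\<close>, with \<open>S\<close> the tensor product of \<open>T(E\<^sub>p)\<close> and
  the smooth functions on \<open>U\<close> over the algebra of parallel sections, is the quotient of the space
  spanned freely by the triples (with \<open>u\<close> smooth on \<open>U\<close>) by the relations below. Throughout,
  a subspace of \<open>F(S)\<close> is represented by its preimage under this quotient map, and a quotient
  \<open>W/N\<close> by the pair of \<open>W\<close> and \<open>N\<close>.
\<close>

type_synonym nword = "(sign \<times> nat) list"
type_synonym 'm triple = "nword \<times> sign list \<times> ('m \<Rightarrow> complex)"
type_synonym 'm fock = "'m triple \<Rightarrow>\<^sub>0 complex"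

definition scl :: "complex \<Rightarrow> ('k \<Rightarrow>\<^sub>0 complex) \<Rightarrow> ('k \<Rightarrow>\<^sub>0 complex)" where
  "scl z v = Poly_Mapping.map ((*) z) v"

lemma lookup_scl [simp]: "Poly_Mapping.lookup (scl z v) k = z * Poly_Mapping.lookup v k"
  by (simp add: scl_def Poly_Mapping.map.rep_eq when_def)

global_interpretation fock: vector_space scl
  by unfold_locales (auto intro!: poly_mapping_eqI simp: lookup_add algebra_simps)

abbreviation ftriple :: "nword \<Rightarrow> sign list \<Rightarrow> ('m \<Rightarrow> complex) \<Rightarrow> 'm fock" where
  "ftriple a b u \<equiv> Poly_Mapping.single (a, b, u) 1"

definition linear_extension :: "('k \<Rightarrow> ('k \<Rightarrow>\<^sub>0 complex)) \<Rightarrow> ('k \<Rightarrow>\<^sub>0 complex) \<Rightarrow> ('k \<Rightarrow>\<^sub>0 complex)" where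
  "linear_extension T v = (\<Sum>k\<in>Poly_Mapping.keys v. scl (Poly_Mapping.lookup v k) (T k))"

definition valid_nword :: "nword \<Rightarrow> bool" where
  "valid_nword a \<longleftrightarrow> (\<forall>(s, m)\<in>set a. m \<ge> 1)"

text \<open>The last family expresses \<open>bX \<otimes> u = b \<otimes> X\<cdot>u\<close> for a parallel section \<open>X\<close> whose value at
  \<open>p\<close> is the combination of words with coefficients \<open>\<xi>\<close>. The vectors \<open>e1\<close>, \<open>e2\<close> at \<open>p\<close> are
  given by their components in the chart \<open>c0\<close>.\<close>

definition tensor_relations ::
    "'m chart set \<Rightarrow> 'm metric \<Rightarrow> 'm chart \<Rightarrow> 'm \<Rightarrow> real^2 \<Rightarrow> real^2 \<Rightarrow> 'm set \<Rightarrow> 'm fock set" where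
  "tensor_relations A g c0 p e1 e2 U =
     {ftriple a b (\<lambda>x. z * u x + z' * u' x) - scl z (ftriple a b u) - scl z' (ftriple a b u') | a b z z' u u'.
        valid_nword a \<and> u \<in> smooth_functions A U \<and> u' \<in> smooth_functions A U} \<union>
     {(\<Sum>w | length w = k. scl (\<xi> w) (ftriple a (b @ w) u)) - ftriple a b u' | a b k X \<xi> u u'.
        valid_nword a \<and> parallel_section A g k X \<and>
        (\<forall>I. length I = k \<longrightarrow> X c0 p I = (\<Sum>w | length w = k. \<xi> w * word_tensor e1 e2 w I)) \<and>
        u \<in> smooth_functions A U \<and> u' \<in> smooth_functions A U \<and> acts_to A g U k X u u'}"


section \<open>Modes and vertex operators\<close>

definition create :: "sign \<Rightarrow> nat \<Rightarrow> 'm fock \<Rightarrow> 'm fock" where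
  "create s m = linear_extension (\<lambda>(a, b, u). ftriple ((s, m) # a) b u)"

definition zero_mode :: "sign \<Rightarrow> 'm fock \<Rightarrow> 'm fock" where
  "zero_mode s = linear_extension (\<lambda>(a, b, u). ftriple a (s # b) u)"

primrec annihilate_word ::
    "complex \<Rightarrow> sign \<Rightarrow> nat \<Rightarrow> nword \<Rightarrow> sign list \<Rightarrow> ('m \<Rightarrow> complex) \<Rightarrow> 'm fock" where
  "annihilate_word l s m [] b u = 0"
| "annihilate_word l s m (y # a) b u =
     create (fst y) (snd y) (annihilate_word l s m a b u) +
     (if snd y = m then scl (of_nat m * hpair s (fst y) * l) (ftriple a b u) else 0)"

definition annihilate :: "complex \<Rightarrow> sign \<Rightarrow> nat \<Rightarrow> 'm fock \<Rightarrow> 'm fock" where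
  "annihilate l s m = linear_extension (\<lambda>(a, b, u). annihilate_word l s m a b u)"

text \<open>\<open>h_mode l s n\<close> is \<open>h\<^sub>s(n)\<close>.\<close>

definition h_mode :: "complex \<Rightarrow> sign \<Rightarrow> int \<Rightarrow> 'm fock \<Rightarrow> 'm fock" where
  "h_mode l s n = (if n < 0 then create s (nat (- n)) else
                   if n = 0 then zero_mode s else annihilate l s (nat n))"

definition normal_ordered :: "complex \<Rightarrow> (sign \<times> int) list \<Rightarrow> 'm fock \<Rightarrow> 'm fock" where
  "normal_ordered l xs = foldr (\<lambda>(s, n). h_mode l s n)
     (filter (\<lambda>(s, n). n < 0) xs @ filter (\<lambda>(s, n). n > 0) xs @ filter (\<lambda>(s, n). n = 0) xs)"

text \<open>
  A basis word \<open>h\<^sub>i\<^sub>1(-m\<^sub>1)\<cdots>h\<^sub>i\<^sub>s(-m\<^sub>s)\<one>\<close> of \<open>V\<close> is represented by the list of the pairs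
  \<open>(i\<^sub>j, m\<^sub>j)\<close>. Its mode of index \<open>N\<close> is the coefficient of \<open>x\<^sup>-\<^sup>N\<^sup>-\<^sup>1\<close>, obtained from
  \[ \frac{1}{(m-1)!} \frac{d^{m-1}}{dx^{m-1}} h(x) = \sum_n {-n-1 \choose m-1} h(n) x^{-n-m}. \]
  On each vector only finitely many tuples of modes have a nonzero contribution, so \<open>Sum_any\<close> is
  a finite sum.
\<close>

definition V_words :: "nword set" where
  "V_words = {v. valid_nword v \<and> charge (map fst v) = 0}"

definition vertex_mode :: "complex \<Rightarrow> nword \<Rightarrow> int \<Rightarrow> 'm fock \<Rightarrow> 'm fock" where
  "vertex_mode l v N y = Sum_any (\<lambda>ns :: int list.
     if length ns = length v \<and> sum_list ns + int (sum_list (map snd v)) = N + 1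
     then scl (\<Prod>j<length v. of_int (- (ns ! j) - 1) gchoose (snd (v ! j) - 1))
              (normal_ordered l (zip (map fst v) ns) y)
     else 0)"


section \<open>The modules and their quotients\<close>

text \<open>Preimage of \<open>V\<^sub>U(l,f)\<close>, where \<open>R\<close> is the set of relations defining \<open>F(S)\<close>. The modes of
  arbitrary elements of \<open>V\<close> are linear combinations of those of the basis words.\<close>

definition VU :: "'m fock set \<Rightarrow> complex \<Rightarrow> ('m \<Rightarrow> complex) \<Rightarrow> 'm fock set" where
  "VU R l f = fock.span (R \<union> {vertex_mode l v N (ftriple [] [] f) | v N. v \<in> V_words})"

definition wt :: "'m triple \<Rightarrow> nat" where
  "wt = (\<lambda>(a, b, u). sum_list (map snd a))"

definition homogeneous :: "'m fock \<Rightarrow> bool" where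
  "homogeneous y \<longleftrightarrow> (\<exists>n. \<forall>k\<in>Poly_Mapping.keys y. wt k = n)"

definition graded_submodule :: "complex \<Rightarrow> 'm fock set \<Rightarrow> bool" where
  "graded_submodule l N \<longleftrightarrow> fock.subspace N \<and> N \<subseteq> fock.span {y\<in>N. homogeneous y} \<and>
     (\<forall>v\<in>V_words. \<forall>n. \<forall>y\<in>N. vertex_mode l v n y \<in> N)"

definition generated_submodule :: "complex \<Rightarrow> 'm fock set \<Rightarrow> 'm fock set" where
  "generated_submodule l G = \<Inter>{N. graded_submodule l N \<and> G \<subseteq> N}"

text \<open>In \<open>Cconst\<close> the indices of the signs start at 0, so that \<open>s\<^sub>q\<close> is \<open>charge (drop q js)\<close>.\<close>

definition Cconst :: "real \<Rightarrow> complex \<Rightarrow> sign list \<Rightarrow> complex" where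
  "Cconst K lam js = (\<Prod>q | q < length js \<and> \<bar>charge (drop q js)\<bar> < \<bar>charge (drop (Suc q) js)\<bar>.
     - lam + of_int (\<bar>charge (drop (Suc q) js)\<bar> * (\<bar>charge (drop (Suc q) js)\<bar> - 1)) * of_real K)"

text \<open>The word \<open>h\<^sub>\<epsilon>\<^sup>N\<close> with the charge \<open>n = \<epsilon>N\<close>.\<close>

definition straight_word :: "int \<Rightarrow> sign list" where
  "straight_word n = replicate (nat \<bar>n\<bar>) (if n > 0 then Plus else Minus)"

definition gens1 :: "real \<Rightarrow> complex \<Rightarrow> ('m \<Rightarrow> complex) \<Rightarrow> 'm fock set" where
  "gens1 K lam f = {ftriple a b f - scl (Cconst K lam b) (ftriple a (straight_word (charge b)) f) | a b.
     valid_nword a \<and> charge (map fst a) + charge b = 0}"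

definition gens2 :: "('m \<Rightarrow> complex) \<Rightarrow> 'm fock set" where
  "gens2 f = {ftriple a b f - ftriple (permute_list \<tau> a) b f | a b \<tau>.
     valid_nword a \<and> charge (map fst a) + charge b = 0 \<and> \<tau> permutes {..<length a}}"

text \<open>\<open>h\<^sub>s(-t\<^sub>1)\<cdots>h\<^sub>s(-t\<^sub>r\<^sub>/\<^sub>2) h\<^sub>-\<^sub>s(-t\<^sub>r\<^sub>/\<^sub>2\<^sub>+\<^sub>1)\<cdots>h\<^sub>-\<^sub>s(-t\<^sub>k) h\<^sub>-\<^sub>s(0)\<^sup>r\<^sup>-\<^sup>k f\<close> with weakly decreasing
  sequences \<open>ts\<close> and \<open>us\<close> of modes\<close>

definition sorted_monomials :: "('m \<Rightarrow> complex) \<Rightarrow> sign \<Rightarrow> nat \<Rightarrow> nat \<Rightarrow> 'm fock set" where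
  "sorted_monomials f s r k =
     {ftriple (map (Pair s) ts @ map (Pair (neg s)) us) (replicate (r - k) (neg s)) f | ts us.
        length ts = r div 2 \<and> length us = k - r div 2 \<and>
        sorted_wrt (\<ge>) ts \<and> sorted_wrt (\<ge>) us \<and> (\<forall>t\<in>set ts \<union> set us. t \<ge> 1)}"

definition gens3 :: "nat \<Rightarrow> ('m \<Rightarrow> complex) \<Rightarrow> 'm fock set" where
  "gens3 P f = \<Union>{sorted_monomials f s r k | s r k. even r \<and> r \<ge> k + P \<and> r div 2 \<le> k}"

text \<open>The kernels of the maps from the preimage of \<open>V\<^sub>U(l,f)\<close> onto its successive quotients\<close>

definition kernel1 ::
    "'m fock set \<Rightarrow> complex \<Rightarrow> real \<Rightarrow> complex \<Rightarrow> ('m \<Rightarrow> complex) \<Rightarrow> 'm fock set" where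
  "kernel1 R l K lam f = generated_submodule l (R \<union> gens1 K lam f)"

definition kernel2 ::
    "'m fock set \<Rightarrow> complex \<Rightarrow> real \<Rightarrow> complex \<Rightarrow> ('m \<Rightarrow> complex) \<Rightarrow> 'm fock set" where
  "kernel2 R l K lam f = generated_submodule l (kernel1 R l K lam f \<union> gens2 f)"

definition kernel3 ::
    "'m fock set \<Rightarrow> complex \<Rightarrow> real \<Rightarrow> complex \<Rightarrow> nat \<Rightarrow> ('m \<Rightarrow> complex) \<Rightarrow> 'm fock set" where
  "kernel3 R l K lam P f = generated_submodule l (kernel2 R l K lam f \<union> gens3 P f)"

text \<open>\<open>B\<close> represents a basis of the quotient space \<open>W/N\<close>; distinct elements of \<open>B\<close> represent
  distinct basis vectors.\<close>

definition basis_of_quotient ::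
    "('k \<Rightarrow>\<^sub>0 complex) set \<Rightarrow> ('k \<Rightarrow>\<^sub>0 complex) set \<Rightarrow> ('k \<Rightarrow>\<^sub>0 complex) set \<Rightarrow> bool" where
  "basis_of_quotient W N B \<longleftrightarrow> fock.subspace W \<and> fock.subspace N \<and> N \<subseteq> W \<and> B \<subseteq> W \<and>
     (\<forall>y\<in>W. \<exists>x\<in>fock.span B. y - x \<in> N) \<and>
     (\<forall>T z. finite T \<and> T \<subseteq> B \<and> (\<Sum>b\<in>T. scl (z b) b) \<in> N \<longrightarrow> (\<forall>b\<in>T. z b = 0))"

end

theory Submission
  imports Defs
begin

text \<open>
  By interpolation of binomial coefficients, the modes of the basis words of \<open>V\<close> applied to \<open>f\<close> span all
  neutral monomials, and the relations of the three quotients reduce these to the sorted ones.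

  For the independence choose a chart around a point where \<open>f\<close> does not vanish and a null frame \<open>h\<^sub>\<plusminus>\<close>
  there. On functions of charge \<open>n\<close> the covariant derivatives along the frame satisfy
  \<open>[\<nabla>\<^sub>+,\<nabla>\<^sub>-] = -2nK\<close>, so the value of the iterated covariant derivative of \<open>u\<close> on a neutral word \<open>w\<close> is
  \<open>C\<^sub>w(-\<Delta>) u\<close>. The components of a parallel section vanish on charged words, because \<open>K \<noteq> 0\<close>, and are
  constant on neutral ones, up to the exchange of \<open>h\<^sub>+\<close> and \<open>h\<^sub>-\<close>, to which \<open>C\<^sub>w\<close> is insensitive.
  Hence \<open>F(S)\<close> maps to the polynomials in the negative modes with coefficients in copies, indexed by the
  charge \<open>n\<close> of the zero modes, of the functions on the chart; zero modes that lower \<open>|n|\<close> act by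
  \<open>\<Delta> + |n|(|n|-1)K\<close>. The polynomials with coefficients zero for \<open>|n| < P\<close> and eigenfunctions for
  \<open>|n| \<ge> P\<close> form a submodule since \<open>-\<lambda> + P(P-1)K = 0\<close>; all relations lie in its preimage, and the
  sorted monomials are independent modulo it.
\<close>

section \<open>Calculus in the plane\<close>

text \<open>Spanning is a finite rewriting; the difficulty lies in independence. The kernels are
  intersections of all graded submodules, and the tensor relations involve every parallel section of
  the surface, so neither is described explicitly. Both are only bounded from above: it suffices to
  exhibit one graded submodule that contains all relations and generators and over which the sorted
  monomials stay independent. Equality with the kernel is not claimed, which is why restricting
  functions to one chart and letting the negative modes commute does no harm. A single mode changes
  the charge and leads out of the module, so all spaces come in families indexed by the charge, and
  only neutral products of modes return to charge zero. The tensor relations prescribe a parallel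
  section by its value at \<open>p\<close>, whereas the model lives near a point where
  \<open>f\<close> does not vanish. Connectedness of the surface links the two: suitable frame
  components are locally constant functions, hence the same at both places.\<close>

definition dx :: "2 \<Rightarrow> (real^2 \<Rightarrow> 'b::real_normed_vector) \<Rightarrow> real^2 \<Rightarrow> 'b" where
  "dx i v y = frechet_derivative v (at y) (axis i 1)"

lemma Ck_on_Suc_iff:
  "Ck_on (Suc k) S v \<longleftrightarrow> (\<forall>y\<in>S. v differentiable (at y)) \<and> (\<forall>i. Ck_on k S (dx i v))"
  by (simp add: dx_def[abs_def])

declare Ck_on.simps(2) [simp del]

text \<open>\<open>frechet_derivative\<close> is a choice among all derivatives, and functions that
  agree near the point have the same ones; this covers points without a derivative as well.\<close>

lemma frechet_derivative_cong_open:
  assumes "open S" "y \<in> S" "\<And>z. z \<in> S \<Longrightarrow> u z = v z"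
  shows "frechet_derivative u (at y) = frechet_derivative v (at y)"
proof -
  have "(u has_derivative D) (at y) \<longleftrightarrow> (v has_derivative D) (at y)" for D
    using assms has_derivative_transform_within_open[of u D y UNIV S v]
      has_derivative_transform_within_open[of v D y UNIV S u] by auto
  then show ?thesis by (simp add: frechet_derivative_def)
qed

lemma dx_cong:
  assumes "open S" "y \<in> S" "\<And>z. z \<in> S \<Longrightarrow> u z = v z"
  shows "dx i u y = dx i v y"
  using frechet_derivative_cong_open[OF assms] by (simp add: dx_def)

lemma differentiable_cong_open:
  assumes "open S" "y \<in> S" "\<And>z. z \<in> S \<Longrightarrow> u z = v z" "u differentiable (at y)"
  shows "v differentiable (at y)"
  using assms has_derivative_transform_within_open[of u _ y UNIV S v]
  unfolding differentiable_def by blast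

lemma Ck_on_cong:
  assumes "open S" "\<And>z. z \<in> S \<Longrightarrow> u z = v z" "Ck_on k S u"
  shows "Ck_on k S v"
  using assms(2,3)
proof (induction k arbitrary: u v)
  case 0
  then show ?case using continuous_on_cong[of S S u v] by simp
next
  case (Suc k)
  have "Ck_on k S (dx i v)" for i
  proof (rule Suc.IH)
    show "dx i u z = dx i v z" if "z \<in> S" for z by (rule dx_cong[OF assms(1) that Suc.prems(1)])
    show "Ck_on k S (dx i u)" using Suc.prems(2) by (simp add: Ck_on_Suc_iff)
  qed
  moreover have "v differentiable (at y)" if "y \<in> S" for y
    by (rule differentiable_cong_open[OF assms(1) that Suc.prems(1)])
      (use Suc.prems(2) that in \<open>auto simp: Ck_on_Suc_iff\<close>)
  ultimately show ?case by (simp add: Ck_on_Suc_iff)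
qed

text \<open>The recursion for order \<open>Suc k\<close> never mentions the lower orders; at the
  bottom differentiability supplies the continuity.\<close>

lemma Ck_on_Suc_imp: "Ck_on (Suc k) S v \<Longrightarrow> Ck_on k S v"
proof (induction k arbitrary: v)
  case 0
  then show ?case
    by (auto simp: Ck_on_Suc_iff intro!: continuous_at_imp_continuous_on differentiable_imp_continuous_within)
next
  case (Suc k)
  then show ?case by (auto simp: Ck_on_Suc_iff[of "Suc k"] Ck_on_Suc_iff[of k])
qed

lemma Ck_on_subset: "Ck_on k S v \<Longrightarrow> T \<subseteq> S \<Longrightarrow> Ck_on k T v"
  by (induction k arbitrary: v) (auto simp: Ck_on_Suc_iff intro: continuous_on_subset)

lemma dx_eqI: "(v has_derivative D) (at y) \<Longrightarrow> dx i v y = D (axis i 1)"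
  by (metis dx_def frechet_derivative_at)

lemma has_derivative_frechet:
  "v differentiable (at y) \<Longrightarrow> (v has_derivative frechet_derivative v (at y)) (at y)"
  by (simp add: frechet_derivative_works)

lemma dx_const [simp]: "dx i (\<lambda>y. a) y = 0"
  by (simp add: dx_def)

lemma dx_add:
  assumes "u differentiable (at y)" "v differentiable (at y)"
  shows "dx i (\<lambda>z. u z + v z) y = dx i u y + dx i v y"
  unfolding dx_def using assms
  by (simp add: frechet_derivative_at[OF has_derivative_add[OF has_derivative_frechet has_derivative_frechet], symmetric])

lemma dx_mult:
  fixes u v :: "real^2 \<Rightarrow> 'b::real_normed_algebra"
  assumes "u differentiable (at y)" "v differentiable (at y)"
  shows "dx i (\<lambda>z. u z * v z) y = u y * dx i v y + dx i u y * v y"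
  unfolding dx_def using assms
  by (simp add: frechet_derivative_at[OF has_derivative_mult[OF has_derivative_frechet has_derivative_frechet], symmetric])

lemma dx_bounded_linear:
  assumes "bounded_linear h" "u differentiable (at y)"
  shows "dx i (\<lambda>z. h (u z)) y = h (dx i u y)"
  unfolding dx_def
  using frechet_derivative_at[OF bounded_linear.has_derivative[OF assms(1) has_derivative_frechet[OF assms(2)]], symmetric]
  by simp

lemma differentiable_bounded_linear:
  assumes "bounded_linear h" "u differentiable (at y)"
  shows "(\<lambda>z. h (u z)) differentiable (at y)"
  using bounded_linear.has_derivative[OF assms(1) has_derivative_frechet[OF assms(2)]]
  unfolding differentiable_def by blast

lemma Ck_on_bounded_linear:
  assumes "bounded_linear h" "open S" "Ck_on k S u"
  shows "Ck_on k S (\<lambda>z. h (u z))"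
  using assms(3)
proof (induction k arbitrary: u)
  case 0
  then show ?case by (simp add: bounded_linear.continuous_on[OF assms(1)])
next
  case (Suc k)
  have "Ck_on k S (dx i (\<lambda>z. h (u z)))" for i
    by (rule Ck_on_cong[OF assms(2) _ Suc.IH[of "dx i u"]])
      (use Suc.prems dx_bounded_linear[OF assms(1), symmetric] in \<open>auto simp: Ck_on_Suc_iff\<close>)
  then show ?case using Suc.prems differentiable_bounded_linear[OF assms(1)]
    by (auto simp: Ck_on_Suc_iff)
qed

lemma Ck_on_const: "Ck_on k S (\<lambda>y. a)"
proof (induction k arbitrary: a)
  case (Suc k)
  have "dx i (\<lambda>y. a) = (\<lambda>y. 0)" for i by (rule ext) simp
  then show ?case using Suc by (simp add: Ck_on_Suc_iff)
qed simp

lemma Ck_on_add: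
  assumes "open S" "Ck_on k S u" "Ck_on k S v"
  shows "Ck_on k S (\<lambda>z. u z + v z)"
  using assms(2,3)
proof (induction k arbitrary: u v)
  case 0
  then show ?case by (simp add: continuous_on_add)
next
  case (Suc k)
  have "Ck_on k S (dx i (\<lambda>z. u z + v z))" for i
    by (rule Ck_on_cong[OF assms(1) _ Suc.IH[of "dx i u" "dx i v"]])
      (use Suc.prems in \<open>auto simp: Ck_on_Suc_iff dx_add\<close>)
  then show ?case using Suc.prems
    by (auto simp: Ck_on_Suc_iff)
qed

lemma Ck_on_mult:
  fixes u v :: "real^2 \<Rightarrow> 'b::real_normed_algebra"
  assumes "open S" "Ck_on k S u" "Ck_on k S v"
  shows "Ck_on k S (\<lambda>z. u z * v z)"
  using assms(2,3)
proof (induction k arbitrary: u v)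
  case 0
  then show ?case by (simp add: continuous_on_mult)
next
  case (Suc k)
  have "Ck_on k S (dx i (\<lambda>z. u z * v z))" for i
    by (rule Ck_on_cong[OF assms(1) _ Ck_on_add[OF assms(1) Suc.IH[of u "dx i v"] Suc.IH[of "dx i u" v]]])
      (use Suc.prems Ck_on_Suc_imp[OF Suc.prems(1)] Ck_on_Suc_imp[OF Suc.prems(2)] in \<open>auto simp: Ck_on_Suc_iff dx_mult\<close>)
  then show ?case using Suc.prems
    by (auto simp: Ck_on_Suc_iff)
qed

lemma powr_has_derivative_at:
  fixes u :: "real^2 \<Rightarrow> real"
  assumes "u differentiable (at y)" "u y > 0"
  shows "((\<lambda>z. u z powr a) has_derivative (\<lambda>h. a * u y powr (a - 1) * frechet_derivative u (at y) h)) (at y)"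
proof -
  have "((\<lambda>z. u z powr a) has_derivative
      (\<lambda>h. u y powr a * (0 * ln (u y) + frechet_derivative u (at y) h * a / u y))) (at y)"
    by (rule has_derivative_powr[OF has_derivative_frechet[OF assms(1)] has_derivative_const])
      (use assms(2) in auto)
  then show ?thesis
    by (rule has_derivative_eq_rhs) (use assms(2) in \<open>auto simp: fun_eq_iff powr_diff field_simps\<close>)
qed

text \<open>An arbitrary real exponent closes the induction, since differentiation turns
  \<open>a\<close> into \<open>a - 1\<close>. Inverses and square roots are the exponents -1 and
  1/2.\<close>

lemma Ck_on_powr:
  fixes u :: "real^2 \<Rightarrow> real"
  assumes "open S" "Ck_on k S u" "\<And>z. z \<in> S \<Longrightarrow> u z > 0"
  shows "Ck_on k S (\<lambda>z. u z powr a)"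
  using assms(2)
proof (induction k arbitrary: a)
  case 0
  have "\<forall>z\<in>S. u z \<noteq> 0" using assms(3) by force
  with 0 show ?case
    by (auto intro!: continuous_intros)
next
  case (Suc k)
  have d: "u differentiable (at y)" if "y \<in> S" for y using Suc.prems that by (auto simp: Ck_on_Suc_iff)
  have "Ck_on k S (dx i (\<lambda>z. u z powr a))" for i
  proof (rule Ck_on_cong[OF assms(1)])
    show "Ck_on k S (\<lambda>z. a * u z powr (a - 1) * dx i u z)"
      using Suc Ck_on_Suc_imp[OF Suc.prems]
      by (intro Ck_on_mult Ck_on_const) (auto simp: Ck_on_Suc_iff assms(1))
    show "a * u z powr (a - 1) * dx i u z = dx i (\<lambda>z. u z powr a) z" if "z \<in> S" for z
      using dx_eqI[OF powr_has_derivative_at[OF d[OF that] assms(3)[OF that]]] by (simp add: dx_def)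
  qed
  then show ?case using powr_has_derivative_at[OF d assms(3)]
    unfolding Ck_on_Suc_iff differentiable_def by blast
qed

lemma smooth_on_dx: "smooth_on S v \<Longrightarrow> smooth_on S (dx i v)"
  unfolding smooth_on_def using Ck_on_Suc_iff by blast

lemma smooth_on_differentiable: "smooth_on S v \<Longrightarrow> y \<in> S \<Longrightarrow> v differentiable (at y)"
  unfolding smooth_on_def using Ck_on_Suc_iff by blast

lemma smooth_on_subset: "smooth_on S v \<Longrightarrow> T \<subseteq> S \<Longrightarrow> smooth_on T v"
  unfolding smooth_on_def using Ck_on_subset by blast

lemma smooth_on_cong: "open S \<Longrightarrow> (\<And>z. z \<in> S \<Longrightarrow> u z = v z) \<Longrightarrow> smooth_on S u \<Longrightarrow> smooth_on S v"
  unfolding smooth_on_def using Ck_on_cong by blast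

lemma smooth_on_const: "smooth_on S (\<lambda>y. a)"
  by (simp add: smooth_on_def Ck_on_const)

lemma smooth_on_add: "open S \<Longrightarrow> smooth_on S u \<Longrightarrow> smooth_on S v \<Longrightarrow> smooth_on S (\<lambda>z. u z + v z)"
  by (simp add: smooth_on_def Ck_on_add)

lemma smooth_on_mult:
  fixes u v :: "real^2 \<Rightarrow> 'b::real_normed_algebra"
  shows "open S \<Longrightarrow> smooth_on S u \<Longrightarrow> smooth_on S v \<Longrightarrow> smooth_on S (\<lambda>z. u z * v z)"
  by (simp add: smooth_on_def Ck_on_mult)

lemma smooth_on_minus:
  "open S \<Longrightarrow> smooth_on S u \<Longrightarrow> smooth_on S (\<lambda>z. - u z)"
  by (simp add: smooth_on_def Ck_on_bounded_linear[OF bounded_linear_minus[OF bounded_linear_ident]])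

lemma smooth_on_diff:
  "open S \<Longrightarrow> smooth_on S u \<Longrightarrow> smooth_on S v \<Longrightarrow> smooth_on S (\<lambda>z. u z - v z)"
  using smooth_on_add[of S u "\<lambda>z. - v z"] smooth_on_minus[of S v] by simp

lemma smooth_on_sum:
  "open S \<Longrightarrow> (\<And>a. a \<in> I \<Longrightarrow> smooth_on S (u a)) \<Longrightarrow> smooth_on S (\<lambda>z. \<Sum>a\<in>I. u a z)"
  by (induction I rule: infinite_finite_induct) (auto intro: smooth_on_const smooth_on_add)

lemma smooth_on_of_real:
  fixes u :: "real^2 \<Rightarrow> real"
  shows "open S \<Longrightarrow> smooth_on S u \<Longrightarrow> smooth_on S (\<lambda>z. of_real (u z) :: 'b::{real_normed_algebra_1})"
  by (simp add: smooth_on_def Ck_on_bounded_linear[OF bounded_linear_of_real])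

lemma smooth_on_powr:
  fixes u :: "real^2 \<Rightarrow> real"
  shows "open S \<Longrightarrow> smooth_on S u \<Longrightarrow> (\<And>z. z \<in> S \<Longrightarrow> u z > 0) \<Longrightarrow> smooth_on S (\<lambda>z. u z powr a)"
  by (simp add: smooth_on_def Ck_on_powr)

lemma smooth_on_inverse:
  fixes u :: "real^2 \<Rightarrow> real"
  assumes "open S" "smooth_on S u" "\<And>z. z \<in> S \<Longrightarrow> u z > 0"
  shows "smooth_on S (\<lambda>z. inverse (u z))"
  by (rule smooth_on_cong[OF assms(1) _ smooth_on_powr[OF assms, of "-1"]])
    (simp_all add: powr_minus_divide assms(3) less_imp_le inverse_eq_divide)

lemma smooth_on_sqrt:
  fixes u :: "real^2 \<Rightarrow> real"
  assumes "open S" "smooth_on S u" "\<And>z. z \<in> S \<Longrightarrow> u z > 0"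
  shows "smooth_on S (\<lambda>z. sqrt (u z))"
  by (rule smooth_on_cong[OF assms(1) _ smooth_on_powr[OF assms, of "1/2"]])
    (simp_all add: powr_half_sqrt assms(3) less_imp_le)

lemma dx_minus: "v differentiable (at y) \<Longrightarrow> dx i (\<lambda>z. - v z) y = - dx i v y"
  by (rule dx_bounded_linear[OF bounded_linear_minus[OF bounded_linear_ident]])

lemma dx_diff:
  assumes "u differentiable (at y)" "v differentiable (at y)"
  shows "dx i (\<lambda>z. u z - v z) y = dx i u y - dx i v y"
  using dx_add[of u y "\<lambda>z. - v z"] assms by (simp add: dx_minus)

lemma dx_of_real:
  "v differentiable (at y) \<Longrightarrow> dx i (\<lambda>z. of_real (v z) :: complex) y = of_real (dx i v y)"
  by (rule dx_bounded_linear[OF bounded_linear_of_real])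

lemma frechet_derivative_expand:
  assumes "v differentiable (at y)"
  shows "frechet_derivative v (at y) h = (\<Sum>i\<in>UNIV. h $ i *\<^sub>R dx i v y)"
proof -
  have l: "linear (frechet_derivative v (at y))"
    using has_derivative_linear[OF has_derivative_frechet[OF assms]] .
  have "h = (\<Sum>i\<in>UNIV. h $ i *\<^sub>R axis i 1)"
    using basis_expansion[of h] by (simp add: scalar_mult_eq_scaleR)
  then have "frechet_derivative v (at y) h = frechet_derivative v (at y) (\<Sum>i\<in>UNIV. h $ i *\<^sub>R axis i 1)" by simp
  then show ?thesis by (simp add: linear_sum[OF l] linear_scale[OF l] dx_def)
qed

section \<open>Equality of mixed partial derivatives\<close>

abbreviation (input) "ax i \<equiv> axis i (1::real)"

lemma has_field_derivative_along:
  fixes v :: "real^2 \<Rightarrow> real"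
  assumes "v differentiable (at (a + s *\<^sub>R ax i))"
  shows "((\<lambda>r. v (a + r *\<^sub>R ax i)) has_field_derivative dx i v (a + s *\<^sub>R ax i)) (at s)"
proof -
  have l: "linear (frechet_derivative v (at (a + s *\<^sub>R ax i)))"
    using has_derivative_linear[OF has_derivative_frechet[OF assms]] .
  have "((\<lambda>r. v (a + r *\<^sub>R ax i)) has_derivative
     (\<lambda>r. frechet_derivative v (at (a + s *\<^sub>R ax i)) (r *\<^sub>R ax i))) (at s)"
    by (rule has_derivative_compose[where g = v and f = "\<lambda>r. a + r *\<^sub>R ax i", OF _ has_derivative_frechet[OF assms]])
       (auto intro!: derivative_eq_intros)
  then show ?thesis
    by (simp add: has_field_derivative_def linear_scale[OF l] dx_def mult.commute[of _ "frechet_derivative _ _ _"])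
qed

text \<open>The mean value theorem is applied twice, first in direction \<open>i\<close> and then in
  direction \<open>j\<close>. The second difference is symmetric in the two directions while the
  order of differentiation is not; this is what yields the symmetry.\<close>

lemma mixed_difference:
  fixes v :: "real^2 \<Rightarrow> real"
  assumes sm: "Ck_on 2 (ball y e) v" and t: "t > 0" "2 * t < e" and ij: "i \<noteq> (j::2)"
  obtains z where "dist z y < 2 * t"
    "v (y + t *\<^sub>R ax i + t *\<^sub>R ax j) - v (y + t *\<^sub>R ax i) - v (y + t *\<^sub>R ax j) + v y
      = t * t * dx j (dx i v) z"
proof -
  have Ck2: "Ck_on (Suc (Suc 0)) (ball y e) v" using sm by (simp add: numeral_2_eq_2)
  have near: "dist (y + s *\<^sub>R ax i + r *\<^sub>R ax j) y \<le> \<bar>s\<bar> + \<bar>r\<bar>" for s r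
  proof -
    have "norm (s *\<^sub>R ax i + r *\<^sub>R ax j :: real^2) \<le> \<bar>s\<bar> + \<bar>r\<bar>"
      by (rule order_trans[OF norm_triangle_ineq]) simp
    then show ?thesis by (simp add: dist_norm add.assoc)
  qed
  have inb: "y + s *\<^sub>R ax i + r *\<^sub>R ax j \<in> ball y e" if "\<bar>s\<bar> \<le> t" "\<bar>r\<bar> \<le> t" for s r
    using near[of s r] that t by (simp add: dist_commute)
  have dv: "v differentiable (at z)" and ddv: "dx i v differentiable (at z)" if "z \<in> ball y e" for z
    using Ck2 that by (auto simp: Ck_on_Suc_iff)
  \<comment> \<open>The increment in direction \<open>j\<close> as a function of the position in
    direction \<open>i\<close>; its change from 0 to \<open>t\<close> is the second
    difference.\<close>
  define \<phi> where "\<phi> s = v (y + t *\<^sub>R ax j + s *\<^sub>R ax i) - v (y + s *\<^sub>R ax i)" for s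
  have d\<phi>: "DERIV \<phi> s :> dx i v (y + t *\<^sub>R ax j + s *\<^sub>R ax i) - dx i v (y + s *\<^sub>R ax i)"
    if "0 \<le> s" "s \<le> t" for s
    unfolding \<phi>_def
    using inb[of s t] inb[of s 0] that
    by (intro DERIV_diff has_field_derivative_along dv) (auto simp: add_ac)
  obtain s where s: "0 < s" "s < t"
    "\<phi> t - \<phi> 0 = (t - 0) * (dx i v (y + t *\<^sub>R ax j + s *\<^sub>R ax i) - dx i v (y + s *\<^sub>R ax i))"
    using MVT2[OF t(1), of \<phi>, OF d\<phi>] by auto
  define \<psi> where "\<psi> r = dx i v (y + s *\<^sub>R ax i + r *\<^sub>R ax j)" for r
  have d\<psi>: "DERIV \<psi> r :> dx j (dx i v) (y + s *\<^sub>R ax i + r *\<^sub>R ax j)" if "0 \<le> r" "r \<le> t" for r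
    unfolding \<psi>_def
    using inb[of s r] that s
    by (intro has_field_derivative_along ddv) auto
  obtain r where r: "0 < r" "r < t" "\<psi> t - \<psi> 0 = (t - 0) * dx j (dx i v) (y + s *\<^sub>R ax i + r *\<^sub>R ax j)"
    using MVT2[OF t(1), of \<psi>, OF d\<psi>] by auto
  show thesis
  proof (rule that)
    show "dist (y + s *\<^sub>R ax i + r *\<^sub>R ax j) y < 2 * t"
      using near[of s r] s(1,2) r(1,2) by simp
    have sw: "y + t *\<^sub>R ax j + s *\<^sub>R ax i = y + s *\<^sub>R ax i + t *\<^sub>R ax j"
      "y + t *\<^sub>R ax j + t *\<^sub>R ax i = y + t *\<^sub>R ax i + t *\<^sub>R ax j"
      by (simp_all add: add_ac)
    have "\<phi> t - \<phi> 0 = t * (\<psi> t - \<psi> 0)" using s(3) by (simp add: \<psi>_def sw)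
    also have "\<dots> = t * t * dx j (dx i v) (y + s *\<^sub>R ax i + r *\<^sub>R ax j)" using r(3) by simp
    finally show "v (y + t *\<^sub>R ax i + t *\<^sub>R ax j) - v (y + t *\<^sub>R ax i) - v (y + t *\<^sub>R ax j) + v y
      = t * t * dx j (dx i v) (y + s *\<^sub>R ax i + r *\<^sub>R ax j)"
      by (simp add: \<phi>_def sw(2))
  qed
qed

text \<open>For different directions both mixed derivatives are the same second difference divided
  by \<open>t * t\<close>, at points that can be taken arbitrarily near \<open>y\<close>; continuity
  does the rest.\<close>

lemma dx_commute_real:
  fixes v :: "real^2 \<Rightarrow> real"
  assumes sm: "Ck_on 2 S v" and S: "open S" "y \<in> S"
  shows "dx i (dx j v) y = dx j (dx i v) y"
proof (cases "i = j")
  case False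
  have Ck2: "Ck_on (Suc (Suc 0)) S v" using sm by (simp add: numeral_2_eq_2)
  have c: "isCont (dx j (dx i v)) y" for i j
    using Ck2 S by (auto simp: Ck_on_Suc_iff continuous_on_eq_continuous_at)
  have "\<bar>dx i (dx j v) y - dx j (dx i v) y\<bar> \<le> \<epsilon>" if "\<epsilon> > 0" for \<epsilon>
  proof -
    have "\<epsilon>/2 > 0" using that by simp
    obtain d1 where d1: "d1 > 0" "\<And>z. dist z y < d1 \<Longrightarrow> dist (dx j (dx i v) z) (dx j (dx i v) y) < \<epsilon>/2"
      using c[of j i] \<open>\<epsilon>/2 > 0\<close> unfolding continuous_at_eps_delta by blast
    obtain d2 where d2: "d2 > 0" "\<And>z. dist z y < d2 \<Longrightarrow> dist (dx i (dx j v) z) (dx i (dx j v) y) < \<epsilon>/2"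
      using c[of i j] \<open>\<epsilon>/2 > 0\<close> unfolding continuous_at_eps_delta by blast
    obtain e where e: "e > 0" "ball y e \<subseteq> S" using S open_contains_ball by blast
    \<comment> \<open>Dividing by 3 keeps \<open>2 * t\<close> strictly below all three
      radii.\<close>
    define t where "t = min e (min d1 d2) / 3"
    have t: "t > 0" "2 * t < e" "2 * t < d1" "2 * t < d2" using e d1 d2 by (auto simp: t_def)
    have b: "Ck_on 2 (ball y e) v" using Ck_on_subset[OF sm e(2)] .
    obtain z where z: "dist z y < 2 * t"
      "v (y + t *\<^sub>R ax i + t *\<^sub>R ax j) - v (y + t *\<^sub>R ax i) - v (y + t *\<^sub>R ax j) + v y = t * t * dx j (dx i v) z"
      by (rule mixed_difference[OF b t(1,2) False])
    obtain z' where z': "dist z' y < 2 * t"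
      "v (y + t *\<^sub>R ax j + t *\<^sub>R ax i) - v (y + t *\<^sub>R ax j) - v (y + t *\<^sub>R ax i) + v y = t * t * dx i (dx j v) z'"
      by (rule mixed_difference[OF b t(1,2) False[symmetric]])
    have sw: "v (y + t *\<^sub>R ax j + t *\<^sub>R ax i) = v (y + t *\<^sub>R ax i + t *\<^sub>R ax j)"
      by (simp add: add_ac)
    have "t * t * dx j (dx i v) z = t * t * dx i (dx j v) z'"
      using z(2) z'(2) unfolding sw by linarith
    then have "dx j (dx i v) z = dx i (dx j v) z'" using t(1) by simp
    moreover have "dist (dx j (dx i v) z) (dx j (dx i v) y) < \<epsilon>/2" "dist (dx i (dx j v) z') (dx i (dx j v) y) < \<epsilon>/2"
      by (rule d1(2)[OF less_trans[OF z(1) t(3)]] d2(2)[OF less_trans[OF z'(1) t(4)]])+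
    ultimately show ?thesis unfolding dist_real_def by linarith
  qed
  then have "\<bar>dx i (dx j v) y - dx j (dx i v) y\<bar> \<le> 0"
    by (meson dense_ge)
  then show ?thesis by simp
qed simp

lemma dx_commute:
  fixes v :: "real^2 \<Rightarrow> complex"
  assumes sm: "smooth_on S v" and S: "open S" "y \<in> S"
  shows "dx i (dx j v) y = dx j (dx i v) y"
proof -
  \<comment> \<open>The mean value theorem is a statement about real functions, so the complex case
    goes through real and imaginary parts, treated together as bounded linear functionals.\<close>
  have *: "h (dx i (dx j v) y) = h (dx j (dx i v) y)" if h: "bounded_linear h" for h :: "complex \<Rightarrow> real"
  proof -
    have e: "dx i (dx j (\<lambda>z. h (v z))) y = h (dx i (dx j v) y)" for i j
    proof -
      have "dx i (dx j (\<lambda>z. h (v z))) y = dx i (\<lambda>z. h (dx j v z)) y"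
        by (rule dx_cong[OF S]) (simp add: dx_bounded_linear[OF h smooth_on_differentiable[OF sm]])
      also have "\<dots> = h (dx i (dx j v) y)"
        by (rule dx_bounded_linear[OF h smooth_on_differentiable[OF smooth_on_dx[OF sm] S(2)]])
      finally show ?thesis .
    qed
    have "Ck_on 2 S (\<lambda>z. h (v z))"
      using sm Ck_on_bounded_linear[OF h S(1)] by (simp add: smooth_on_def)
    from dx_commute_real[OF this S, of i j] show ?thesis by (simp add: e)
  qed
  show ?thesis using *[OF bounded_linear_Re] *[OF bounded_linear_Im] by (simp add: complex_eq_iff)
qed

section \<open>Null frames and the connection form\<close>

text \<open>The pairing is complex bilinear rather than Hermitian, so nonzero vectors can be
  isotropic. The normalisation is that of the vectors h_+ and h_- at \<open>p\<close>.\<close>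

definition null_frame :: "(2 \<Rightarrow> 2 \<Rightarrow> complex) \<Rightarrow> (sign \<Rightarrow> 2 \<Rightarrow> complex) \<Rightarrow> bool" where
  "null_frame M h \<longleftrightarrow> (\<forall>i j. M i j = M j i) \<and>
     (\<forall>s t. (\<Sum>i\<in>UNIV. \<Sum>j\<in>UNIV. M i j * h s i * h t j) = hpair s t)"

text \<open>The dual basis: since \<open>h s\<close> pairs to 2 with \<open>h (neg s)\<close> and to
  0 with itself, its dual covector is half the pairing with \<open>h (neg s)\<close>.\<close>

definition coframe :: "(2 \<Rightarrow> 2 \<Rightarrow> complex) \<Rightarrow> (sign \<Rightarrow> 2 \<Rightarrow> complex) \<Rightarrow> sign \<Rightarrow> 2 \<Rightarrow> complex" where
  "coframe M h s i = (\<Sum>j\<in>UNIV. M i j * h (neg s) j) / 2"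

lemma neg_neg [simp]: "neg (neg s) = s"
  by (cases s) simp_all

lemma sval_neg [simp]: "sval (neg s) = - sval s"
  by (cases s) simp_all

lemma neg_neq [simp]: "neg s \<noteq> s" "s \<noteq> neg s"
  by (cases s; simp)+

lemma neq_iff_neg: "s \<noteq> t \<longleftrightarrow> t = neg s"
  by (cases s; cases t) simp_all

lemma UNIV_sign: "(UNIV :: sign set) = {Plus, Minus}"
  using sign.exhaust by auto

instance sign :: finite
  by standard (simp add: UNIV_sign)

lemma sum_sign: "(\<Sum>s\<in>UNIV. u s) = u Plus + u Minus"
  by (simp add: UNIV_sign)

lemma null_frame_sum:
  assumes "null_frame M h"
  shows "(\<Sum>i\<in>UNIV. (\<Sum>j\<in>UNIV. M i j * h t j) * h s i) = hpair s t"
proof -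
  have "(\<Sum>i\<in>UNIV. (\<Sum>j\<in>UNIV. M i j * h t j) * h s i) = (\<Sum>i\<in>UNIV. \<Sum>j\<in>UNIV. M i j * h s i * h t j)"
    by (simp add: sum_2 algebra_simps)
  then show ?thesis using assms by (simp add: null_frame_def)
qed

lemma coframe_frame:
  assumes "null_frame M h"
  shows "(\<Sum>i\<in>UNIV. coframe M h s i * h t i) = (if s = t then 1 else 0)"
proof -
  have "(\<Sum>i\<in>UNIV. coframe M h s i * h t i) = (\<Sum>i\<in>UNIV. (\<Sum>j\<in>UNIV. M i j * h (neg s) j) * h t i) / 2"
    by (simp add: coframe_def sum_2 field_simps)
  then show ?thesis
    unfolding null_frame_sum[OF assms] by (cases s; cases t) (auto simp: hpair_def)
qed

text \<open>Frame and coframe form square matrices, so the left inverse found in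
  \<open>coframe_frame\<close> is also a right inverse.\<close>

lemma frame_coframe:
  assumes "null_frame M h"
  shows "(\<Sum>s\<in>UNIV. h s i * coframe M h s j) = (if i = j then 1 else 0)"
proof -
  let ?e = "coframe M h"
  have 1: "?e Plus 1 * h Plus 1 + ?e Plus 2 * h Plus 2 = 1"
    "?e Plus 1 * h Minus 1 + ?e Plus 2 * h Minus 2 = 0"
    "?e Minus 1 * h Plus 1 + ?e Minus 2 * h Plus 2 = 0"
    "?e Minus 1 * h Minus 1 + ?e Minus 2 * h Minus 2 = 1"
    using coframe_frame[OF assms, unfolded sum_2] by simp_all
  have "h Plus 1 * ?e Plus 1 + h Minus 1 * ?e Minus 1 = 1"
    "h Plus 1 * ?e Plus 2 + h Minus 1 * ?e Minus 2 = 0"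
    "h Plus 2 * ?e Plus 1 + h Minus 2 * ?e Minus 1 = 0"
    "h Plus 2 * ?e Plus 2 + h Minus 2 * ?e Minus 2 = 1"
    using 1 by algebra+
  then show ?thesis
    using exhaust_2[of i] exhaust_2[of j] by (auto simp: sum_sign)
qed

lemma metric_coframe:
  assumes "null_frame M h"
  shows "M i j = 2 * (\<Sum>s\<in>UNIV. coframe M h (neg s) i * coframe M h s j)"
proof -
  have "M i j = (\<Sum>k\<in>UNIV. M i k * (if k = j then 1 else 0))"
    using exhaust_2[of j] by (auto simp: sum_2)
  also have "\<dots> = (\<Sum>k\<in>UNIV. M i k * (\<Sum>s\<in>UNIV. h s k * coframe M h s j))"
    by (simp add: frame_coframe[OF assms])
  also have "\<dots> = 2 * (\<Sum>s\<in>UNIV. coframe M h (neg s) i * coframe M h s j)"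
    by (simp add: sum_2 sum_sign coframe_def[of M h _ i] field_simps)
  finally show ?thesis .
qed

text \<open>The null lines of a metric are intrinsic, hence a null frame is unique up to scaling and exchange.\<close>

lemma coframe_compare:
  assumes "null_frame M h" "null_frame M h'"
  obtains \<mu> \<sigma> where "\<sigma> = id \<or> \<sigma> = neg" "\<mu> Plus * \<mu> Minus = 1"
    "\<And>s i. coframe M h' s i = \<mu> s * coframe M h (\<sigma> s) i"
proof -
  \<comment> \<open>\<open>m s t\<close> is the coefficient of \<open>h t\<close> in
    \<open>h' s\<close>. Isotropy kills an entry in each row, and the mutual pairing 2 makes the
    product of the two surviving entries 1, so the matrix is diagonal or antidiagonal.\<close>
  define m where "m s t = (\<Sum>i\<in>UNIV. coframe M h t i * h' s i)" for s t
  have h': "h' s i = (\<Sum>t\<in>UNIV. m s t * h t i)" for s i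
  proof -
    have "h' s i = (\<Sum>j\<in>UNIV. (if i = j then 1 else 0) * h' s j)"
      using exhaust_2[of i] by (auto simp: sum_2)
    also have "\<dots> = (\<Sum>j\<in>UNIV. (\<Sum>t\<in>UNIV. h t i * coframe M h t j) * h' s j)"
      by (simp add: frame_coframe[OF assms(1)])
    also have "\<dots> = (\<Sum>t\<in>UNIV. m s t * h t i)" by (simp add: m_def sum_2 sum_sign algebra_simps)
    finally show ?thesis .
  qed
  have co: "coframe M h' s i = (\<Sum>t\<in>UNIV. m (neg s) t * coframe M h (neg t) i)" for s i
    by (simp add: coframe_def h' sum_2 sum_sign algebra_simps add_divide_distrib)
  have pair: "hpair s t = (\<Sum>a\<in>UNIV. \<Sum>b\<in>UNIV. m s a * m t b * hpair a b)" for s t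
  proof -
    have "hpair s t = (\<Sum>i\<in>UNIV. \<Sum>j\<in>UNIV. M i j * h' s i * h' t j)"
      using assms(2) by (simp add: null_frame_def)
    also have "\<dots> = (\<Sum>a\<in>UNIV. \<Sum>b\<in>UNIV. m s a * m t b * (\<Sum>i\<in>UNIV. \<Sum>j\<in>UNIV. M i j * h a i * h b j))"
      unfolding h' sum_2 sum_sign by (simp add: algebra_simps)
    also have "\<dots> = (\<Sum>a\<in>UNIV. \<Sum>b\<in>UNIV. m s a * m t b * hpair a b)"
      using assms(1) by (simp add: null_frame_def)
    finally show ?thesis .
  qed
  have e: "m Plus Plus * m Plus Minus = 0" "m Minus Plus * m Minus Minus = 0"
    "m Plus Plus * m Minus Minus + m Plus Minus * m Minus Plus = 1"
  proof -
    have *: "a * d + b * c = 1" if "a * d * 2 + b * c * 2 = 2" for a b c d :: complex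
    proof -
      have "2 * (a * d + b * c) = 2 * 1" using that by (simp add: distrib_left mult.commute[of 2])
      then show ?thesis unfolding mult_cancel_left by simp
    qed
    show "m Plus Plus * m Plus Minus = 0" "m Minus Plus * m Minus Minus = 0"
      using pair[of Plus Plus] pair[of Minus Minus] by (auto simp: sum_sign hpair_def)
    show "m Plus Plus * m Minus Minus + m Plus Minus * m Minus Plus = 1"
      by (rule *) (use pair[of Plus Minus] in \<open>simp add: sum_sign hpair_def\<close>)
  qed
  show thesis
  proof (cases "m Plus Plus = 0")
    case True
    then have "m Plus Minus * m Minus Plus = 1" "m Minus Minus = 0" using e by auto
    moreover from this True have "coframe M h' s i = m (neg s) s * coframe M h (neg s) i" for s i
      by (cases s) (simp_all add: co sum_sign)
    ultimately show thesis
      by (intro that[of neg "\<lambda>s. m (neg s) s"]) (auto simp: mult.commute)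
  next
    case False
    then have "m Plus Minus = 0" "m Minus Minus * m Plus Plus = 1" "m Minus Plus = 0"
      using e by (auto simp: mult.commute)
    moreover from this have "coframe M h' s i = m (neg s) (neg s) * coframe M h s i" for s i
      by (cases s) (simp_all add: co sum_sign)
    ultimately show thesis
      by (intro that[of id "\<lambda>s. m (neg s) (neg s)"]) auto
  qed
qed

text \<open>All that is used of the surface inside one chart, complexified in order to admit null
  frames. In dimension two the single component in \<open>curv\<close> carries the whole
  curvature.\<close>

locale chart_geometry =
  fixes S :: "(real^2) set" and G :: "2 \<Rightarrow> 2 \<Rightarrow> real^2 \<Rightarrow> complex"
    and Gam :: "2 \<Rightarrow> 2 \<Rightarrow> 2 \<Rightarrow> real^2 \<Rightarrow> complex"
    and h :: "sign \<Rightarrow> 2 \<Rightarrow> real^2 \<Rightarrow> complex" and K :: complex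
  assumes open_S [simp, intro]: "open S"
    and smooth_G: "smooth_on S (G i j)"
    and smooth_Gam: "smooth_on S (Gam k i j)"
    and smooth_h: "smooth_on S (h s i)"
    and Gam_sym: "y \<in> S \<Longrightarrow> Gam k i j y = Gam k j i y"
    and compat: "y \<in> S \<Longrightarrow> dx i (G j k) y = (\<Sum>m\<in>UNIV. Gam m i j y * G m k y + Gam m i k y * G j m y)"
    and frame: "y \<in> S \<Longrightarrow> null_frame (\<lambda>i j. G i j y) (\<lambda>s i. h s i y)"
    and curv: "y \<in> S \<Longrightarrow> (\<Sum>a\<in>UNIV. G a 1 y * (dx 1 (Gam a 2 2) y - dx 2 (Gam a 1 2) y +
        (\<Sum>m\<in>UNIV. Gam a 1 m y * Gam m 2 2 y - Gam a 2 m y * Gam m 1 2 y))) =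
        K * (G 1 1 y * G 2 2 y - (G 1 2 y)\<^sup>2)"
begin

lemma diff_G [simp]: "y \<in> S \<Longrightarrow> G i j differentiable (at y)"
  and diff_Gam [simp]: "y \<in> S \<Longrightarrow> Gam k i j differentiable (at y)"
  and diff_h [simp]: "y \<in> S \<Longrightarrow> h s i differentiable (at y)"
  using smooth_G smooth_Gam smooth_h smooth_on_differentiable by blast+

lemma G_sym: "y \<in> S \<Longrightarrow> G i j y = G j i y"
  using frame unfolding null_frame_def by blast

definition eta where "eta s i y = coframe (\<lambda>i j. G i j y) (\<lambda>s i. h s i y) s i"

text \<open>The connection form of the null frame: by \<open>dx_h\<close>, the covariant derivative
  of \<open>h s\<close> along the coordinate field \<open>i\<close> is
  \<open>- sval s * theta i\<close> times \<open>h s\<close>.\<close>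

definition theta where
  "theta i y = - (\<Sum>a\<in>UNIV. eta Plus a y * (dx i (h Plus a) y + (\<Sum>m\<in>UNIV. Gam a i m y * h Plus m y)))"

lemma eta_eq: "eta s i = (\<lambda>y. (\<Sum>j\<in>UNIV. G i j y * h (neg s) j y) / 2)"
  by (rule ext) (simp add: eta_def coframe_def)

lemma smooth_eta: "smooth_on S (eta s i)"
  unfolding eta_eq divide_inverse by (intro smooth_on_mult smooth_on_sum smooth_on_const smooth_G smooth_h open_S)

lemma smooth_theta: "smooth_on S (theta i)"
proof -
  have "theta i = (\<lambda>y. - (\<Sum>a\<in>UNIV. eta Plus a y * (dx i (h Plus a) y + (\<Sum>m\<in>UNIV. Gam a i m y * h Plus m y))))"
    by (rule ext) (simp add: theta_def)
  then show ?thesis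
    by (auto intro!: smooth_on_minus smooth_on_mult smooth_on_add smooth_on_sum smooth_eta smooth_h smooth_Gam smooth_on_dx)
qed

lemma diff_eta [simp]: "y \<in> S \<Longrightarrow> eta s i differentiable (at y)"
  and diff_theta [simp]: "y \<in> S \<Longrightarrow> theta i differentiable (at y)"
  using smooth_eta smooth_theta smooth_on_differentiable by blast+

lemma dx_divide:
  fixes v :: "real^2 \<Rightarrow> complex"
  shows "v differentiable (at y) \<Longrightarrow> dx i (\<lambda>z. v z / a) y = dx i v y / a"
  by (rule dx_bounded_linear[OF bounded_linear_divide])

lemmas dx_rules = dx_add dx_mult dx_diff dx_minus dx_divide

text \<open>The pairings of the frame are constant; in their derivative \<open>compat\<close>
  converts the derivatives of the metric into Christoffel symbols.\<close>

lemma nabla_metric: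
  assumes "y \<in> S"
  shows "(\<Sum>j\<in>UNIV. \<Sum>k\<in>UNIV. G j k y * (dx i (h s j) y + (\<Sum>m\<in>UNIV. Gam j i m y * h s m y)) * h t k y +
     G j k y * h s j y * (dx i (h t k) y + (\<Sum>m\<in>UNIV. Gam k i m y * h t m y))) = 0"
proof -
  have "dx i (\<lambda>y. \<Sum>j\<in>UNIV. \<Sum>k\<in>UNIV. G j k y * h s j y * h t k y) y = dx i (\<lambda>y. hpair s t) y"
    by (rule dx_cong[OF open_S assms]) (use frame in \<open>simp add: null_frame_def\<close>)
  then have "0 = (\<Sum>j\<in>UNIV. \<Sum>k\<in>UNIV. dx i (G j k) y * h s j y * h t k y + G j k y * dx i (h s j) y * h t k y
       + G j k y * h s j y * dx i (h t k) y)"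
    using assms by (simp add: sum_2 dx_rules) (simp add: algebra_simps)
  also have "\<dots> = (\<Sum>j\<in>UNIV. \<Sum>k\<in>UNIV. G j k y * (dx i (h s j) y + (\<Sum>m\<in>UNIV. Gam j i m y * h s m y)) * h t k y +
     G j k y * h s j y * (dx i (h t k) y + (\<Sum>m\<in>UNIV. Gam k i m y * h t m y)))"
    unfolding compat[OF assms] sum_2 by (simp add: algebra_simps)
  finally show ?thesis by simp
qed

text \<open>Covariant differentiation of the frame is skew for the pairing, and a skew endomorphism
  of a plane is diagonal in a null basis, with opposite entries. One coefficient
  \<open>theta\<close> therefore describes both vectors.\<close>

lemma dx_h:
  assumes "y \<in> S"
  shows "dx i (h s a) y = - (\<Sum>m\<in>UNIV. Gam a i m y * h s m y) - of_int (sval s) * theta i y * h s a y"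
proof -
  define N where "N s a = dx i (h s a) y + (\<Sum>m\<in>UNIV. Gam a i m y * h s m y)" for s a
  \<comment> \<open>With \<open>s = t\<close> the component of \<open>N s\<close> along
    \<open>h (neg s)\<close> vanishes; with opposite signs the two diagonal coefficients are seen to
    be opposite.\<close>
  have c: "2 * (\<Sum>a\<in>UNIV. eta (neg t) a y * N s a) + 2 * (\<Sum>a\<in>UNIV. eta (neg s) a y * N t a) = 0" for s t
    using nabla_metric[OF assms, of i s t, folded N_def] unfolding eta_def coframe_def sum_2
    by (simp add: algebra_simps add_divide_distrib G_sym[OF assms, of 2 1])
  have th: "(\<Sum>a\<in>UNIV. eta Plus a y * N Plus a) = - theta i y"
    by (simp add: theta_def N_def)
  have e: "(\<Sum>a\<in>UNIV. eta t a y * N s a) = (if s = t then - of_int (sval s) * theta i y else 0)" for s t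
    using c[of Plus Plus] c[of Minus Minus] c[of Plus Minus] th
    by (cases s; cases t) (simp_all add: add_eq_0_iff)
  have "N s a = (\<Sum>b\<in>UNIV. (if a = b then 1 else 0) * N s b)"
    using exhaust_2[of a] by (auto simp: sum_2)
  also have "\<dots> = (\<Sum>b\<in>UNIV. (\<Sum>t\<in>UNIV. h t a y * eta t b y) * N s b)"
    using frame_coframe[OF frame[OF assms]] by (simp add: eta_def)
  also have "\<dots> = (\<Sum>t\<in>UNIV. h t a y * (\<Sum>b\<in>UNIV. eta t b y * N s b))"
    by (simp add: sum_2 sum_sign algebra_simps)
  also have "\<dots> = - of_int (sval s) * theta i y * h s a y"
    unfolding e by (cases s) (simp_all add: sum_sign)
  finally have "N s a = - of_int (sval s) * theta i y * h s a y" .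
  moreover have "dx i (h s a) y = N s a - (\<Sum>m\<in>UNIV. Gam a i m y * h s m y)" by (simp add: N_def)
  ultimately show ?thesis by simp
qed

lemma dx_eta:
  assumes "y \<in> S"
  shows "dx i (eta s a) y = (\<Sum>m\<in>UNIV. Gam m i a y * eta s m y) + of_int (sval s) * theta i y * eta s a y"
proof -
  have "dx i (eta s a) y = (\<Sum>j\<in>UNIV. dx i (G a j) y * h (neg s) j y + G a j y * dx i (h (neg s) j) y) / 2"
    unfolding eta_eq using assms by (simp add: sum_2 dx_rules add_ac)
  also have "\<dots> = (\<Sum>m\<in>UNIV. Gam m i a y * eta s m y) + of_int (sval s) * theta i y * eta s a y"
    unfolding compat[OF assms] dx_h[OF assms] eta_eq sum_2
    by (simp add: algebra_simps add_divide_distrib)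
  finally show ?thesis .
qed

text \<open>The coefficient of the exterior derivative of the connection form.\<close>

definition kappa where "kappa y = dx 1 (theta 2) y - dx 2 (theta 1) y"

definition Riem where
  "Riem a k y = dx 1 (Gam a 2 k) y - dx 2 (Gam a 1 k) y +
     (\<Sum>m\<in>UNIV. Gam a 1 m y * Gam m 2 k y - Gam a 2 m y * Gam m 1 k y)"

text \<open>Equality of the mixed derivatives of \<open>h s\<close> after inserting
  \<open>dx_h\<close> twice. The products of \<open>theta\<close> with itself cancel, and only its
  exterior derivative remains.\<close>

lemma Riem_h:
  assumes "y \<in> S"
  shows "(\<Sum>k\<in>UNIV. Riem a k y * h s k y) = - of_int (sval s) * kappa y * h s a y"
proof -
  have e: "dx i (dx j (h s a)) y = dx i (\<lambda>y. - (\<Sum>m\<in>UNIV. Gam a j m y * h s m y) - of_int (sval s) * theta j y * h s a y) y" for i j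
    by (rule dx_cong[OF open_S assms]) (rule dx_h)
  have "dx 1 (dx 2 (h s a)) y = dx 2 (dx 1 (h s a)) y"
    by (rule dx_commute[OF smooth_h open_S assms])
  then show ?thesis
    using assms unfolding e sum_2 by (simp add: dx_rules dx_h Riem_def kappa_def sum_2 algebra_simps)
qed

text \<open>Let D be the determinant of the coframe. Written in the coframe, the curvature equation
  reads 2 kappa D = - 4 K D^2. As D is inverse to the determinant of the frame, one factor
  cancels.\<close>

lemma kappa_eq:
  assumes "y \<in> S"
  shows "kappa y * (h Plus 1 y * h Minus 2 y - h Plus 2 y * h Minus 1 y) = - 2 * K"
proof -
  let ?e = "\<lambda>s i. eta s i y" and ?h = "\<lambda>s i. h s i y"
  let ?D = "?e Plus 1 * ?e Minus 2 - ?e Minus 1 * ?e Plus 2"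
  have alg: "2 * k * (a * d - c * b) = - 4 * K * (a * d - c * b)\<^sup>2"
    if "- k * (2 * c * b - 2 * a * d) = K * ((4 * c * a) * (4 * d * b) - (2 * (c * b + a * d))\<^sup>2)" for a b c d k :: complex
    using that by algebra
  have R: "Riem a 2 y = - kappa y * (?h Plus a * ?e Plus 2 - ?h Minus a * ?e Minus 2)" for a
  proof -
    have "Riem a 2 y = (\<Sum>k\<in>UNIV. Riem a k y * (if k = 2 then 1 else 0))" by (simp add: sum_2)
    also have "\<dots> = (\<Sum>k\<in>UNIV. Riem a k y * (\<Sum>s\<in>UNIV. ?h s k * ?e s 2))"
      using frame_coframe[OF frame[OF assms]] by (simp add: eta_def)
    also have "\<dots> = (\<Sum>s\<in>UNIV. (\<Sum>k\<in>UNIV. Riem a k y * ?h s k) * ?e s 2)"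
      by (simp add: sum_2 sum_sign algebra_simps)
    also have "\<dots> = - kappa y * (?h Plus a * ?e Plus 2 - ?h Minus a * ?e Minus 2)"
      unfolding Riem_h[OF assms] by (simp add: sum_sign algebra_simps)
    finally show ?thesis .
  qed
  have g: "(\<Sum>a\<in>UNIV. G a 1 y * ?h s a) = 2 * ?e (neg s) 1" for s
    by (simp add: eta_eq sum_2 G_sym[OF assms, of 1 2])
  have M: "G i j y = 2 * (?e Minus i * ?e Plus j + ?e Plus i * ?e Minus j)" for i j
    using metric_coframe[OF frame[OF assms], of i j] unfolding eta_def sum_sign neg.simps .
  have "(\<Sum>a\<in>UNIV. G a 1 y * Riem a 2 y) = K * (G 1 1 y * G 2 2 y - (G 1 2 y)\<^sup>2)"
    using curv[OF assms] by (simp add: Riem_def)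
  moreover have "(\<Sum>a\<in>UNIV. G a 1 y * Riem a 2 y) =
      - kappa y * ((\<Sum>a\<in>UNIV. G a 1 y * ?h Plus a) * ?e Plus 2 - (\<Sum>a\<in>UNIV. G a 1 y * ?h Minus a) * ?e Minus 2)"
    unfolding R by (simp add: sum_2 algebra_simps)
  ultimately have "- kappa y * ((\<Sum>a\<in>UNIV. G a 1 y * ?h Plus a) * ?e Plus 2 - (\<Sum>a\<in>UNIV. G a 1 y * ?h Minus a) * ?e Minus 2) =
      K * (G 1 1 y * G 2 2 y - (G 1 2 y)\<^sup>2)" by simp
  then have "- kappa y * (2 * ?e Minus 1 * ?e Plus 2 - 2 * ?e Plus 1 * ?e Minus 2) =
      K * ((4 * ?e Minus 1 * ?e Plus 1) * (4 * ?e Minus 2 * ?e Plus 2) - (2 * (?e Minus 1 * ?e Plus 2 + ?e Plus 1 * ?e Minus 2))\<^sup>2)"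
    unfolding g unfolding M by (simp add: mult.assoc)
  then have 1: "2 * kappa y * ?D = - 4 * K * ?D\<^sup>2" by (rule alg)
  have c: "?e Plus 1 * ?h Plus 1 + ?e Plus 2 * ?h Plus 2 = 1"
    "?e Plus 1 * ?h Minus 1 + ?e Plus 2 * ?h Minus 2 = 0"
    "?e Minus 1 * ?h Plus 1 + ?e Minus 2 * ?h Plus 2 = 0"
    "?e Minus 1 * ?h Minus 1 + ?e Minus 2 * ?h Minus 2 = 1"
    using coframe_frame[OF frame[OF assms], unfolded sum_2] by (simp_all add: eta_def)
  have d: "?D * (?h Plus 1 * ?h Minus 2 - ?h Plus 2 * ?h Minus 1) = 1"
    using c by algebra
  then show ?thesis using 1 by algebra
qed

text \<open>The covariant derivative along \<open>h\<^sub>s\<close> of a component of charge \<open>n\<close>.\<close>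

definition Dn :: "sign \<Rightarrow> int \<Rightarrow> (real^2 \<Rightarrow> complex) \<Rightarrow> real^2 \<Rightarrow> complex" where
  "Dn s n v y = (\<Sum>i\<in>UNIV. h s i y * (dx i v y + of_int n * theta i y * v y))"

lemma Dn_eq: "Dn s n v = (\<lambda>y. (\<Sum>i\<in>UNIV. h s i y * (dx i v y + of_int n * theta i y * v y)))"
  by (rule ext) (simp add: Dn_def)

lemma smooth_Dn: "smooth_on S v \<Longrightarrow> smooth_on S (Dn s n v)"
  unfolding Dn_eq
  by (intro smooth_on_mult smooth_on_add smooth_on_sum smooth_h smooth_theta smooth_on_dx smooth_on_const open_S)

lemma Dn_cong: "y \<in> S \<Longrightarrow> (\<And>z. z \<in> S \<Longrightarrow> u z = v z) \<Longrightarrow> Dn s n u y = Dn s n v y"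
  using dx_cong[OF open_S, of y u v] by (simp add: Dn_def)

lemma Dn_linear:
  assumes "y \<in> S" "smooth_on S u" "smooth_on S v"
  shows "Dn s n (\<lambda>y. a * u y + b * v y) y = a * Dn s n u y + b * Dn s n v y"
  using smooth_on_differentiable[OF assms(2,1)] smooth_on_differentiable[OF assms(3,1)]
  unfolding Dn_def sum_2 by (simp add: dx_rules algebra_simps)

text \<open>Second derivatives and Christoffel symbols cancel by symmetry. The inner derivative has
  changed the charge, and the shifted indices \<open>n - 1\<close> and \<open>n + 1\<close>
  compensate the connection terms from differentiating \<open>h\<close>. What is left is
  \<open>n * kappa\<close> times the determinant of the frame.\<close>

lemma Dn_commutator:
  assumes "y \<in> S" "smooth_on S v"
  shows "Dn Plus (n - 1) (Dn Minus n v) y - Dn Minus (n + 1) (Dn Plus n v) y = - 2 * of_int n * K * v y"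
proof -
  have dv [simp]: "v differentiable (at y)" "dx i v differentiable (at y)" for i
    using smooth_on_differentiable[OF _ assms(1)] assms(2) smooth_on_dx by blast+
  have c: "dx 2 (dx 1 v) y = dx 1 (dx 2 v) y"
    by (rule dx_commute[OF assms(2) open_S assms(1)])
  have sym: "Gam k 2 1 y = Gam k 1 2 y" for k using Gam_sym[OF assms(1)] .
  have "Dn Plus (n - 1) (Dn Minus n v) y - Dn Minus (n + 1) (Dn Plus n v) y =
    of_int n * (kappa y * (h Plus 1 y * h Minus 2 y - h Plus 2 y * h Minus 1 y)) * v y"
    unfolding Dn_def[of _ "n - 1"] Dn_def[of _ "n + 1"] Dn_eq[of _ n] sum_2
    using assms(1) by (simp add: dx_rules dx_h kappa_def sum_2 c sym) (simp add: algebra_simps)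
  then show ?thesis by (simp add: kappa_eq[OF assms(1)])
qed

end

section \<open>Covariant derivatives evaluated on words\<close>

text \<open>Contraction one slot at a time, beginning with the first: this is where
  \<open>cov_deriv\<close> puts its new index, so inductions over words fit.\<close>

primrec pair :: "(2 list \<Rightarrow> complex) \<Rightarrow> (2 \<Rightarrow> complex) list \<Rightarrow> complex" where
  "pair T [] = T []"
| "pair T (v # vs) = (\<Sum>i\<in>UNIV. v i * pair (\<lambda>J. T (i # J)) vs)"

lemma pair_cong: "(\<And>I. length I = length vs \<Longrightarrow> T I = T' I) \<Longrightarrow> pair T vs = pair T' vs"
proof (induction vs arbitrary: T T')
  case (Cons v vs)
  have "pair (\<lambda>J. T (i # J)) vs = pair (\<lambda>J. T' (i # J)) vs" for i
    by (rule Cons.IH) (use Cons.prems in simp)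
  then show ?case by simp
qed simp

lemma pair_add: "pair (\<lambda>J. T J + T' J) vs = pair T vs + pair T' vs"
  by (induction vs arbitrary: T T') (simp_all add: sum.distrib algebra_simps)

lemma pair_scale: "pair (\<lambda>J. a * T J) vs = a * pair T vs"
  by (induction vs arbitrary: T) (simp_all add: sum_distrib_left mult.left_commute)

lemma pair_diff: "pair (\<lambda>J. T J - T' J) vs = pair T vs - pair T' vs"
  using pair_add[of T "\<lambda>J. - 1 * T' J" vs] unfolding pair_scale by simp

lemma pair_zero: "pair (\<lambda>J. 0) vs = 0"
  by (induction vs) simp_all

lemma pair_sum: "pair (\<lambda>J. \<Sum>a\<in>A. T a J) vs = (\<Sum>a\<in>A. pair (T a) vs)"
  by (induction A rule: infinite_finite_induct) (simp_all add: pair_zero pair_add)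

lemma length_Suc_lists: "{I. length I = Suc k} = (\<lambda>(i, I). i # I) ` (UNIV \<times> {I. length I = k})"
  by (auto simp: length_Suc_conv image_iff)

lemma finite_lists_length: "finite {I :: 'a::finite list. length I = k}"
  using finite_lists_length_eq[of "UNIV :: 'a set" k] by simp

lemma sum_lists_Suc:
  "(\<Sum>I | length I = Suc k. \<phi> I) = (\<Sum>i\<in>(UNIV :: 'a::finite set). \<Sum>I | length I = k. \<phi> (i # I))"
proof -
  have "inj_on (\<lambda>(i :: 'a, I). i # I) (UNIV \<times> {I. length I = k})"
    by (auto simp: inj_on_def)
  then show ?thesis
    by (simp add: length_Suc_lists sum.reindex sum.cartesian_product case_prod_unfold)
qed

lemma sum_lists_0: "(\<Sum>I | length I = 0. \<phi> I) = \<phi> []"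
  by simp

text \<open>The identity, written as the sum over \<open>s\<close> of \<open>h s\<close> times
  \<open>e s\<close>, is inserted in every slot.\<close>

lemma contraction_frame:
  fixes h e :: "sign \<Rightarrow> 2 \<Rightarrow> complex"
  assumes "\<And>i j. (\<Sum>s\<in>UNIV. h s i * e s j) = (if i = j then 1 else (0::complex))"
  shows "(\<Sum>I | length I = k. T I * X I) = (\<Sum>w | length w = k. pair T (map h w) * pair X (map e w))"
proof (induction k arbitrary: T X)
  case 0
  show ?case unfolding sum_lists_0 by simp
next
  case (Suc k)
  have d: "(if i = j then 1 else 0) = h Plus i * e Plus j + h Minus i * e Minus j" for i j
    using assms[of i j] by (simp add: sum_sign)
  have "(\<Sum>I | length I = Suc k. T I * X I) =
    (\<Sum>i\<in>UNIV. \<Sum>j\<in>UNIV. (if i = j then 1 else 0) * (\<Sum>w | length w = k. pair (\<lambda>I. T (i # I)) (map h w) * pair (\<lambda>I. X (j # I)) (map e w)))"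
    by (simp add: sum_lists_Suc Suc sum_2)
  also have "\<dots> = (\<Sum>w | length w = k. \<Sum>s\<in>UNIV. (\<Sum>i\<in>UNIV. h s i * pair (\<lambda>I. T (i # I)) (map h w)) *
       (\<Sum>j\<in>UNIV. e s j * pair (\<lambda>I. X (j # I)) (map e w)))"
    unfolding d sum_2 sum_sign sum_distrib_left sum.distrib[symmetric] by (simp add: algebra_simps)
  also have "\<dots> = (\<Sum>w | length w = Suc k. pair T (map h w) * pair X (map e w))"
    by (subst sum.swap) (simp add: sum_lists_Suc)
  finally show ?case .
qed

lemma word_tensor_Nil: "word_tensor e1 e2 [] I = 1"
  by (simp add: word_tensor_def)

lemma word_tensor_Cons: "word_tensor e1 e2 (s # w) (i # I) = hvec e1 e2 s i * word_tensor e1 e2 w I"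
  unfolding word_tensor_def by (simp add: prod.lessThan_Suc_shift del: prod.lessThan_Suc)

lemma pair_word_tensor:
  assumes "\<And>s t. (\<Sum>i\<in>UNIV. e s i * hvec e1 e2 t i) = (if s = t then 1 else 0)"
    and "length v = length w"
  shows "pair (word_tensor e1 e2 w) (map e v) = (if v = w then 1 else 0)"
  using assms(2)
proof (induction v w rule: list_induct2)
  case (Cons s v t w)
  then show ?case
    using assms(1)[of s t] by (simp add: word_tensor_Cons pair_scale flip: mult.assoc sum_distrib_right)
qed (simp add: word_tensor_Nil)

section \<open>Change of chart and of frame in tensor components\<close>

definition transf :: "(2 \<Rightarrow> 2 \<Rightarrow> complex) \<Rightarrow> (2 list \<Rightarrow> complex) \<Rightarrow> 2 list \<Rightarrow> complex" where
  "transf B X I = (\<Sum>J | length J = length I. (\<Prod>a<length I. B (I ! a) (J ! a)) * X J)"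

lemma transf_Cons: "transf B X (i # I) = (\<Sum>j\<in>UNIV. B i j * transf B (\<lambda>J. X (j # J)) I)"
  unfolding transf_def length_Cons sum_lists_Suc
  by (simp add: prod.lessThan_Suc_shift sum_distrib_left mult.assoc del: prod.lessThan_Suc)

text \<open>The Jacobians move from the tensor to the covectors, which are thereby pulled back to
  the other chart.\<close>

lemma pair_transf: "pair (transf B X) vs = pair X (map (\<lambda>v j. \<Sum>i\<in>UNIV. v i * B i j) vs)"
proof (induction vs arbitrary: X)
  case Nil
  have "{J. J = []} = {[]::2 list}" by auto
  then show ?case by (simp add: transf_def)
next
  case (Cons v vs)
  show ?case
    by (simp add: transf_Cons pair_add pair_scale Cons sum_2 algebra_simps)
qed

lemma pair_scaled_frame:
  "pair X (map (\<lambda>s i. \<mu> s * e (\<sigma> s) i) w) = (\<Prod>s\<leftarrow>w. \<mu> s) * pair X (map e (map \<sigma> w))"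
  by (induction w arbitrary: X) (simp_all add: sum_distrib_left mult_ac)

lemma charge_Nil [simp]: "charge [] = 0"
  and charge_Cons [simp]: "charge (s # w) = sval s + charge w"
  and charge_append [simp]: "charge (v @ w) = charge v + charge w"
  by (simp_all add: charge_def)

lemma charge_replicate [simp]: "charge (replicate n s) = int n * sval s"
  by (induction n) (simp_all add: algebra_simps)

lemma charge_map_neg [simp]: "charge (map neg w) = - charge w"
  by (induction w) simp_all

text \<open>Opposite letters contribute inverse factors. In particular rescaling a null frame leaves
  neutral components unchanged.\<close>

lemma prod_list_charge:
  assumes "\<mu> Plus * \<mu> Minus = (1::complex)"
  shows "(\<Prod>s\<leftarrow>w. \<mu> s) = \<mu> Plus powi charge w"
proof (induction w)
  case (Cons s w)
  have nz: "\<mu> Plus \<noteq> 0" using assms by auto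
  have "\<mu> s = \<mu> Plus powi sval s"
    using assms nz by (cases s) (auto simp: power_int_minus field_simps)
  then show ?case using Cons nz by (simp add: power_int_add)
qed simp

abbreviation "frame_at e y w \<equiv> map (\<lambda>s a. e s a y) w"

text \<open>The product rule over all slots. By \<open>de\<close> each factor is parallel up to the
  multiple \<open>sval s * c\<close>, and these multiples add up to the charge. \<open>M\<close>
  stands for the Christoffel symbols in either variance, so that the lemma serves both frames
  applied to covariant derivatives and coframes applied to parallel sections.\<close>

lemma dx_pair:
  fixes T :: "real^2 \<Rightarrow> 2 list \<Rightarrow> complex" and e :: "sign \<Rightarrow> 2 \<Rightarrow> real^2 \<Rightarrow> complex"
  assumes T: "\<And>I. (\<lambda>y. T y I) differentiable (at y)"
    and e: "\<And>s a. e s a differentiable (at y)"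
    and de: "\<And>s a. dx i (e s a) y = - (\<Sum>b\<in>UNIV. M a b * e s b y) + of_int (sval s) * c * e s a y"
  shows "(\<lambda>y. pair (T y) (frame_at e y w)) differentiable (at y) \<and>
    dx i (\<lambda>y. pair (T y) (frame_at e y w)) y =
      pair (\<lambda>J. dx i (\<lambda>y. T y J) y - (\<Sum>a<length J. \<Sum>b\<in>UNIV. M b (J ! a) * T y (J[a := b])))
        (frame_at e y w) +
      of_int (charge w) * c * pair (T y) (frame_at e y w)"
  using T
proof (induction w arbitrary: T)
  case (Cons s w)
  note IH = Cons.IH[of "\<lambda>y J. T y (_ # J)", OF Cons.prems]
  have "(\<lambda>y. pair (T y) (frame_at e y (s # w))) differentiable (at y)"
    unfolding list.map pair.simps sum_2 using e IH[THEN conjunct1]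
    by (intro differentiable_add differentiable_mult) auto
  moreover have "dx i (\<lambda>y. pair (T y) (frame_at e y (s # w))) y =
      (\<Sum>m\<in>UNIV. e s m y * dx i (\<lambda>y. pair (\<lambda>J. T y (m # J)) (frame_at e y w)) y +
        dx i (e s m) y * pair (\<lambda>J. T y (m # J)) (frame_at e y w))"
    unfolding list.map pair.simps sum_2 using e IH[THEN conjunct1] by (simp add: dx_add dx_mult)
  moreover have "\<dots> = pair (\<lambda>J. dx i (\<lambda>y. T y J) y - (\<Sum>a<length J. \<Sum>b\<in>UNIV. M b (J ! a) * T y (J[a := b])))
      (frame_at e y (s # w)) +
    of_int (charge (s # w)) * c * pair (T y) (frame_at e y (s # w))"
    unfolding IH[THEN conjunct2] de
    unfolding list.map pair.simps length_Cons sum.lessThan_Suc_shift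
    by (simp add: sum_2 pair_diff pair_add pair_scale) (simp add: algebra_simps)
  ultimately show ?case by simp
qed (simp add: charge_def)

lemma smooth_pair:
  assumes "open S" "\<And>I. smooth_on S (\<lambda>y. T y I)" "\<And>s a. smooth_on S (e s a)"
  shows "smooth_on S (\<lambda>y. pair (T y) (frame_at e y w))"
  using assms(2)
proof (induction w arbitrary: T)
  case (Cons s w)
  show ?case unfolding list.map pair.simps
    by (intro smooth_on_sum smooth_on_mult assms(1,3) Cons.IH Cons.prems)
qed simp

text \<open>\<open>cop L K w\<close> is \<open>C\<^sub>w\<close> with \<open>-\<lambda>\<close> replaced by the operator \<open>L\<close>.\<close>

primrec cop :: "(('x \<Rightarrow> complex) \<Rightarrow> 'x \<Rightarrow> complex) \<Rightarrow> complex \<Rightarrow> sign list \<Rightarrow> ('x \<Rightarrow> complex) \<Rightarrow> 'x \<Rightarrow> complex" where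
  "cop L K [] v = v"
| "cop L K (s # w) v = (if \<bar>sval s + charge w\<bar> < \<bar>charge w\<bar>
     then (\<lambda>y. L (cop L K w v) y + of_int (\<bar>charge w\<bar> * (\<bar>charge w\<bar> - 1)) * K * cop L K w v y)
     else cop L K w v)"

text \<open>Only absolute values of partial charges enter. This is what hides an exchange of the two
  null lines from the operators.\<close>

lemma cop_map_neg: "cop L K (map neg w) v = cop L K w v"
proof (induction w)
  case (Cons s w)
  have "\<bar>- sval s - charge w\<bar> = \<bar>sval s + charge w\<bar>" by linarith
  with Cons show ?case by simp
qed simp

text \<open>Partial charges are counted from the right end, so to the left of a neutral suffix they
  start again from zero.\<close>

lemma cop_append: "charge w = 0 \<Longrightarrow> cop L K (b @ w) v = cop L K b (cop L K w v)"
  by (induction b) simp_all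

section \<open>Iterated covariant derivatives along the null frame\<close>

context chart_geometry
begin

primrec nabla_comp :: "nat \<Rightarrow> (real^2 \<Rightarrow> complex) \<Rightarrow> real^2 \<Rightarrow> 2 list \<Rightarrow> complex" where
  "nabla_comp 0 u = (\<lambda>y I. if I = [] then u y else 0)"
| "nabla_comp (Suc k) u = (\<lambda>y I. case I of [] \<Rightarrow> 0 | i # J \<Rightarrow> dx i (\<lambda>y. nabla_comp k u y J) y -
     (\<Sum>a<length J. \<Sum>b\<in>UNIV. Gam b i (J ! a) y * nabla_comp k u y (J[a := b])))"

lemma smooth_nabla_comp: "smooth_on S u \<Longrightarrow> smooth_on S (\<lambda>y. nabla_comp k u y I)"
proof (induction k arbitrary: I)
  case 0
  then show ?case by (cases "I = []") (simp_all add: smooth_on_const)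
next
  case (Suc k)
  then show ?case
    by (cases I) (auto intro!: smooth_on_const smooth_on_diff smooth_on_dx smooth_on_sum smooth_on_mult smooth_Gam
       open_S)
qed

primrec Dw :: "sign list \<Rightarrow> (real^2 \<Rightarrow> complex) \<Rightarrow> real^2 \<Rightarrow> complex" where
  "Dw [] v = v"
| "Dw (s # w) v = Dn s (charge w) (Dw w v)"

lemma smooth_Dw: "smooth_on S v \<Longrightarrow> smooth_on S (Dw w v)"
  by (induction w) (simp_all add: smooth_Dn)

lemma Dw_cong: "(\<And>z. z \<in> S \<Longrightarrow> u z = v z) \<Longrightarrow> y \<in> S \<Longrightarrow> Dw w u y = Dw w v y"
  by (induction w arbitrary: y) (auto intro: Dn_cong)

lemma Dw_linear:
  assumes "smooth_on S u" "smooth_on S v" "y \<in> S"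
  shows "Dw w (\<lambda>y. a * u y + b * v y) y = a * Dw w u y + b * Dw w v y"
  using assms(3)
proof (induction w arbitrary: y)
  case (Cons s w)
  have "Dw (s # w) (\<lambda>y. a * u y + b * v y) y = Dn s (charge w) (\<lambda>y. a * Dw w u y + b * Dw w v y) y"
    using Cons by (auto intro!: Dn_cong)
  also have "\<dots> = a * Dw (s # w) u y + b * Dw (s # w) v y"
    using Dn_linear[OF Cons.prems smooth_Dw[OF assms(1)] smooth_Dw[OF assms(2)]] by simp
  finally show ?case .
qed simp

text \<open>The product rule \<open>dx_pair\<close>, solved for the contracted covariant derivative;
  its charge term is exactly the connection term of \<open>Dn\<close>.\<close>

lemma pair_nabla_comp:
  assumes "smooth_on S u" "y \<in> S"
  shows "pair (nabla_comp (length w) u y) (frame_at h y w) = Dw w u y"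
  using assms(2)
proof (induction w arbitrary: y)
  case (Cons s w)
  note y = Cons.prems
  have d: "(\<lambda>y. nabla_comp (length w) u y I) differentiable (at y)" for I
    by (rule smooth_on_differentiable[OF smooth_nabla_comp[OF assms(1)] y])
  have "dx i (\<lambda>y. pair (nabla_comp (length w) u y) (frame_at h y w)) y =
      pair (\<lambda>J. nabla_comp (length (s # w)) u y (i # J)) (frame_at h y w) +
      of_int (charge w) * (- theta i y) * pair (nabla_comp (length w) u y) (frame_at h y w)" for i
    using dx_pair[of "nabla_comp (length w) u" y h i "\<lambda>a b. Gam a i b y" "- theta i y" w, THEN conjunct2] d y
    by (simp add: dx_h)
  then have "pair (\<lambda>J. nabla_comp (length (s # w)) u y (i # J)) (frame_at h y w) =
    dx i (\<lambda>y. pair (nabla_comp (length w) u y) (frame_at h y w)) y + of_int (charge w) * theta i y * Dw w u y" for i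
    using Cons.IH[OF y] by simp
  moreover have "dx i (\<lambda>y. pair (nabla_comp (length w) u y) (frame_at h y w)) y = dx i (Dw w u) y" for i
    by (rule dx_cong[OF open_S y]) (rule Cons.IH)
  ultimately show ?case by (simp add: Dn_def del: nabla_comp.simps)
qed simp

text \<open>At charge zero the product of the two null derivatives is the Laplacian, see
  \<open>laplace_lap\<close>. The cut-off outside \<open>S\<close> lets identities between operators
  hold as equations of functions on the whole plane.\<close>

definition Lap :: "(real^2 \<Rightarrow> complex) \<Rightarrow> real^2 \<Rightarrow> complex" where
  "Lap v y = (if y \<in> S then Dn Plus (-1) (Dn Minus 0 v) y else 0)"

lemma smooth_Lap: "smooth_on S v \<Longrightarrow> smooth_on S (Lap v)"
  by (rule smooth_on_cong[of S "Dn Plus (-1) (Dn Minus 0 v)"]) (auto simp: Lap_def smooth_Dn)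

lemma Lap_linear:
  assumes "smooth_on S u" "smooth_on S v"
  shows "Lap (\<lambda>y. a * u y + b * v y) = (\<lambda>y. a * Lap u y + b * Lap v y)"
proof
  fix y
  have "Dn Plus (-1) (Dn Minus 0 (\<lambda>y. a * u y + b * v y)) y = a * Dn Plus (-1) (Dn Minus 0 u) y + b * Dn Plus (-1) (Dn Minus 0 v) y" if "y \<in> S"
    using Dw_linear[OF assms that, of "[Plus, Minus]" a b] by simp
  then show "Lap (\<lambda>y. a * u y + b * v y) y = a * Lap u y + b * Lap v y" by (simp add: Lap_def)
qed

lemma smooth_cop: "smooth_on S v \<Longrightarrow> smooth_on S (cop Lap K w v)"
  by (induction w) (auto intro!: smooth_on_add smooth_on_mult smooth_on_const smooth_Lap)

lemma Dn_exchange: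
  assumes "y \<in> S" "smooth_on S v"
  shows "Dn (neg s) (m + sval s) (Dn s m v) y =
    Dn s (m - sval s) (Dn (neg s) m v) y + 2 * of_int (sval s * m) * K * v y"
  using Dn_commutator[OF assms, of m] by (cases s) (simp_all add: algebra_simps)

text \<open>The derivative along \<open>h (neg s)\<close> is moved through the power of the
  derivative along \<open>h s\<close> until it meets the last one, where the two form the Laplacian.
  The crossing at absolute charge j costs 2jK, and 2(1 + ... + n) = n(n + 1). This is the origin of
  the factor |c|(|c| - 1)K in \<open>Cconst\<close>, with |c| = n + 1.\<close>

lemma Dn_lower:
  assumes "y \<in> S" "smooth_on S v"
  shows "Dn (neg s) (sval s * (int n + 1)) (Dw (replicate (Suc n) s) v) y =
    Dw (replicate n s) (\<lambda>y. Lap v y + of_nat (n * Suc n) * K * v y) y"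
  using assms(1)
proof (induction n arbitrary: y)
  case 0
  then show ?case
    using Dn_exchange[OF 0 assms(2), of s 0] by (cases s) (simp_all add: Lap_def)
next
  case (Suc n)
  let ?W = "Dw (replicate (Suc n) s) v"
  let ?v = "\<lambda>y. Lap v y + of_nat (n * Suc n) * K * v y"
  let ?m = "sval s * (int n + 1)"
  have ss: "sval s * sval s = 1" by (cases s) simp_all
  have sm: "smooth_on S ?v" by (intro smooth_on_add smooth_on_mult smooth_on_const smooth_Lap assms(2) open_S)
  have "Dn (neg s) (sval s * (int (Suc n) + 1)) (Dw (replicate (Suc (Suc n)) s) v) y =
     Dn (neg s) (?m + sval s) (Dn s ?m ?W) y"
    by (simp add: algebra_simps)
  also have "\<dots> = Dn s (?m - sval s) (Dn (neg s) ?m ?W) y + 2 * of_int (sval s * ?m) * K * ?W y"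
    by (rule Dn_exchange[OF Suc.prems smooth_Dw[OF assms(2)]])
  also have "Dn s (?m - sval s) (Dn (neg s) ?m ?W) y = Dn s (?m - sval s) (Dw (replicate n s) ?v) y"
    by (rule Dn_cong[OF Suc.prems]) (rule Suc.IH)
  also have "\<dots> = Dw (replicate (Suc n) s) ?v y"
    by (simp add: algebra_simps)
  also have "sval s * ?m = int n + 1"
    using ss by (simp flip: mult.assoc)
  also have "Dw (replicate (Suc n) s) ?v y + 2 * of_int (int n + 1) * K * ?W y =
    Dw (replicate (Suc n) s) (\<lambda>y. 1 * ?v y + (2 * of_int (int n + 1) * K) * v y) y"
    unfolding Dw_linear[OF sm assms(2) Suc.prems] by simp
  also have "\<dots> = Dw (replicate (Suc n) s) (\<lambda>y. Lap v y + of_nat (Suc n * Suc (Suc n)) * K * v y) y"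
    by (rule arg_cong[where f = "\<lambda>u. Dw _ u y"]) (simp add: fun_eq_iff algebra_simps)
  finally show ?case .
qed

text \<open>Read from the right, each letter either lengthens the straight word reached so far or
  cancels against it; by \<open>Dn_lower\<close> a cancellation produces one factor of the
  operator.\<close>

lemma Dw_straight:
  assumes "y \<in> S" "smooth_on S v"
  shows "Dw w v y = Dw (straight_word (charge w)) (cop Lap K w v) y"
  using assms(1)
proof (induction w arbitrary: y)
  case Nil
  then show ?case by (simp add: straight_word_def)
next
  case (Cons s w)
  let ?c = "charge w" and ?v = "cop Lap K w v"
  have 1: "Dw (s # w) v y = Dn s ?c (Dw (straight_word ?c) ?v) y"
    unfolding Dw.simps by (rule Dn_cong[OF Cons.prems]) (rule Cons.IH)
  define t where "t = (if ?c > 0 then Plus else Minus)"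
  have st: "straight_word ?c = replicate (nat \<bar>?c\<bar>) t" and ct: "?c = int (nat \<bar>?c\<bar>) * sval t"
    by (auto simp: straight_word_def t_def)
  consider "?c = 0" | "?c \<noteq> 0" "s = t" | "?c \<noteq> 0" "s = neg t"
    using neq_iff_neg by metis
  then show ?case
  proof cases
    case 1
    then show ?thesis using \<open>Dw (s # w) v y = _\<close>
      by (cases s) (simp_all add: straight_word_def)
  next
    case 2
    have "straight_word (charge (s # w)) = s # straight_word ?c"
    proof -
      have "nat \<bar>sval t + ?c\<bar> = Suc (nat \<bar>?c\<bar>)" "sval t + ?c > 0 \<longleftrightarrow> ?c > 0"
        using 2 by (auto simp: t_def)
      then show ?thesis using 2 st by (simp add: straight_word_def t_def)
    qed
    moreover have "\<not> \<bar>sval s + ?c\<bar> < \<bar>?c\<bar>" using 2 by (auto simp: t_def)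
    moreover have "charge (straight_word ?c) = ?c" unfolding st using ct by simp
    ultimately show ?thesis using 1 by simp
  next
    case 3
    obtain n where n: "nat \<bar>?c\<bar> = Suc n" using 3 by (cases "nat \<bar>?c\<bar>") auto
    have abs: "\<bar>?c\<bar> = int n + 1" using n by simp
    have "straight_word (charge (s # w)) = replicate n t"
    \<comment> \<open>Charge zero is treated apart: the sign test in \<open>straight_word\<close>
      then no longer singles out \<open>t\<close>, but the word is empty.\<close>
    proof (cases "n = 0")
      case True
      then show ?thesis using 3 abs by (auto simp: straight_word_def t_def)
    next
      case False
      then have "nat \<bar>- sval t + ?c\<bar> = n" "- sval t + ?c > 0 \<longleftrightarrow> ?c > 0"
        using 3 abs by (auto simp: t_def split: if_splits)
      then show ?thesis using 3 by (simp add: straight_word_def t_def)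
    qed
    moreover have "\<bar>sval s + ?c\<bar> < \<bar>?c\<bar>" using 3 abs by (auto simp: t_def)
    moreover have "Dn s ?c (Dw (straight_word ?c) ?v) y = Dw (replicate n t) (\<lambda>y. Lap ?v y + of_nat (n * Suc n) * K * ?v y) y"
      using Dn_lower[OF Cons.prems smooth_cop[OF assms(2)], of t n w] ct abs 3(2) st n
      by (simp add: mult.commute)
    moreover have "of_int (\<bar>?c\<bar> * (\<bar>?c\<bar> - 1)) = (of_nat (n * Suc n) :: complex)"
      unfolding abs by (simp add: algebra_simps)
    ultimately show ?thesis using 1 by simp
  qed
qed

lemma Dw_neutral:
  assumes "y \<in> S" "smooth_on S v" "charge w = 0"
  shows "Dw w v y = cop Lap K w v y"
  using Dw_straight[OF assms(1,2), of w] assms(3) by (simp add: straight_word_def)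

end

section \<open>Charts of a surface\<close>

lemma matrix_inv_works:
  fixes M :: "real^2^2"
  assumes "det M \<noteq> 0"
  shows "M ** matrix_inv M = mat 1" "matrix_inv M ** M = mat 1"
proof -
  have "\<exists>B. M ** B = mat 1 \<and> B ** M = mat 1"
    using assms invertible_det_nz[of M] by (simp add: invertible_def)
  then show "M ** matrix_inv M = mat 1" "matrix_inv M ** M = mat 1"
    unfolding matrix_inv_def by (metis (mono_tags, lifting) someI_ex)+
qed

lemma matrix_inv_2:
  fixes M :: "real^2^2"
  assumes "det M \<noteq> 0"
  shows "matrix_inv M $ i $ j = (if i = j then M $ (i + 1) $ (i + 1) else - M $ i $ j) * inverse (det M)"
proof -
  define r where "r = inverse (det M)"
  define B :: "real^2^2" where "B = (\<chi> i j. (if i = j then M $ (i + 1) $ (i + 1) else - M $ i $ j) * r)"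
  \<comment> \<open>Numerals of type \<open>2\<close> are taken modulo two, so that
    \<open>i + 1\<close> denotes the other index.\<close>
  have two: "(2::2) = 0" by simp
  have "(M $ 1 $ 1 * M $ 2 $ 2 - M $ 1 $ 2 * M $ 2 $ 1) * r = 1" using assms by (simp add: det_2 r_def)
  then have "M ** B = mat 1"
    by (simp add: vec_eq_iff forall_2 matrix_matrix_mult_def sum_2 B_def mat_def algebra_simps two)
  then have "matrix_inv M = B"
    using matrix_inv_works[OF assms] by (metis matrix_mul_assoc matrix_mul_lid matrix_mul_rid)
  then show ?thesis by (simp add: B_def r_def)
qed

locale riemannian =
  fixes A :: "'m::topological_space chart set" and g :: "'m metric"
  assumes riem: "riemannian_surface A g"
begin

abbreviation inv_chart where "inv_chart c \<equiv> inv_into (fst c) (snd c)"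

lemma atlas: "(\<Union>c\<in>A. fst c) = UNIV"
  and open_dom: "c \<in> A \<Longrightarrow> open (fst c)"
  and open_range: "c \<in> A \<Longrightarrow> open (snd c ` fst c)"
  and homeo: "c \<in> A \<Longrightarrow> homeomorphism (fst c) (snd c ` fst c) (snd c) (inv_chart c)"
  and smooth_metric: "c \<in> A \<Longrightarrow> smooth_on (snd c ` fst c) (local_rep c (\<lambda>x. g c x $ i $ j))"
  and gip_sym: "c \<in> A \<Longrightarrow> x \<in> fst c \<Longrightarrow> gip g c x v w = gip g c x w v"
  and gip_pos: "c \<in> A \<Longrightarrow> x \<in> fst c \<Longrightarrow> v \<noteq> 0 \<Longrightarrow> gip g c x v v > 0"
  and metric_transform: "c \<in> A \<Longrightarrow> d \<in> A \<Longrightarrow> x \<in> fst c \<inter> fst d \<Longrightarrow>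
     g c x $ i $ j = (\<Sum>a\<in>UNIV. \<Sum>b\<in>UNIV. jac c d x a i * jac c d x b j * g d x $ a $ b)"
  using riem unfolding riemannian_surface_def smooth_atlas_def smooth_in_chart_def Int_UNIV_right by blast+

lemma inv_chart [simp]: "c \<in> A \<Longrightarrow> x \<in> fst c \<Longrightarrow> inv_chart c (snd c x) = x"
  using homeo unfolding homeomorphism_def by blast

lemma open_image:
  assumes "c \<in> A" "open W"
  shows "open (snd c ` (fst c \<inter> W))"
proof -
  have "openin (top_of_set (snd c ` fst c)) (snd c ` (fst c \<inter> W))"
    by (rule homeomorphism_imp_open_map[OF homeo[OF assms(1)]]) (use assms(2) in \<open>auto simp: openin_open\<close>)
  then show ?thesis
    using open_range[OF assms(1)] openin_open_eq by blast
qed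

lemma metric_sym: "c \<in> A \<Longrightarrow> x \<in> fst c \<Longrightarrow> g c x $ i $ j = g c x $ j $ i"
  using gip_sym[of c x "axis i 1" "axis j 1"] exhaust_2[of i] exhaust_2[of j]
  by (auto simp: gip_def sum_2 axis_def)

lemma metric_pos:
  assumes "c \<in> A" "x \<in> fst c"
  shows "g c x $ 1 $ 1 > 0" "g c x $ 1 $ 1 * g c x $ 2 $ 2 - g c x $ 1 $ 2 * g c x $ 1 $ 2 > 0"
    "det (g c x) > 0"
proof -
  show 1: "g c x $ 1 $ 1 > 0"
    using gip_pos[OF assms, of "axis 1 1"] by (simp add: gip_def sum_2 axis_eq_0_iff) (simp add: axis_def)
  have s: "g c x $ 2 $ 1 = g c x $ 1 $ 2" by (rule metric_sym[OF assms])
  \<comment> \<open>A vector orthogonal to the first coordinate field; its square length is the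
    first metric entry times the determinant.\<close>
  define v :: "real^2" where "v = (\<chi> i. if i = 1 then - g c x $ 1 $ 2 else g c x $ 1 $ 1)"
  have "v \<noteq> 0" using 1 by (auto simp: vec_eq_iff v_def forall_2)
  then have "gip g c x v v > 0" by (rule gip_pos[OF assms])
  also have "gip g c x v v = g c x $ 1 $ 1 * (g c x $ 1 $ 1 * g c x $ 2 $ 2 - g c x $ 1 $ 2 * g c x $ 1 $ 2)"
    by (simp add: gip_def sum_2 v_def s algebra_simps)
  finally show 2: "g c x $ 1 $ 1 * g c x $ 2 $ 2 - g c x $ 1 $ 2 * g c x $ 1 $ 2 > 0"
    using 1 by (simp add: zero_less_mult_iff)
  then show "det (g c x) > 0" by (simp add: det_2 s)
qed

lemma pd_inv_chart: "c \<in> A \<Longrightarrow> y \<in> snd c ` fst c \<Longrightarrow> pd c i u (inv_chart c y) = dx i (local_rep c u) y"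
  by (auto simp: pd_def dx_def)

lemma pd_cong: 
  assumes "c \<in> A" "x \<in> fst c" "\<And>z. z \<in> fst c \<Longrightarrow> u z = v z"
  shows "pd c i u x = pd c i v x"
proof -
  have "dx i (local_rep c u) (snd c x) = dx i (local_rep c v) (snd c x)"
    by (rule dx_cong[OF open_range[OF assms(1)]]) (use assms in \<open>auto simp: local_rep_def\<close>)
  then show ?thesis by (simp add: pd_def dx_def)
qed

lemma metric_inverse:
  assumes "c \<in> A" "x \<in> fst c"
  shows "(\<Sum>m\<in>UNIV. g c x $ k $ m * matrix_inv (g c x) $ m $ j) = (if k = j then 1 else 0)"
    "(\<Sum>m\<in>UNIV. matrix_inv (g c x) $ k $ m * g c x $ m $ j) = (if k = j then 1 else 0)"
proof -
  have "(g c x ** matrix_inv (g c x)) $ k $ j = mat 1 $ k $ j" "(matrix_inv (g c x) ** g c x) $ k $ j = mat 1 $ k $ j"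
    using matrix_inv_works[of "g c x"] metric_pos(3)[OF assms] by auto
  then show "(\<Sum>m\<in>UNIV. g c x $ k $ m * matrix_inv (g c x) $ m $ j) = (if k = j then 1 else 0)"
    "(\<Sum>m\<in>UNIV. matrix_inv (g c x) $ k $ m * g c x $ m $ j) = (if k = j then 1 else 0)"
    by (simp_all add: matrix_matrix_mult_def mat_def)
qed

lemma pd_metric_sym:
  "c \<in> A \<Longrightarrow> x \<in> fst c \<Longrightarrow> pd c m (\<lambda>y. g c y $ i $ j) x = pd c m (\<lambda>y. g c y $ j $ i) x"
  by (rule pd_cong) (auto intro: metric_sym)

lemma christoffel_sym:
  assumes "c \<in> A" "x \<in> fst c"
  shows "christoffel g c k i j x = christoffel g c k j i x"
  unfolding christoffel_def pd_metric_sym[OF assms, of _ i j] by (simp add: algebra_simps)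

text \<open>The Koszul formula in coordinates: lowering the index cancels the inverse
  metric.\<close>

lemma christoffel_lower:
  assumes "c \<in> A" "x \<in> fst c"
  shows "(\<Sum>m\<in>UNIV. g c x $ k $ m * christoffel g c m i j x) =
    (pd c i (\<lambda>y. g c y $ j $ k) x + pd c j (\<lambda>y. g c y $ i $ k) x - pd c k (\<lambda>y. g c y $ i $ j) x) / 2"
proof -
  let ?L = "\<lambda>n. (pd c i (\<lambda>y. g c y $ j $ n) x + pd c j (\<lambda>y. g c y $ i $ n) x - pd c n (\<lambda>y. g c y $ i $ j) x) / 2"
  have "(\<Sum>m\<in>UNIV. g c x $ k $ m * christoffel g c m i j x) =
    (\<Sum>n\<in>UNIV. (\<Sum>m\<in>UNIV. g c x $ k $ m * matrix_inv (g c x) $ m $ n) * ?L n)"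
    unfolding christoffel_def sum_2 by (simp add: field_simps)
  also have "\<dots> = ?L k"
    unfolding metric_inverse[OF assms] using exhaust_2[of k] by (auto simp: sum_2)
  finally show ?thesis .
qed

lemma metric_compatible:
  assumes "c \<in> A" "x \<in> fst c"
  shows "pd c i (\<lambda>y. g c y $ j $ k) x =
    (\<Sum>m\<in>UNIV. christoffel g c m i j x * g c x $ m $ k + christoffel g c m i k x * g c x $ j $ m)"
proof -
  have "(\<Sum>m\<in>UNIV. christoffel g c m i j x * g c x $ m $ k + christoffel g c m i k x * g c x $ j $ m) =
    (\<Sum>m\<in>UNIV. g c x $ k $ m * christoffel g c m i j x) + (\<Sum>m\<in>UNIV. g c x $ j $ m * christoffel g c m i k x)"
    by (simp add: sum.distrib metric_sym[OF assms, of _ k] mult.commute)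
  also have "\<dots> = pd c i (\<lambda>y. g c y $ j $ k) x"
    unfolding christoffel_lower[OF assms] 
    by (simp add: pd_metric_sym[OF assms, of i k j] pd_metric_sym[OF assms, of j k i] pd_metric_sym[OF assms, of k j i] field_simps)
  finally show ?thesis ..
qed

lemma smooth_matrix_inv:
  assumes "c \<in> A"
  shows "smooth_on (snd c ` fst c) (local_rep c (\<lambda>x. matrix_inv (g c x) $ i $ j))"
proof -
  let ?S = "snd c ` fst c" and ?d = "\<lambda>y. local_rep c (\<lambda>x. det (g c x)) y"
  have S: "open ?S" using open_range[OF assms] .
  have "smooth_on ?S ?d"
    unfolding local_rep_def comp_def det_2
    using smooth_metric[OF assms, unfolded local_rep_def comp_def]
    by (intro smooth_on_diff smooth_on_mult S)
  moreover have "?d y > 0" if "y \<in> ?S" for y using that metric_pos(3)[OF assms] assms by (auto simp: local_rep_def)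
  ultimately have i: "smooth_on ?S (\<lambda>y. inverse (?d y))" by (rule smooth_on_inverse[OF S])
  have dn: "det (g c (inv_chart c y)) \<noteq> 0" if "y \<in> ?S" for y
    using that metric_pos(3)[OF assms] assms by fastforce
  have "smooth_on ?S (\<lambda>y. (if i = j then local_rep c (\<lambda>x. g c x $ (i + 1) $ (i + 1)) y
      else - local_rep c (\<lambda>x. g c x $ i $ j) y) * inverse (?d y))"
    by (cases "i = j") (auto intro!: smooth_on_mult smooth_on_minus S smooth_metric assms i)
  then show ?thesis
    by (rule smooth_on_cong[OF S, rotated]) (simp add: local_rep_def matrix_inv_2[OF dn])
qed

lemma smooth_christoffel:
  assumes "c \<in> A"
  shows "smooth_on (snd c ` fst c) (local_rep c (christoffel g c k i j))"
proof -
  let ?S = "snd c ` fst c"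
  have S: "open ?S" using open_range[OF assms] .
  let ?p = "\<lambda>i j m. dx i (local_rep c (\<lambda>x. g c x $ j $ m))"
  have "smooth_on ?S (\<lambda>y. \<Sum>m\<in>UNIV. local_rep c (\<lambda>x. matrix_inv (g c x) $ k $ m) y * (1/2) *
     (?p i j m y + ?p j i m y - ?p m i j y))"
    by (intro smooth_on_sum smooth_on_mult smooth_on_diff smooth_on_add smooth_on_dx smooth_on_const S
      smooth_matrix_inv smooth_metric assms)
  then show ?thesis
    by (rule smooth_on_cong[OF S, rotated])
      (simp add: local_rep_def[of c "christoffel _ _ _ _ _"] christoffel_def pd_inv_chart[OF assms] del: image_iff, simp add: local_rep_def)
qed

text \<open>The frame comes from the roots of the quadratic form of the metric, which has discriminant \<open>-4D\<close>.\<close>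

definition null_vec :: "'m chart \<Rightarrow> sign \<Rightarrow> 2 \<Rightarrow> 'm \<Rightarrow> complex" where
  "null_vec c s i x = (let D = g c x $ 1 $ 1 * g c x $ 2 $ 2 - g c x $ 1 $ 2 * g c x $ 1 $ 2 in
     case s of
       Plus \<Rightarrow> if i = 1 then (- of_real (g c x $ 1 $ 2) + \<i> * of_real (sqrt D)) * of_real (inverse (g c x $ 1 $ 1)) else 1
     | Minus \<Rightarrow> (if i = 1 then - of_real (g c x $ 1 $ 2) - \<i> * of_real (sqrt D) else of_real (g c x $ 1 $ 1)) * of_real (inverse D))"

abbreviation cmetric :: "'m chart \<Rightarrow> 'm \<Rightarrow> 2 \<Rightarrow> 2 \<Rightarrow> complex" where
  "cmetric c x i j \<equiv> of_real (g c x $ i $ j)"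

text \<open>Normalised to second coordinate 1, the two isotropic vectors pair to 2 D / a, where a is
  the first metric entry and D the determinant. For this reason the vector of sign
  \<open>Minus\<close> carries the additional factor a / D.\<close>

lemma null_frame_null_vec:
  assumes "c \<in> A" "x \<in> fst c"
  shows "null_frame (cmetric c x) (\<lambda>s i. null_vec c s i x)"
proof -
  define a b d where "a = g c x $ 1 $ 1" and "b = g c x $ 1 $ 2" and "d = g c x $ 2 $ 2"
  define q where "q = complex_of_real (sqrt (a * d - b * b))"
  have ba: "g c x $ 2 $ 1 = b" unfolding b_def by (rule metric_sym[OF assms])
  have nz: "complex_of_real a \<noteq> 0" "complex_of_real a * of_real d - of_real b * of_real b \<noteq> 0"
    using metric_pos(1,2)[OF assms] by (auto simp: a_def b_def d_def simp flip: of_real_mult of_real_diff)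
  have q: "q * q = of_real a * of_real d - of_real b * of_real b"
    using metric_pos(2)[OF assms] by (simp add: q_def a_def b_def d_def flip: of_real_mult of_real_diff)
  have i: "\<i> * \<i> = -1" by simp
  \<comment> \<open>Names for the inverses turn the four pairings into polynomial
    identities.\<close>
  define a' where "a' = inverse (complex_of_real a)"
  define D' where "D' = inverse (complex_of_real a * of_real d - of_real b * of_real b)"
  have inv: "of_real a * a' = 1" "(of_real a * of_real d - of_real b * of_real b) * D' = 1"
    using nz by (simp_all add: a'_def D'_def)
  have h: "null_vec c Plus 1 x = (- of_real b + \<i> * q) * a'" "null_vec c Plus 2 x = 1"
    "null_vec c Minus 1 x = (- of_real b - \<i> * q) * D'" "null_vec c Minus 2 x = of_real a * D'"
    by (simp_all add: null_vec_def Let_def a_def b_def d_def q_def a'_def D'_def)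
  note E = sum_2 h ba a_def[symmetric] b_def[symmetric] d_def[symmetric]
  have "(\<Sum>i\<in>UNIV. \<Sum>j\<in>UNIV. cmetric c x i j * null_vec c Plus i x * null_vec c Plus j x) = 0"
    "(\<Sum>i\<in>UNIV. \<Sum>j\<in>UNIV. cmetric c x i j * null_vec c Minus i x * null_vec c Minus j x) = 0"
    "(\<Sum>i\<in>UNIV. \<Sum>j\<in>UNIV. cmetric c x i j * null_vec c Plus i x * null_vec c Minus j x) = 2"
    "(\<Sum>i\<in>UNIV. \<Sum>j\<in>UNIV. cmetric c x i j * null_vec c Minus i x * null_vec c Plus j x) = 2"
    using q i inv unfolding E by algebra+
  then have "(\<Sum>i\<in>UNIV. \<Sum>j\<in>UNIV. cmetric c x i j * null_vec c s i x * null_vec c t j x) = hpair s t" for s t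
    by (cases s; cases t) (simp_all add: hpair_def)
  then show ?thesis
    unfolding null_frame_def using metric_sym[OF assms] by auto
qed

lemma smooth_null_vec:
  assumes "c \<in> A"
  shows "smooth_on (snd c ` fst c) (local_rep c (null_vec c s i))"
proof -
  let ?S = "snd c ` fst c"
  have S: "open ?S" using open_range[OF assms] .
  define G where "G i j y = local_rep c (\<lambda>x. g c x $ i $ j) y" for i j y
  define D where "D y = G 1 1 y * G 2 2 y - G 1 2 y * G 1 2 y" for y
  have G: "smooth_on ?S (\<lambda>y. G i j y)" for i j unfolding G_def by (rule smooth_metric[OF assms])
  have D: "smooth_on ?S (\<lambda>y. D y)" unfolding D_def by (intro smooth_on_diff smooth_on_mult S G)
  have p: "G 1 1 y > 0" "D y > 0" if "y \<in> ?S" for y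
    using that metric_pos(1,2)[OF assms] assms by (auto simp: G_def D_def local_rep_def)
  note i = smooth_on_inverse[OF S G p(1)] smooth_on_inverse[OF S D p(2)] smooth_on_sqrt[OF S D p(2)]
  have e: "local_rep c (null_vec c s i) = (\<lambda>y. case s of
       Plus \<Rightarrow> if i = 1 then (- of_real (G 1 2 y) + \<i> * of_real (sqrt (D y))) * of_real (inverse (G 1 1 y)) else 1
     | Minus \<Rightarrow> (if i = 1 then - of_real (G 1 2 y) - \<i> * of_real (sqrt (D y)) else of_real (G 1 1 y)) * of_real (inverse (D y)))"
    by (rule ext) (simp add: local_rep_def null_vec_def Let_def G_def D_def split: sign.split)
  note I = smooth_on_mult smooth_on_add smooth_on_diff smooth_on_minus smooth_on_const smooth_on_of_real S G
  have "smooth_on ?S (\<lambda>y. (- of_real (G 1 2 y) + \<i> * of_real (sqrt (D y))) * complex_of_real (inverse (G 1 1 y)))"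
    by (intro I i)
  moreover have "smooth_on ?S (\<lambda>y. (- of_real (G 1 2 y) - \<i> * of_real (sqrt (D y))) * complex_of_real (inverse (D y)))"
    by (intro I i(2,3))
  moreover have "smooth_on ?S (\<lambda>y. of_real (G 1 1 y) * complex_of_real (inverse (D y)))"
    by (intro I i(2))
  ultimately show ?thesis
    unfolding e by (cases s; cases "i = 1") (simp_all add: smooth_on_const)
qed

definition chart_metric where "chart_metric c i j y = complex_of_real (g c (inv_chart c y) $ i $ j)"
definition chart_gamma where "chart_gamma c k i j y = complex_of_real (christoffel g c k i j (inv_chart c y))"

lemma chart_geometry:
  assumes c: "c \<in> A" and K: "constant_curvature A g K" and W: "open W"
  shows "chart_geometry (snd c ` (fst c \<inter> W)) (chart_metric c) (chart_gamma c) (\<lambda>s i. local_rep c (null_vec c s i)) (of_real K)"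
proof
  let ?S = "snd c ` (fst c \<inter> W)"
  have sub: "?S \<subseteq> snd c ` fst c" by auto
  show S: "open ?S" by (rule open_image[OF c W])
  have G_eq: "chart_metric c i j = (\<lambda>y. of_real (local_rep c (\<lambda>x. g c x $ i $ j) y))" for i j
    by (rule ext) (simp add: chart_metric_def local_rep_def)
  have Gam_eq: "chart_gamma c k i j = (\<lambda>y. of_real (local_rep c (christoffel g c k i j) y))" for k i j
    by (rule ext) (simp add: chart_gamma_def local_rep_def)
  show "smooth_on ?S (chart_metric c i j)" for i j
    unfolding G_eq by (intro smooth_on_of_real S smooth_on_subset[OF smooth_metric[OF c] sub])
  show "smooth_on ?S (chart_gamma c k i j)" for k i j
    unfolding Gam_eq by (intro smooth_on_of_real S smooth_on_subset[OF smooth_christoffel[OF c] sub])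
  show "smooth_on ?S (local_rep c (null_vec c s i))" for s i
    by (rule smooth_on_subset[OF smooth_null_vec[OF c] sub])
  fix y assume y: "y \<in> ?S"
  then have y': "y \<in> snd c ` fst c" by auto
  let ?x = "inv_chart c y"
  have x: "?x \<in> fst c" using y c by auto
  show "chart_gamma c k i j y = chart_gamma c k j i y" for k i j
    by (simp add: chart_gamma_def christoffel_sym[OF c x, of k i j])
  show "null_frame (\<lambda>i j. chart_metric c i j y) (\<lambda>s i. local_rep c (null_vec c s i) y)"
    using null_frame_null_vec[OF c x] by (simp add: chart_metric_def local_rep_def)
  have dG: "dx i (chart_metric c j k) y = of_real (pd c i (\<lambda>x. g c x $ j $ k) ?x)" for i j k
    unfolding G_eq pd_inv_chart[OF c y']
    by (rule dx_of_real) (rule smooth_on_differentiable[OF smooth_metric[OF c] y'])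
  show "dx i (chart_metric c j k) y = (\<Sum>m\<in>UNIV. chart_gamma c m i j y * chart_metric c m k y + chart_gamma c m i k y * chart_metric c j m y)" for i j k
    unfolding dG metric_compatible[OF c x] by (simp add: chart_gamma_def chart_metric_def)
  have dGam: "dx i (chart_gamma c l j k) y = of_real (pd c i (christoffel g c l j k) ?x)" for i j k l
    unfolding Gam_eq pd_inv_chart[OF c y']
    by (rule dx_of_real) (rule smooth_on_differentiable[OF smooth_christoffel[OF c] y'])
  \<comment> \<open>The section spanned by the coordinate fields yields the one curvature component
    that the locale asks for.\<close>
  let ?v = "axis 1 1 :: real^2" and ?w = "axis 2 1 :: real^2"
  have D: "gip g c ?x ?v ?v * gip g c ?x ?w ?w - (gip g c ?x ?v ?w)\<^sup>2 =
      g c ?x $ 1 $ 1 * g c ?x $ 2 $ 2 - g c ?x $ 1 $ 2 * g c ?x $ 1 $ 2"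
    by (simp add: gip_def sum_2 axis_def power2_eq_square)
  then have "sectional_curvature g c ?x ?v ?w = K"
    using K c x metric_pos(2)[OF c x] unfolding constant_curvature_def by (metis less_irrefl)
  then have "gip g c ?x (riem_op g c ?x ?v ?w ?w) ?v = K * (g c ?x $ 1 $ 1 * g c ?x $ 2 $ 2 - g c ?x $ 1 $ 2 * g c ?x $ 1 $ 2)"
    using metric_pos(2)[OF c x] unfolding sectional_curvature_def D by (simp add: field_simps)
  moreover have "gip g c ?x (riem_op g c ?x ?v ?w ?w) ?v = (\<Sum>a\<in>UNIV. g c ?x $ a $ 1 * riem g c a 2 1 2 ?x)"
    by (simp add: gip_def sum_2 axis_def riem_op_def)
  ultimately have "(\<Sum>a\<in>UNIV. g c ?x $ a $ 1 * riem g c a 2 1 2 ?x) =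
     K * (g c ?x $ 1 $ 1 * g c ?x $ 2 $ 2 - g c ?x $ 1 $ 2 * g c ?x $ 1 $ 2)" by simp
  then have "complex_of_real (\<Sum>a\<in>UNIV. g c ?x $ a $ 1 * riem g c a 2 1 2 ?x) =
     of_real (K * (g c ?x $ 1 $ 1 * g c ?x $ 2 $ 2 - g c ?x $ 1 $ 2 * g c ?x $ 1 $ 2))" by simp
  then show "(\<Sum>a\<in>UNIV. chart_metric c a 1 y * (dx 1 (chart_gamma c a 2 2) y - dx 2 (chart_gamma c a 1 2) y +
        (\<Sum>m\<in>UNIV. chart_gamma c a 1 m y * chart_gamma c m 2 2 y - chart_gamma c a 2 m y * chart_gamma c m 1 2 y))) =
        of_real K * (chart_metric c 1 1 y * chart_metric c 2 2 y - (chart_metric c 1 2 y)\<^sup>2)"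
    unfolding dGam by (simp add: chart_metric_def chart_gamma_def riem_def power2_eq_square)
qed

end

section \<open>Parallel sections\<close>

context chart_geometry
begin

lemma kappa_nz: "y \<in> S \<Longrightarrow> K \<noteq> 0 \<Longrightarrow> kappa y \<noteq> 0"
  using kappa_eq[of y] by auto

text \<open>The mixed derivatives of the component differ by \<open>n * kappa\<close> times the
  component itself, so curvature forbids a nonzero parallel component of nonzero charge.\<close>

lemma parallel_components:
  assumes sm: "smooth_on S \<xi>" and d: "\<And>y i. y \<in> S \<Longrightarrow> dx i \<xi> y = of_int n * theta i y * \<xi> y"
    and n: "n \<noteq> 0" "K \<noteq> 0" and y: "y \<in> S"
  shows "\<xi> y = 0"
proof -
  have [simp]: "\<xi> differentiable (at y)" by (rule smooth_on_differentiable[OF sm y])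
  have "dx i (dx j \<xi>) y = dx i (\<lambda>y. of_int n * theta j y * \<xi> y) y" for i j
    by (rule dx_cong[OF open_S y]) (rule d)
  then have e: "dx i (dx j \<xi>) y = of_int n * dx i (theta j) y * \<xi> y + of_int n * theta j y * (of_int n * theta i y * \<xi> y)" for i j
    using y by (simp add: dx_mult d)
  have "dx 1 (dx 2 \<xi>) y = dx 2 (dx 1 \<xi>) y" by (rule dx_commute[OF sm open_S y])
  then have "of_int n * kappa y * \<xi> y = 0"
    unfolding e kappa_def by (simp add: algebra_simps)
  then show ?thesis using n kappa_nz[OF y] by simp
qed

text \<open>Convexity of the ball replaces connectedness of \<open>S\<close>; constancy is only
  claimed locally.\<close>

lemma constant_on_ball:
  assumes "smooth_on S \<xi>" "\<And>y i. y \<in> S \<Longrightarrow> dx i \<xi> y = 0" "ball y r \<subseteq> S" "z \<in> ball y r"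
  shows "\<xi> z = \<xi> y"
proof -
  have "(\<xi> has_derivative (\<lambda>h. 0)) (at x within ball y r)" if "x \<in> ball y r" for x
  proof -
    have x: "x \<in> S" using that assms(3) by blast
    have df: "\<xi> differentiable (at x)" by (rule smooth_on_differentiable[OF assms(1) x])
    have "frechet_derivative \<xi> (at x) = (\<lambda>h. 0)"
      by (rule ext) (simp add: frechet_derivative_expand[OF df] assms(2)[OF x])
    then show ?thesis using has_derivative_frechet[OF df] has_derivative_at_withinI by metis
  qed
  then obtain c where c: "\<forall>x\<in>ball y r. \<xi> x = c"
    using has_derivative_zero_constant[OF convex_ball] by blast
  have "y \<in> ball y r" using assms(4) by (auto intro: le_less_trans[OF zero_le_dist])
  then show ?thesis using c assms(4) by metis
qed

end

section \<open>Frame components of parallel sections on the surface\<close>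

context riemannian
begin

text \<open>The transformation law of the metric makes the Jacobian an isometry, so null frames go
  to null frames and their coframes are pulled back.\<close>

lemma jac_frame:
  assumes "c \<in> A" "d \<in> A" "x \<in> fst c" "x \<in> fst d" "null_frame (cmetric c x) h"
  defines "h' \<equiv> \<lambda>s a. \<Sum>i\<in>UNIV. of_real (jac c d x a i) * h s i"
  shows "null_frame (cmetric d x) h'"
    and "coframe (cmetric c x) h s i = (\<Sum>a\<in>UNIV. coframe (cmetric d x) h' s a * of_real (jac c d x a i))"
proof -
  have m: "cmetric c x i j = (\<Sum>a\<in>UNIV. \<Sum>b\<in>UNIV. of_real (jac c d x a i) * of_real (jac c d x b j) * cmetric d x a b)" for i j
    using metric_transform[of c d x i j] assms(1-4) by simp
  have s: "cmetric d x i j = cmetric d x j i" for i j using metric_sym[OF assms(2,4), of i j] by simp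
  have "(\<Sum>i\<in>UNIV. \<Sum>j\<in>UNIV. cmetric d x i j * h' s i * h' t j) =
    (\<Sum>i\<in>UNIV. \<Sum>j\<in>UNIV. cmetric c x i j * h s i * h t j)" for s t
    unfolding m h'_def sum_2 by (simp add: algebra_simps)
  then show "null_frame (cmetric d x) h'"
    using assms(5) s unfolding null_frame_def by simp
  show "coframe (cmetric c x) h s i = (\<Sum>a\<in>UNIV. coframe (cmetric d x) h' s a * of_real (jac c d x a i))"
    unfolding coframe_def m h'_def sum_2 by (simp add: field_simps)
qed

definition frame_comp :: "('m chart \<Rightarrow> 'm \<Rightarrow> 2 list \<Rightarrow> complex) \<Rightarrow> 'm chart \<Rightarrow> 'm \<Rightarrow> (sign \<Rightarrow> 2 \<Rightarrow> complex) \<Rightarrow> sign list \<Rightarrow> complex" where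
  "frame_comp X c x h w = pair (X c x) (map (coframe (cmetric c x) h) w)"

text \<open>The frame of \<open>c\<close> is pushed into the chart \<open>d\<close>, where two null
  frames of one metric can be compared by \<open>coframe_compare\<close>. The scalings of the single
  letters collect into a power given by the charge.\<close>

lemma comp_compare:
  assumes X: "parallel_section A g k X"
    and c: "c \<in> A" "x \<in> fst c" "null_frame (cmetric c x) h"
    and d: "d \<in> A" "x \<in> fst d" "null_frame (cmetric d x) h'"
  obtains \<mu> \<sigma> where "\<sigma> = id \<or> \<sigma> = neg"
    "\<And>w. length w = k \<Longrightarrow> frame_comp X d x h' w = \<mu> powi charge w * frame_comp X c x h (map \<sigma> w)"
proof -
  define h2 where "h2 = (\<lambda>s a. \<Sum>i\<in>UNIV. of_real (jac c d x a i) * h s i)"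
  note jf = jac_frame[OF c(1) d(1) c(2) d(2) c(3), folded h2_def]
  obtain \<mu> \<sigma> where \<sigma>: "\<sigma> = id \<or> \<sigma> = neg" and \<mu>: "\<mu> Plus * \<mu> Minus = 1"
    and co: "\<And>s i. coframe (cmetric d x) h' s i = \<mu> s * coframe (cmetric d x) h2 (\<sigma> s) i"
    using coframe_compare[OF jf(1) d(3)] by metis
  have "frame_comp X d x h' w = \<mu> Plus powi charge w * frame_comp X c x h (map \<sigma> w)" if w: "length w = k" for w
  proof -
    have "frame_comp X d x h' w = pair (X d x) (map (\<lambda>s i. \<mu> s * coframe (cmetric d x) h2 (\<sigma> s) i) w)"
      by (simp add: frame_comp_def co[abs_def])
    also have "\<dots> = \<mu> Plus powi charge w * pair (X d x) (map (coframe (cmetric d x) h2) (map \<sigma> w))"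
      unfolding pair_scaled_frame by (simp add: prod_list_charge[OF \<mu>])
    also have "pair (X d x) (map (coframe (cmetric d x) h2) (map \<sigma> w)) =
        pair (transf (\<lambda>a i. of_real (jac c d x a i)) (X c x)) (map (coframe (cmetric d x) h2) (map \<sigma> w))"
      by (rule pair_cong) (use X c d w in \<open>simp add: parallel_section_def transf_def\<close>)
    also have "\<dots> = frame_comp X c x h (map \<sigma> w)"
    proof -
      have "(\<lambda>j. \<Sum>a\<in>UNIV. coframe (cmetric d x) h2 s a * of_real (jac c d x a j)) = coframe (cmetric c x) h s" for s
        by (rule ext) (simp add: jf(2))
      then show ?thesis unfolding pair_transf frame_comp_def by (simp add: o_def)
    qed
    finally show ?thesis .
  qed
  then show thesis using that \<sigma> by blast
qed

end

locale const_curv = riemannian A g for A :: "'m::topological_space chart set" and g +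
  fixes K :: real
  assumes curvature: "constant_curvature A g K" and K: "K \<noteq> 0"
begin

lemma parallel_comp:
  assumes X: "parallel_section A g k X" and c: "c \<in> A" and w: "length w = k"
  defines "S \<equiv> snd c ` fst c"
  defines "\<xi> \<equiv> \<lambda>y. frame_comp X c (inv_chart c y) (\<lambda>s i. null_vec c s i (inv_chart c y)) w"
  shows "smooth_on S \<xi>"
    and "y \<in> S \<Longrightarrow> charge w = 0 \<Longrightarrow> dx i \<xi> y = 0"
    and "y \<in> S \<Longrightarrow> charge w \<noteq> 0 \<Longrightarrow> \<xi> y = 0"
proof -
  interpret cg: chart_geometry S "chart_metric c" "chart_gamma c" "\<lambda>s i. local_rep c (null_vec c s i)" "of_real K"
    using chart_geometry[OF c curvature open_UNIV] by (simp add: S_def)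
  \<comment> \<open>Zero at other lengths: \<open>parallel_section\<close> constrains only index
    lists of length \<open>k\<close>, while \<open>dx_pair\<close> and \<open>smooth_pair\<close>
    speak about all lists.\<close>
  define T where "T y I = (if length I = k then X c (inv_chart c y) I else 0)" for y I
  have lX: "local_rep c (\<lambda>x. X c x I) = (\<lambda>y. X c (inv_chart c y) I)" for I by (simp add: local_rep_def fun_eq_iff)
  have Tsm: "smooth_on S (\<lambda>y. T y I)" for I
    using X c unfolding parallel_section_def smooth_in_chart_def T_def S_def
    by (cases "length I = k") (auto simp: smooth_on_const lX)
  have \<xi>: "\<xi> = (\<lambda>y. pair (T y) (frame_at cg.eta y w))"
  proof
    fix y
    have "coframe (cmetric c (inv_chart c y)) (\<lambda>s i. null_vec c s i (inv_chart c y)) = (\<lambda>s a. cg.eta s a y)"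
      unfolding cg.eta_def by (simp add: fun_eq_iff chart_metric_def local_rep_def)
    then show "\<xi> y = pair (T y) (frame_at cg.eta y w)"
      unfolding \<xi>_def frame_comp_def using w by (auto intro!: pair_cong simp: T_def)
  qed
  show sm: "smooth_on S \<xi>"
    unfolding \<xi> by (rule smooth_pair[OF cg.open_S Tsm cg.smooth_eta])
  have d: "dx i \<xi> y = of_int (charge w) * cg.theta i y * \<xi> y" if y: "y \<in> S" for i y
  proof -
    have "dx i \<xi> y = pair (\<lambda>J. dx i (\<lambda>y. T y J) y - (\<Sum>a<length J. \<Sum>b\<in>UNIV. - chart_gamma c (J ! a) i b y * T y (J[a := b])))
        (frame_at cg.eta y w) + of_int (charge w) * cg.theta i y * \<xi> y"
      unfolding \<xi>
      by (rule dx_pair[where M = "\<lambda>a b. - chart_gamma c b i a y", THEN conjunct2])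
        (use smooth_on_differentiable[OF Tsm y] y in \<open>auto simp: cg.dx_eta sum_negf\<close>)
    also have "pair (\<lambda>J. dx i (\<lambda>y. T y J) y - (\<Sum>a<length J. \<Sum>b\<in>UNIV. - chart_gamma c (J ! a) i b y * T y (J[a := b])))
        (frame_at cg.eta y w) = pair (\<lambda>J. 0) (frame_at cg.eta y w)"
    proof (rule pair_cong)
      fix J :: "2 list" assume "length J = length (frame_at cg.eta y w)"
      then have J: "length J = k" using w by simp
      have x: "inv_chart c y \<in> fst c" using y c by (auto simp: S_def)
      have "pd c i (\<lambda>y. X c y J) (inv_chart c y) +
        (\<Sum>a<k. \<Sum>b\<in>UNIV. of_real (christoffel g c (J ! a) i b (inv_chart c y)) * X c (inv_chart c y) (J[a := b])) = 0"
        using X c J x unfolding parallel_section_def by blast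
      moreover have "dx i (\<lambda>y. T y J) y = pd c i (\<lambda>y. X c y J) (inv_chart c y)"
        using y J c by (simp add: pd_inv_chart S_def lX T_def)
      ultimately show "dx i (\<lambda>y. T y J) y - (\<Sum>a<length J. \<Sum>b\<in>UNIV. - chart_gamma c (J ! a) i b y * T y (J[a := b])) = 0"
        using J by (simp add: chart_gamma_def T_def sum_negf)
    qed
    finally show ?thesis by (simp add: pair_zero)
  qed
  then show "y \<in> S \<Longrightarrow> charge w = 0 \<Longrightarrow> dx i \<xi> y = 0" by simp
  show "y \<in> S \<Longrightarrow> charge w \<noteq> 0 \<Longrightarrow> \<xi> y = 0"
    by (rule cg.parallel_components[OF sm d]) (use K in auto)
qed

text \<open>Passing to another frame rescales the components and at most exchanges the signs of the
  word, which keeps its charge nonzero; so the frame \<open>null_vec\<close> decides.\<close>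

lemma charged_comp_zero:
  assumes X: "parallel_section A g k X" and c: "c \<in> A" "x \<in> fst c" "null_frame (cmetric c x) h"
    and w: "length w = k" "charge w \<noteq> 0"
  shows "frame_comp X c x h w = 0"
proof -
  obtain \<mu> \<sigma> where \<sigma>: "\<sigma> = id \<or> \<sigma> = neg" and e: "\<And>w. length w = k \<Longrightarrow> frame_comp X c x h w = \<mu> powi charge w *
      frame_comp X c x (\<lambda>s i. null_vec c s i x) (map \<sigma> w)"
    using comp_compare[OF X c(1,2) null_frame_null_vec[OF c(1,2)] c] by metis
  have "length (map \<sigma> w) = k" "charge (map \<sigma> w) \<noteq> 0" using \<sigma> w by auto
  then have "frame_comp X c x (\<lambda>s i. null_vec c s i x) (map \<sigma> w) = 0"
    using parallel_comp(3)[OF X c(1), of "map \<sigma> w" "snd c x"] c by simp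
  then show ?thesis by (simp add: e[OF w(1)])
qed

text \<open>Symmetrising over the exchange of the two null lines makes an orientation of the frames unnecessary.\<close>

lemma neutral_comp_constant:
  assumes conn: "connected (UNIV :: 'm set)" and X: "parallel_section A g k X" and w: "length w = k" "charge w = 0"
    and c: "c \<in> A" "x \<in> fst c" "null_frame (cmetric c x) h"
    and d: "d \<in> A" "y \<in> fst d" "null_frame (cmetric d y) h'"
  shows "frame_comp X c x h w + frame_comp X c x h (map neg w) = frame_comp X d y h' w + frame_comp X d y h' (map neg w)"
proof -
  have inv: "frame_comp X c x h w + frame_comp X c x h (map neg w) = frame_comp X d x h' w + frame_comp X d x h' (map neg w)"
    if c: "c \<in> A" "x \<in> fst c" "null_frame (cmetric c x) h" and d: "d \<in> A" "x \<in> fst d" "null_frame (cmetric d x) h'"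
    for c d h h' x
  proof -
    obtain \<mu> \<sigma> where \<sigma>: "\<sigma> = id \<or> \<sigma> = neg" and e: "\<And>w. length w = k \<Longrightarrow> frame_comp X c x h w = \<mu> powi charge w *
      frame_comp X d x h' (map \<sigma> w)"
      using comp_compare[OF X d c] by metis
    have "frame_comp X c x h w = frame_comp X d x h' (map \<sigma> w)" "frame_comp X c x h (map neg w) = frame_comp X d x h' (map \<sigma> (map neg w))"
      using e[of w] e[of "map neg w"] w by simp_all
    moreover have "map neg (map neg w) = w" by (simp add: o_def)
    ultimately show ?thesis using \<sigma> by auto
  qed
  \<comment> \<open>A chart is picked at each point to make the symmetrised component a function on
    the surface. By \<open>inv\<close> its value does not depend on the choice, so local constancy
    can be tested in a single chart.\<close>
  define ch where "ch x = (SOME c. c \<in> A \<and> x \<in> fst c)" for x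
  have ch: "ch x \<in> A" "x \<in> fst (ch x)" for x
  proof -
    have "\<exists>c. c \<in> A \<and> x \<in> fst c" using atlas by blast
    from someI_ex[OF this] show "ch x \<in> A" "x \<in> fst (ch x)" by (simp_all add: ch_def)
  qed
  define E where "E x = frame_comp X (ch x) x (\<lambda>s i. null_vec (ch x) s i x) w + frame_comp X (ch x) x (\<lambda>s i. null_vec (ch x) s i x) (map neg w)" for x
  have E: "frame_comp X c x h w + frame_comp X c x h (map neg w) = E x"
    if "c \<in> A" "x \<in> fst c" "null_frame (cmetric c x) h" for c x h
    unfolding E_def by (rule inv[OF that ch null_frame_null_vec[OF ch]])
  have "E constant_on UNIV"
  proof (rule locally_constant_imp_constant[OF conn])
    fix x :: 'm
    let ?c = "ch x" and ?f = "snd (ch x)"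
    let ?S = "?f ` fst ?c"
    interpret cg: chart_geometry ?S "chart_metric ?c" "chart_gamma ?c" "\<lambda>s i. local_rep ?c (null_vec ?c s i)" "of_real K"
      using chart_geometry[OF ch(1) curvature open_UNIV] by simp
    define \<xi> where "\<xi> w y = frame_comp X ?c (inv_chart ?c y) (\<lambda>s i. null_vec ?c s i (inv_chart ?c y)) w" for w y
    have "?f x \<in> ?S" using ch(2) by blast
    then obtain r where r: "r > 0" "ball (?f x) r \<subseteq> ?S"
      using open_range[OF ch(1)] open_contains_ball by blast
    have const: "\<xi> v z = \<xi> v (?f x)" if "length v = k" "charge v = 0" "z \<in> ball (?f x) r" for v z
      unfolding \<xi>_def
      by (rule cg.constant_on_ball[OF parallel_comp(1,2)[OF X ch(1) that(1)] r(2) that(3)]) (use that(2) in auto)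
    define T where "T = fst ?c \<inter> ?f -` ball (?f x) r"
    have "openin (top_of_set UNIV) T"
      unfolding T_def subtopology_UNIV open_openin[symmetric]
      by (rule continuous_open_preimage) (use homeo[OF ch(1)] open_dom[OF ch(1)] in \<open>auto simp: homeomorphism_def\<close>)
    moreover have "x \<in> T" using ch(2) r by (simp add: T_def)
    moreover have "E z = E x" if "z \<in> T" for z
    proof -
      have z: "z \<in> fst ?c" "?f z \<in> ball (?f x) r" using that by (auto simp: T_def)
      have *: "E z = \<xi> w (?f z) + \<xi> (map neg w) (?f z)" if "z \<in> fst ?c" for z
        using E[OF ch(1) that null_frame_null_vec[OF ch(1) that]] that ch(1) by (simp add: \<xi>_def)
      have "\<xi> w (?f z) = \<xi> w (?f x)" "\<xi> (map neg w) (?f z) = \<xi> (map neg w) (?f x)"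
        by (rule const[OF _ _ z(2)]; use w in simp)+
      then show ?thesis unfolding *[OF z(1)] *[OF ch(2)] by (rule arg_cong2)
    qed
    ultimately show "\<exists>T. openin (top_of_set UNIV) T \<and> x \<in> T \<and> (\<forall>z\<in>T. E z = E x)" by blast
  qed
  then have "E x = E y" unfolding constant_on_def by auto
  then show ?thesis using E[OF c] E[OF d] by simp
qed

section \<open>The Laplacian and the action of parallel sections in a chart\<close>

definition lap :: "'m chart \<Rightarrow> 'm set \<Rightarrow> (real^2 \<Rightarrow> complex) \<Rightarrow> real^2 \<Rightarrow> complex" where
  "lap c U = chart_geometry.Lap (snd c ` (fst c \<inter> U)) (chart_metric c) (chart_gamma c) (\<lambda>s i. local_rep c (null_vec c s i))"

context
  fixes c :: "'m chart" and U :: "'m set" and S :: "(real^2) set"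
  assumes c: "c \<in> A" and U: "open U"
  defines "S \<equiv> snd c ` (fst c \<inter> U)"
begin

interpretation cg: chart_geometry S "chart_metric c" "chart_gamma c" "\<lambda>s i. local_rep c (null_vec c s i)" "of_real K"
  using chart_geometry[OF c curvature U] by (simp add: S_def)

lemma S_dom: "y \<in> S \<Longrightarrow> y \<in> snd c ` fst c" "y \<in> S \<Longrightarrow> inv_chart c y \<in> fst c" "y \<in> S \<Longrightarrow> inv_chart c y \<in> U"
  using c by (auto simp: S_def)

lemma nabla_pow_chart: "y \<in> S \<Longrightarrow> nabla_pow g c k u I (inv_chart c y) = cg.nabla_comp k (local_rep c u) y I"
proof (induction k arbitrary: y I)
  case 0
  then show ?case by (simp add: local_rep_def)
next
  case (Suc k)
  show ?case
  proof (cases I)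
    case Nil
    then show ?thesis by (simp add: cov_deriv_def)
  next
    case (Cons i J)
    have "pd c i (nabla_pow g c k u J) (inv_chart c y) = dx i (local_rep c (nabla_pow g c k u J)) y"
      by (rule pd_inv_chart[OF c S_dom(1)[OF Suc.prems]])
    also have "\<dots> = dx i (\<lambda>y. cg.nabla_comp k (local_rep c u) y J) y"
      by (rule dx_cong[OF cg.open_S Suc.prems]) (use Suc.IH in \<open>simp add: local_rep_def[of c "nabla_pow _ _ _ _ _"]\<close>)
    finally have "pd c i (nabla_pow g c k u J) (inv_chart c y) = dx i (\<lambda>y. cg.nabla_comp k (local_rep c u) y J) y" .
    moreover have "complex_of_real (christoffel g c a b d (inv_chart c y)) = chart_gamma c a b d y" for a b d
      by (simp add: chart_gamma_def)
    ultimately show ?thesis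
      by (simp add: Cons cov_deriv_def Suc.IH[OF Suc.prems])
  qed
qed

text \<open>Both sides invert the metric, one from the left by \<open>metric_inverse\<close>, the
  other from the right by duality of frame and coframe.\<close>

lemma inverse_metric_frame:
  assumes "y \<in> S"
  shows "complex_of_real (matrix_inv (g c (inv_chart c y)) $ i $ j) =
    (\<Sum>s\<in>UNIV. null_vec c s i (inv_chart c y) * null_vec c (neg s) j (inv_chart c y)) / 2"
proof -
  let ?x = "inv_chart c y"
  note x = S_dom(2)[OF assms]
  define N where "N i j = complex_of_real (matrix_inv (g c ?x) $ i $ j)" for i j
  define h where "h s i = null_vec c s i ?x" for s i
  define B where "B i j = (\<Sum>s\<in>UNIV. h s i * h (neg s) j) / 2" for i j
  have nf: "null_frame (cmetric c ?x) h" using null_frame_null_vec[OF c x] by (simp add: h_def[abs_def])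
  have NM: "(\<Sum>k\<in>UNIV. N i k * cmetric c ?x k l) = (if i = l then 1 else 0)" for i l
    using metric_inverse(2)[OF c x, of i l] unfolding N_def by (metis (mono_tags, lifting) of_real_0 of_real_1 of_real_mult of_real_sum sum.cong)
  have MB: "(\<Sum>l\<in>UNIV. cmetric c ?x k l * B l j) = (if k = j then 1 else 0)" for k j
  proof -
    have "(\<Sum>l\<in>UNIV. cmetric c ?x k l * B l j) = (\<Sum>s\<in>UNIV. h s j * coframe (cmetric c ?x) h s k)"
      by (simp add: B_def sum_2 sum_sign coframe_def field_simps)
    then show ?thesis using frame_coframe[OF nf, of j k] by auto
  qed
  have "N i j = (\<Sum>k\<in>UNIV. N i k * (if k = j then 1 else 0))"
    using exhaust_2[of j] by (auto simp: sum_2)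
  also have "\<dots> = (\<Sum>l\<in>UNIV. (\<Sum>k\<in>UNIV. N i k * cmetric c ?x k l) * B l j)"
    unfolding MB[symmetric] sum_2 by (simp add: algebra_simps)
  also have "\<dots> = B i j"
    unfolding NM using exhaust_2[of i] by (auto simp: sum_2)
  finally show ?thesis by (simp add: N_def B_def h_def)
qed

text \<open>In the null frame the trace is the mean of the second covariant derivatives on the words
  + - and - +. They agree because the commutator vanishes at charge zero.\<close>

lemma laplace_lap:
  assumes u: "smooth_on S (local_rep c u)" and y: "y \<in> S"
  shows "laplace_beltrami g c u (inv_chart c y) = lap c U (local_rep c u) y"
proof -
  let ?v = "local_rep c u" and ?h = "\<lambda>s a. local_rep c (null_vec c s a) y"
  have h: "null_vec c s a (inv_chart c y) = ?h s a" for s a by (simp add: local_rep_def)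
  have "laplace_beltrami g c u (inv_chart c y) =
      (\<Sum>i\<in>UNIV. \<Sum>j\<in>UNIV. (\<Sum>s\<in>UNIV. ?h s i * ?h (neg s) j) / 2 * cg.nabla_comp 2 ?v y [i, j])"
    unfolding laplace_beltrami_def inverse_metric_frame[OF y] nabla_pow_chart[OF y] h ..
  also have "\<dots> = (pair (cg.nabla_comp 2 ?v y) (map ?h [Plus, Minus]) + pair (cg.nabla_comp 2 ?v y) (map ?h [Minus, Plus])) / 2"
    by (simp add: sum_2 sum_sign field_simps del: cg.nabla_comp.simps)
  also have "\<dots> = (cg.Dw [Plus, Minus] ?v y + cg.Dw [Minus, Plus] ?v y) / 2"
    using cg.pair_nabla_comp[OF u y, of "[Plus, Minus]"] cg.pair_nabla_comp[OF u y, of "[Minus, Plus]"]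
    by (simp add: numeral_2_eq_2 del: cg.nabla_comp.simps pair.simps)
  also have "cg.Dw [Minus, Plus] ?v y = cg.Dw [Plus, Minus] ?v y"
    using cg.Dn_commutator[OF y u, of 0] by simp
  also have "cg.Dw [Plus, Minus] ?v y = lap c U ?v y"
    using y by (simp add: lap_def cg.Lap_def flip: S_def)
  finally show ?thesis by simp
qed

lemma smooth_lap: "smooth_on S v \<Longrightarrow> smooth_on S (lap c U v)"
  using cg.smooth_Lap by (simp add: lap_def S_def)

lemma lap_linear:
  "smooth_on S u \<Longrightarrow> smooth_on S v \<Longrightarrow> lap c U (\<lambda>y. a * u y + b * v y) = (\<lambda>y. a * lap c U u y + b * lap c U v y)"
  using cg.Lap_linear by (simp add: lap_def S_def)

lemma lap_outside: "y \<notin> S \<Longrightarrow> lap c U v y = 0"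
  using cg.Lap_def by (simp add: lap_def S_def)

lemma lap_cong: "(\<And>y. y \<in> S \<Longrightarrow> u y = v y) \<Longrightarrow> lap c U u = lap c U v"
  using cg.Dw_cong[of u v _ "[Plus, Minus]"] by (simp add: lap_def fun_eq_iff cg.Lap_def flip: S_def)

text \<open>The coefficients of the section at \<open>p\<close> are its frame components there. At a
  point of \<open>S\<close> the contraction is expanded in the local null frame: charged words drop
  out, neutral components agree with those at \<open>p\<close> after symmetrisation, and the
  operators are insensitive to symmetrisation.\<close>

lemma parallel_action:
  assumes conn: "connected (UNIV :: 'm set)" and X: "parallel_section A g k X"
    and c0: "c0 \<in> A" "p \<in> fst c0" "gip g c0 p e1 e1 = 1" "gip g c0 p e2 e2 = 1" "gip g c0 p e1 e2 = 0"
    and \<xi>: "\<And>I. length I = k \<Longrightarrow> X c0 p I = (\<Sum>w | length w = k. \<xi> w * word_tensor e1 e2 w I)"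
  shows "length w = k \<Longrightarrow> charge w \<noteq> 0 \<Longrightarrow> \<xi> w = 0"
    and "acts_to A g U k X u u' \<Longrightarrow> smooth_on S (local_rep c u) \<Longrightarrow> y \<in> S \<Longrightarrow>
      local_rep c u' y = (\<Sum>w | length w = k. \<xi> w * cop (lap c U) (of_real K) w (local_rep c u) y)"
proof -
  let ?e = "coframe (cmetric c0 p) (hvec e1 e2)"
  have sym: "gip g c0 p e2 e1 = 0" using gip_sym[OF c0(1,2)] c0(5) by metis
  have cg: "(\<Sum>i\<in>UNIV. \<Sum>j\<in>UNIV. cmetric c0 p i j * of_real (v $ i) * of_real (w $ j)) = of_real (gip g c0 p v w)" for v w
    by (simp add: gip_def)
  have "(\<Sum>i\<in>UNIV. \<Sum>j\<in>UNIV. cmetric c0 p i j * hvec e1 e2 s i * hvec e1 e2 t j) =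
     of_real (gip g c0 p e1 e1) - of_int (sval t) * \<i> * of_real (gip g c0 p e1 e2) - of_int (sval s) * \<i> * of_real (gip g c0 p e2 e1)
      + of_int (sval s) * of_int (sval t) * (\<i> * \<i>) * of_real (gip g c0 p e2 e2)" for s t
    unfolding cg[symmetric] hvec_def sum_2 by (simp add: algebra_simps)
  then have "(\<Sum>i\<in>UNIV. \<Sum>j\<in>UNIV. cmetric c0 p i j * hvec e1 e2 s i * hvec e1 e2 t j) = hpair s t" for s t
    by (cases s; cases t) (simp_all add: c0 sym hpair_def)
  then have nf: "null_frame (cmetric c0 p) (hvec e1 e2)"
    using metric_sym[OF c0(1,2)] unfolding null_frame_def by metis
  have comp\<xi>: "frame_comp X c0 p (hvec e1 e2) w = \<xi> w" if "length w = k" for w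
  proof -
    have "frame_comp X c0 p (hvec e1 e2) w = pair (\<lambda>I. \<Sum>w | length w = k. \<xi> w * word_tensor e1 e2 w I) (map ?e w)"
      unfolding frame_comp_def by (rule pair_cong) (use that \<xi> in simp)
    also have "\<dots> = (\<Sum>v | length v = k. \<xi> v * (if w = v then 1 else 0))"
      unfolding pair_sum pair_scale
      by (intro sum.cong refl arg_cong2[where f = "(*)"] pair_word_tensor coframe_frame[OF nf]) (use that in auto)
    also have "\<dots> = \<xi> w"
    proof -
      have "finite {v :: sign list. length v = k}" by (rule finite_lists_length)
      then show ?thesis using that by (simp add: if_distrib[of "(*) _"] cong: if_cong)
    qed
    finally show ?thesis .
  qed
  show z: "length w = k \<Longrightarrow> charge w \<noteq> 0 \<Longrightarrow> \<xi> w = 0" for w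
    using charged_comp_zero[OF X c0(1,2) nf] comp\<xi> by metis
  assume act: "acts_to A g U k X u u'" and u: "smooth_on S (local_rep c u)" and y: "y \<in> S"
  let ?x = "inv_chart c y" and ?v = "local_rep c u"
  note x = S_dom[OF y]
  define h where "h s i = null_vec c s i ?x" for s i
  have nfx: "null_frame (cmetric c ?x) h" using null_frame_null_vec[OF c x(2)] by (simp add: h_def[abs_def])
  define \<zeta> where "\<zeta> w = frame_comp X c ?x h w" for w
  define C where "C w = cop (lap c U) (of_real K) w ?v y" for w
  have "local_rep c u' y = (\<Sum>I | length I = k. cg.nabla_comp k ?v y I * X c ?x I)"
    using act c x unfolding acts_to_def nabla_pow_chart[OF y, symmetric] by (simp add: local_rep_def[of c u'])
  also have "\<dots> = (\<Sum>w | length w = k. pair (cg.nabla_comp k ?v y) (map h w) * pair (X c ?x) (map (coframe (cmetric c ?x) h) w))"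
    by (rule contraction_frame) (rule frame_coframe[OF nfx])
  also have "\<dots> = (\<Sum>w | length w = k. C w * \<zeta> w)"
  proof (rule sum.cong[OF refl])
    fix w :: "sign list" assume "w \<in> {w. length w = k}"
    then have w: "length w = k" by simp
    show "pair (cg.nabla_comp k ?v y) (map h w) * pair (X c ?x) (map (coframe (cmetric c ?x) h) w) = C w * \<zeta> w"
    proof (cases "charge w = 0")
      case True
      have "pair (cg.nabla_comp k ?v y) (map h w) = C w"
        using cg.pair_nabla_comp[OF u y, of w] cg.Dw_neutral[OF y u True] w
        by (simp add: h_def[abs_def] local_rep_def C_def lap_def S_def)
      then show ?thesis by (simp add: \<zeta>_def frame_comp_def)
    next
      case False
      then show ?thesis
        using charged_comp_zero[OF X c x(2) nfx w] by (simp add: \<zeta>_def frame_comp_def)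
    qed
  qed
  finally have 1: "local_rep c u' y = (\<Sum>w | length w = k. C w * \<zeta> w)" .
  \<comment> \<open>Replaces the coefficients by their averages over \<open>map neg\<close>, the
    quantities that \<open>neutral_comp_constant\<close> compares between distant points.\<close>
  have sw: "(\<Sum>w | length w = k. C w * \<phi> w) = (\<Sum>w | length w = k. C w * (\<phi> w + \<phi> (map neg w))) / 2" for \<phi>
  proof -
    have "(\<Sum>w | length w = k. C w * \<phi> w) = (\<Sum>w | length w = k. C (map neg w) * \<phi> (map neg w))"
      by (rule sum.reindex_bij_witness[of _ "map neg" "map neg"]) (auto simp: o_def)
    then have "(\<Sum>w | length w = k. C w * (\<phi> w + \<phi> (map neg w))) = 2 * (\<Sum>w | length w = k. C w * \<phi> w)"
      by (simp add: C_def cop_map_neg distrib_left sum.distrib)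
    then show ?thesis by simp
  qed
  have "\<zeta> w + \<zeta> (map neg w) = \<xi> w + \<xi> (map neg w)" if w: "length w = k" for w
  proof (cases "charge w = 0")
    case True
    then show ?thesis
      using neutral_comp_constant[OF conn X w True c x(2) nfx c0(1,2) nf] w by (simp add: \<zeta>_def comp\<xi>)
  next
    case False
    then show ?thesis
      using charged_comp_zero[OF X c x(2) nfx] z w by (simp add: \<zeta>_def)
  qed
  then have "(\<Sum>w | length w = k. C w * (\<zeta> w + \<zeta> (map neg w))) = (\<Sum>w | length w = k. C w * (\<xi> w + \<xi> (map neg w)))"
    by simp
  then have "(\<Sum>w | length w = k. C w * \<zeta> w) = (\<Sum>w | length w = k. C w * \<xi> w)"
    by (subst sw[of \<zeta>], subst sw[of \<xi>]) simp
  then show "local_rep c u' y = (\<Sum>w | length w = k. \<xi> w * cop (lap c U) (of_real K) w (local_rep c u) y)"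
    unfolding 1 by (simp add: C_def mult.commute)
qed

end

end

section \<open>Modes\<close>

definition lin :: "(('k \<Rightarrow>\<^sub>0 complex) \<Rightarrow> ('k \<Rightarrow>\<^sub>0 complex)) \<Rightarrow> bool" where
  "lin T \<longleftrightarrow> (\<forall>x y. T (x + y) = T x + T y) \<and> (\<forall>z x. T (scl z x) = scl z (T x))"

lemma lin_add: "lin T \<Longrightarrow> T (x + y) = T x + T y"
  and lin_scl: "lin T \<Longrightarrow> T (scl z x) = scl z (T x)"
  by (simp_all add: lin_def)

lemma lin_zero: "lin T \<Longrightarrow> T 0 = 0"
  using lin_scl[of T 0 0] by (simp add: fock.scale_zero_left)

lemma lin_diff: "lin T \<Longrightarrow> T (x - y) = T x - T y"
  using lin_add[of T "x - y" y] by simp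

lemma lin_sum: "lin T \<Longrightarrow> T (\<Sum>a\<in>A. u a) = (\<Sum>a\<in>A. T (u a))"
  by (induction A rule: infinite_finite_induct) (simp_all add: lin_zero lin_add)

lemma lin_span:
  assumes "lin T" "fock.subspace M" "\<And>b. b \<in> B \<Longrightarrow> T b \<in> M" "y \<in> fock.span B"
  shows "T y \<in> M"
  using assms(4)
  by (induction rule: fock.span_induct_alt)
    (auto simp: lin_zero lin_add lin_scl assms fock.subspace_0 fock.subspace_add fock.subspace_scale)

lemma linear_extension_superset:
  assumes "finite A" "Poly_Mapping.keys v \<subseteq> A"
  shows "linear_extension T v = (\<Sum>k\<in>A. scl (Poly_Mapping.lookup v k) (T k))"
  unfolding linear_extension_def
  by (rule sum.mono_neutral_left[OF assms]) (simp add: in_keys_iff fock.scale_zero_left)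

lemma lin_linear_extension: "lin (linear_extension T)"
proof -
  have "linear_extension T (x + y) = linear_extension T x + linear_extension T y" for x y
  proof -
    let ?A = "Poly_Mapping.keys x \<union> Poly_Mapping.keys y"
    have f: "finite ?A" by simp
    show ?thesis
      using linear_extension_superset[OF f Poly_Mapping.keys_add, of T] linear_extension_superset[OF f, of x T]
        linear_extension_superset[OF f, of y T]
      by (simp add: lookup_add fock.scale_left_distrib sum.distrib)
  qed
  moreover have "linear_extension T (scl z x) = scl z (linear_extension T x)" for z x
  proof -
    have "Poly_Mapping.keys (scl z x) \<subseteq> Poly_Mapping.keys x" by (auto simp: in_keys_iff)
    then show ?thesis
      using linear_extension_superset[of "Poly_Mapping.keys x" "scl z x" T]
      by (simp add: linear_extension_def[of T x] fock.scale_sum_right)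
  qed
  ultimately show ?thesis by (simp add: lin_def)
qed

lemma linear_extension_single [simp]: "linear_extension T (Poly_Mapping.single k 1) = T k"
  by (simp add: linear_extension_def)

lemma fock_expand: "y = (\<Sum>k\<in>Poly_Mapping.keys y. scl (Poly_Mapping.lookup y k) (Poly_Mapping.single k 1))"
proof (rule poly_mapping_eqI)
  fix k
  have "Poly_Mapping.lookup (\<Sum>k\<in>A. scl (Poly_Mapping.lookup y k) (Poly_Mapping.single k 1)) k' =
     (\<Sum>k\<in>A. Poly_Mapping.lookup y k * (if k = k' then 1 else 0))" for A k'
    by (simp add: lookup_sum lookup_single when_def)
  then show "Poly_Mapping.lookup y k =
    Poly_Mapping.lookup (\<Sum>k\<in>Poly_Mapping.keys y. scl (Poly_Mapping.lookup y k) (Poly_Mapping.single k 1)) k"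
    by (simp add: if_distrib[of "(*) _"] in_keys_iff cong: if_cong)
qed

lemma lin_h_mode: "lin (h_mode l s n)"
  by (simp add: h_mode_def create_def[abs_def] zero_mode_def[abs_def] annihilate_def[abs_def] lin_linear_extension
    cong: if_cong) 

lemma lin_create: "lin (create s m)"
  by (simp add: create_def[abs_def] lin_linear_extension)

lemma create_ftriple [simp]: "create s m (ftriple a b u) = ftriple ((s, m) # a) b u"
  and zero_mode_ftriple [simp]: "zero_mode s (ftriple a b u) = ftriple a (s # b) u"
  and annihilate_ftriple [simp]: "annihilate l s m (ftriple a b u) = annihilate_word l s m a b u"
  by (simp_all add: create_def zero_mode_def annihilate_def)

definition remove_nth :: "nat \<Rightarrow> 'a list \<Rightarrow> 'a list" where
  "remove_nth i a = take i a @ drop (Suc i) a"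

lemma remove_nth_simps [simp]: "remove_nth 0 (y # a) = a" "remove_nth (Suc i) (y # a) = y # remove_nth i a"
  by (simp_all add: remove_nth_def)

lemma set_remove_nth: "set (remove_nth i a) \<subseteq> set a"
  unfolding remove_nth_def using set_take_subset[of i a] set_drop_subset[of "Suc i" a] by auto

lemma mset_remove_nth: "i < length a \<Longrightarrow> add_mset (a ! i) (mset (remove_nth i a)) = mset a"
proof (induction a arbitrary: i)
  case (Cons y a)
  then show ?case by (cases i) (simp_all add: add_mset_commute)
qed simp

text \<open>By the commutation rule a positive mode is contracted with each occurrence of the
  opposite letter of level \<open>m\<close> in turn. Deleting a letter is compatible with forgetting
  the order of the word, which is why the modes descend to commuting polynomials.\<close>

lemma annihilate_word_eq:
  "annihilate_word l s m a b u =
    (\<Sum>i | i < length a \<and> a ! i = (neg s, m). scl (of_nat m * 2 * l) (ftriple (remove_nth i a) b u))"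
proof (induction a)
  case Nil
  then show ?case by simp
next
  case (Cons y a)
  have fin: "finite {i. i < length a \<and> a ! i = (neg s, m)}" by simp
  have set: "{i. i < length (y # a) \<and> (y # a) ! i = (neg s, m)} =
    (if y = (neg s, m) then {0} else {}) \<union> Suc ` {i. i < length a \<and> a ! i = (neg s, m)}"
  proof (rule set_eqI)
    show "i \<in> {i. i < length (y # a) \<and> (y # a) ! i = (neg s, m)} \<longleftrightarrow>
      i \<in> (if y = (neg s, m) then {0} else {}) \<union> Suc ` {i. i < length a \<and> a ! i = (neg s, m)}" for i
      by (cases i) (auto simp: image_iff)
  qed
  have h: "(if snd y = m then scl (of_nat m * hpair s (fst y) * l) (ftriple a b u) else 0) =
    (if y = (neg s, m) then scl (of_nat m * 2 * l) (ftriple a b u) else 0)"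
    by (cases y; cases s; cases "fst y") (auto simp: hpair_def)
  have "annihilate_word l s m (y # a) b u =
    (\<Sum>i | i < length a \<and> a ! i = (neg s, m). scl (of_nat m * 2 * l) (ftriple (y # remove_nth i a) b u)) +
    (if y = (neg s, m) then scl (of_nat m * 2 * l) (ftriple a b u) else 0)"
    unfolding annihilate_word.simps Cons h
    by (simp add: lin_sum[OF lin_create] lin_scl[OF lin_create])
  also have "\<dots> = (\<Sum>i | i < length (y # a) \<and> (y # a) ! i = (neg s, m).
      scl (of_nat m * 2 * l) (ftriple (remove_nth i (y # a)) b u))"
    unfolding set using fin by (subst sum.union_disjoint) (auto simp: sum.reindex add.commute)
  finally show ?case .
qed

lemma valid_nword_Nil [simp]: "valid_nword []"
  and valid_nword_Cons [simp]: "valid_nword ((s, m) # a) \<longleftrightarrow> m \<ge> 1 \<and> valid_nword a"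
  by (auto simp: valid_nword_def)

lemma charge_remove_nth:
  "i < length a \<Longrightarrow> charge (map fst (remove_nth i a)) = charge (map fst a) - sval (fst (a ! i))"
proof (induction a arbitrary: i)
  case (Cons y a)
  then show ?case by (cases i) auto
qed simp

text \<open>A common form for all three kinds of modes. The index set, the new words and the prefix
  do not depend on \<open>b\<close> and \<open>u\<close>: modes act from the left and therefore pass
  through the tensor relations, which live at the right end of a triple.\<close>

lemma h_mode_ftriple:
  assumes "valid_nword a"
  obtains I :: "nat set" and c a' pre where "finite I"
    "\<And>i. i \<in> I \<Longrightarrow> valid_nword (a' i)"
    "\<And>i. i \<in> I \<Longrightarrow> charge (map fst (a' i)) + charge pre = charge (map fst a) + sval s"
    "\<And>b u. h_mode l s n (ftriple a b u) = (\<Sum>i\<in>I. scl c (ftriple (a' i) (pre @ b) u))"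
proof -
  consider "n < 0" | "n = 0" | "n > 0" by linarith
  then show thesis
  proof cases
    case 1
    then show thesis using assms
      by (intro that[of "{0}" "\<lambda>_. (s, nat (- n)) # a" "[]" 1]) (auto simp: h_mode_def)
  next
    case 2
    then show thesis using assms
      by (intro that[of "{0}" "\<lambda>_. a" "[s]" 1]) (auto simp: h_mode_def)
  next
    case 3
    show thesis
    proof (rule that[of "{i. i < length a \<and> a ! i = (neg s, nat n)}" "\<lambda>i. remove_nth i a" "[]"])
      show "valid_nword (remove_nth i a)" for i
        using assms set_remove_nth[of i a] unfolding valid_nword_def by blast
    qed (use 3 in \<open>auto simp: h_mode_def annihilate_word_eq charge_remove_nth\<close>)
  qed
qed

lemma normal_ordered_stable:
  assumes st: "\<And>s k n y. y \<in> N n \<Longrightarrow> h_mode l s k y \<in> N (n + sval s)" and y: "y \<in> N n"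
  shows "normal_ordered l xs y \<in> N (n + charge (map fst xs))"
proof -
  have 1: "foldr (\<lambda>(s, n). h_mode l s n) xs y \<in> N (n + charge (map fst xs))" for xs
  proof (induction xs)
    case Nil
    then show ?case using y by simp
  next
    case (Cons x xs)
    then show ?case using st[OF Cons, of "fst x" "snd x"] by (simp add: case_prod_beta algebra_simps)
  qed
  have 2: "charge (map fst (filter (\<lambda>(s, n). n < 0) xs)) + charge (map fst (filter (\<lambda>(s, n). n > 0) xs))
     + charge (map fst (filter (\<lambda>(s, n). n = 0) xs)) = charge (map fst xs)" for xs :: "(sign \<times> int) list"
    by (induction xs) auto
  show ?thesis
    unfolding normal_ordered_def using 1[of "filter (\<lambda>(s, n). n < 0) xs @ filter (\<lambda>(s, n). n > 0) xs @ filter (\<lambda>(s, n). n = 0) xs"]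
    using 2[of xs] by (simp add: algebra_simps)
qed

text \<open>A single mode shifts the charge, hence the family of subspaces; normal ordering only
  permutes the modes, and a neutral word returns to the member where it started.\<close>

lemma vertex_mode_stable:
  assumes sub: "\<And>n. fock.subspace (N n)"
    and st: "\<And>s k n y. y \<in> N n \<Longrightarrow> h_mode l s k y \<in> N (n + sval s)" and y: "y \<in> N n" and v: "v \<in> V_words"
  shows "vertex_mode l v m y \<in> N n"
proof -
  have "scl z (normal_ordered l (zip (map fst v) ns) y) \<in> N n" if "length ns = length v" for z and ns :: "int list"
    using normal_ordered_stable[of N l y n "zip (map fst v) ns", OF st y] v that sub
    by (auto simp: V_words_def intro: fock.subspace_scale)
  then show ?thesis
    unfolding vertex_mode_def Sum_any.expand_set
    by (intro fock.subspace_sum[OF sub]) (auto intro: fock.subspace_0[OF sub])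
qed

lemma graded_submoduleI:
  assumes "\<And>n. fock.subspace (N n)" "\<And>s k n y. y \<in> N n \<Longrightarrow> h_mode l s k y \<in> N (n + sval s)"
    "N 0 \<subseteq> fock.span {y \<in> N 0. homogeneous y}"
  shows "graded_submodule l (N 0)"
  unfolding graded_submodule_def using assms vertex_mode_stable[of N l, OF assms(1,2)] by blast

text \<open>Newton interpolation at \<open>-1, 0, \<dots>, n-1\<close>: the coefficients occurring in the modes of basis words
  of \<open>V\<close> suffice to separate the mode indices.\<close>

lemma binomial_interpolation: "\<exists>\<gamma>. \<forall>x<n. (\<Sum>m<n. \<gamma> m * of_nat (x choose m)) = (F x :: complex)"
proof (induction n)
  case (Suc n)
  then obtain \<gamma> where \<gamma>: "\<forall>x<n. (\<Sum>m<n. \<gamma> m * of_nat (x choose m)) = F x" by blast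
  define \<gamma>' where "\<gamma>' m = (if m < n then \<gamma> m else F n - (\<Sum>m<n. \<gamma> m * of_nat (n choose m)))" for m
  have "(\<Sum>m<Suc n. \<gamma>' m * of_nat (x choose m)) = F x" if "x < Suc n" for x
    using \<gamma> that by (cases "x = n") (auto simp: \<gamma>'_def less_Suc_eq)
  then show ?case by blast
qed simp

lemma gbinomial_interpolation:
  obtains \<gamma> where "\<And>t. t \<le> n \<Longrightarrow> (\<Sum>m\<le>n. \<gamma> m * ((of_int (int t - 1) :: complex) gchoose m)) = F t"
proof -
  obtain \<gamma> where \<gamma>: "\<And>x. x < n \<Longrightarrow> (\<Sum>m<n. \<gamma> m * of_nat (x choose m)) = F (Suc x)"
    using binomial_interpolation[of n "\<lambda>x. F (Suc x)"] by blast
  \<comment> \<open>The top coefficient serves the additional node -1: the binomial of degree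
    \<open>n\<close> vanishes at 0, ..., n - 1 but is 1 or -1 at -1, so adjusting it leaves the
    other nodes alone.\<close>
  define \<gamma>' where "\<gamma>' m = (if m < n then \<gamma> m else (F 0 - (\<Sum>m<n. \<gamma> m * ((- 1) gchoose m))) / ((- 1) gchoose n))" for m
  have nz: "((- 1 :: complex) gchoose n) \<noteq> 0"
    by (simp add: gbinomial_pochhammer pochhammer_fact[symmetric])
  have "(\<Sum>m\<le>n. \<gamma>' m * ((of_int (int t - 1) :: complex) gchoose m)) = F t" if t: "t \<le> n" for t
  proof (cases t)
    case 0
    then show ?thesis using nz by (simp add: \<gamma>'_def lessThan_Suc_atMost[symmetric])
  next
    case (Suc x)
    have g: "((of_int (int t - 1) :: complex) gchoose m) = of_nat (x choose m)" for m
      by (simp add: Suc binomial_gbinomial)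
    show ?thesis
      unfolding g lessThan_Suc_atMost[symmetric] using \<gamma>[of x] t Suc by (simp add: \<gamma>'_def)
  qed
  then show thesis by (rule that)
qed

text \<open>Weights on tuples of modes with one factor per position. The modes of basis words come
  with binomial factors, whereas delta factors isolate a single tuple.\<close>

primrec wprod :: "(nat \<Rightarrow> complex) list \<Rightarrow> nat list \<Rightarrow> complex" where
  "wprod [] ts = 1"
| "wprod (\<phi> # \<phi>s) ts = (case ts of [] \<Rightarrow> 1 | t # ts' \<Rightarrow> \<phi> t * wprod \<phi>s ts')"

lemma wprod_eq: "length \<phi>s = length ts \<Longrightarrow> wprod \<phi>s ts = (\<Prod>j<length ts. (\<phi>s ! j) (ts ! j))"
  by (induction \<phi>s ts rule: list_induct2) (simp_all add: prod.lessThan_Suc_shift del: prod.lessThan_Suc)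

lemma wprod_append:
  "length \<phi>s = length ts \<Longrightarrow> wprod (\<phi>s @ \<psi>s) (ts @ us) = wprod \<phi>s ts * wprod \<psi>s us"
  by (induction \<phi>s ts rule: list_induct2) simp_all

lemma wprod_coordinate:
  assumes "length ts = length \<phi>s + Suc (length \<psi>s)"
    and "\<phi> (ts ! length \<phi>s) = (\<Sum>m\<in>M. c m * \<beta> m (ts ! length \<phi>s))"
  shows "wprod (\<phi>s @ \<phi> # \<psi>s) ts = (\<Sum>m\<in>M. c m * wprod (\<phi>s @ \<beta> m # \<psi>s) ts)"
proof -
  define n where "n = length \<phi>s"
  have ts: "ts = take n ts @ ts ! n # drop (Suc n) ts"
    using assms(1) by (simp add: n_def id_take_nth_drop)
  have len: "length \<phi>s = length (take n ts)" using assms(1) by (simp add: n_def)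
  have w: "wprod (\<phi>s @ \<phi> # \<psi>s) ts = wprod \<phi>s (take n ts) * (\<phi> (ts ! n) * wprod \<psi>s (drop (Suc n) ts))" for \<phi>
    by (subst ts) (simp add: wprod_append[OF len] del: append_take_drop_id)
  show ?thesis
    unfolding w using assms(2) by (simp add: n_def sum_distrib_left sum_distrib_right mult_ac)
qed

lemma wprod_delta:
  "length ts = length us \<Longrightarrow> wprod (map (\<lambda>t u. if u = t then 1 else 0) ts) us = (if us = ts then 1 else 0)"
  by (induction ts us rule: list_induct2) auto

lemma finite_compositions: "finite {ts. length ts = n \<and> sum_list ts = (t::nat)}"
proof -
  have "{ts. length ts = n \<and> sum_list ts = t} \<subseteq> {ts. set ts \<subseteq> {..t} \<and> length ts = n}"
    using member_le_sum_list by auto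
  then show ?thesis using finite_lists_length_eq[of "{..t}" n] finite_subset by blast
qed

text \<open>What normal ordering makes of the modes of indices \<open>- ts\<close> on
  \<open>f\<close>: the negative ones in front, the zero modes next to the function.\<close>

definition mono_vec :: "sign list \<Rightarrow> nat list \<Rightarrow> ('m \<Rightarrow> complex) \<Rightarrow> 'm fock" where
  "mono_vec \<sigma> ts f = ftriple (filter (\<lambda>(s, t). t > 0) (zip \<sigma> ts)) (map fst (filter (\<lambda>(s, t). t = 0) (zip \<sigma> ts))) f"

lemma normal_ordered_ftriple:
  assumes "length \<sigma> = length ts"
  shows "normal_ordered l (zip \<sigma> (map (\<lambda>t. - int t) ts)) (ftriple [] [] f) = mono_vec \<sigma> ts f"
proof -
  have z: "foldr (\<lambda>(s, n). h_mode l s n) xs (ftriple [] b f) = ftriple [] (map fst xs @ b) f"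
    if "\<forall>x\<in>set xs. snd x = 0" for xs :: "(sign \<times> int) list" and b
    using that by (induction xs) (auto simp: h_mode_def)
  have n: "foldr (\<lambda>(s, n). h_mode l s n) xs (ftriple a b f) = ftriple (map (\<lambda>(s, n). (s, nat (- n))) xs @ a) b f"
    if "\<forall>x\<in>set xs. snd x < 0" for xs :: "(sign \<times> int) list" and a b
    using that by (induction xs) (auto simp: h_mode_def)
  let ?xs = "zip \<sigma> (map (\<lambda>t. - int t) ts)"
  have p: "filter (\<lambda>(s, n). n > 0) ?xs = []"
    using assms by (induction \<sigma> ts rule: list_induct2) auto
  have "normal_ordered l ?xs (ftriple [] [] f) =
    ftriple (map (\<lambda>(s, n). (s, nat (- n))) (filter (\<lambda>(s, n). n < 0) ?xs)) (map fst (filter (\<lambda>(s, n). n = 0) ?xs)) f"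
  proof -
    have "foldr (\<lambda>(s, n). h_mode l s n) (filter (\<lambda>(s, n). n = 0) ?xs) (ftriple [] [] f) =
        ftriple [] (map fst (filter (\<lambda>(s, n). n = 0) ?xs) @ []) f"
      by (rule z) auto
    moreover have "foldr (\<lambda>(s, n). h_mode l s n) (filter (\<lambda>(s, n). n < 0) ?xs) (ftriple [] b f) =
        ftriple (map (\<lambda>(s, n). (s, nat (- n))) (filter (\<lambda>(s, n). n < 0) ?xs) @ []) b f" for b
      by (rule n) auto
    ultimately show ?thesis
      unfolding normal_ordered_def p append_Nil foldr_append o_apply by (simp only: append_Nil2)
  qed
  also have "map (\<lambda>(s, n). (s, nat (- n))) (filter (\<lambda>(s, n). n < 0) ?xs) = filter (\<lambda>(s, t). t > 0) (zip \<sigma> ts)"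
    using assms by (induction \<sigma> ts rule: list_induct2) auto
  also have "map fst (filter (\<lambda>(s, n). n = 0) ?xs) = map fst (filter (\<lambda>(s, t). t = 0) (zip \<sigma> ts))"
    using assms by (induction \<sigma> ts rule: list_induct2) auto
  finally show ?thesis by (simp add: mono_vec_def)
qed

lemma normal_ordered_positive:
  assumes "n \<in> set (map snd xs)" "n > 0"
  shows "normal_ordered l xs (ftriple [] [] f) = (0 :: 'm fock)"
proof -
  have z: "\<exists>b. foldr (\<lambda>(s, n). h_mode l s n) (filter (\<lambda>(s, n). n = 0) xs) (ftriple [] [] f) = ftriple [] b f" 
    for xs :: "(sign \<times> int) list"
    by (induction xs) (auto simp: h_mode_def)
  have 0: "foldr (\<lambda>(s, n). h_mode l s n) xs 0 = (0 :: 'm fock)" for xs :: "(sign \<times> int) list"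
    by (induction xs) (auto simp: lin_zero[OF lin_h_mode])
  have p: "foldr (\<lambda>(s, n). h_mode l s n) xs (ftriple [] b f) = (0 :: 'm fock)"
    if "xs \<noteq> []" "\<forall>x\<in>set xs. snd x > 0" for xs :: "(sign \<times> int) list" and b
    using that
    by (induction xs rule: rev_induct) (auto simp: h_mode_def 0)
  have "filter (\<lambda>(s, n). n > 0) xs \<noteq> []" using assms by (auto simp: filter_empty_conv)
  then show ?thesis
    using z[of xs] unfolding normal_ordered_def by (auto simp: p 0)
qed

text \<open>The mode index is chosen so that the total level is \<open>t\<close>. Positive modes
  annihilate \<open>f\<close>, so only tuples of nonpositive modes survive, and those correspond to
  the finitely many compositions of \<open>t\<close>.\<close>

lemma vertex_mode_ftriple:
  assumes "length \<sigma> = length ms"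
  shows "vertex_mode l (zip \<sigma> ms) (int (sum_list ms) - int t - 1) (ftriple [] [] f) =
    (\<Sum>ts | length ts = length ms \<and> sum_list ts = t.
       scl (wprod (map (\<lambda>m t. of_int (int t - 1) gchoose (m - 1)) ms) ts) (mono_vec \<sigma> ts f))"
proof -
  let ?v = "zip \<sigma> ms"
  define Tup where "Tup = {ts. length ts = length ms \<and> sum_list ts = t}"
  define g where "g ns = (if length ns = length ?v \<and> sum_list ns + int (sum_list (map snd ?v)) = int (sum_list ms) - int t - 1 + 1
     then scl (\<Prod>j<length ?v. of_int (- (ns ! j) - 1) gchoose (snd (?v ! j) - 1))
              (normal_ordered l (zip (map fst ?v) ns) (ftriple [] [] f))
     else 0)" for ns :: "int list"
  let ?i = "map (\<lambda>t. - int t)"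
  have sub: "{ns. g ns \<noteq> 0} \<subseteq> ?i ` Tup"
  proof
    fix ns assume "ns \<in> {ns. g ns \<noteq> 0}"
    then have nz: "g ns \<noteq> 0" by simp
    then have ns: "length ns = length ms" "sum_list ns = - int t"
      using assms by (auto simp: g_def split: if_splits)
    have "\<not> n > 0" if "n \<in> set ns" for n
      using nz normal_ordered_positive[of n "zip (map fst ?v) ns" l f] that assms ns
      by (auto simp: g_def fock.scale_zero_right split: if_splits)
    then have "map (\<lambda>n. - int (nat (- n))) ns = ns" by (intro map_idI) force
    then have "ns = ?i (map (\<lambda>n. nat (- n)) ns)" by (simp add: o_def)
    moreover have "map (\<lambda>n. nat (- n)) ns \<in> Tup"
    proof -
      have "int (sum_list (map (\<lambda>n. nat (- n)) ns)) = - sum_list ns"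
        using \<open>\<And>n. n \<in> set ns \<Longrightarrow> \<not> n > 0\<close> by (induction ns) (auto simp: not_less)
      then show ?thesis using ns by (simp add: Tup_def)
    qed
    ultimately show "ns \<in> ?i ` Tup" by blast
  qed
  have fin: "finite Tup" unfolding Tup_def by (rule finite_compositions)
  have inj: "inj_on ?i Tup" by (rule inj_on_subset[OF _ subset_UNIV]) (simp add: inj_def)
  have sneg: "sum_list (?i ts) = - int (sum_list ts)" for ts by (induction ts) auto
  have gi: "g (?i ts) = scl (wprod (map (\<lambda>m t. of_int (int t - 1) gchoose (m - 1)) ms) ts) (mono_vec \<sigma> ts f)"
    if "ts \<in> Tup" for ts
    using that assms unfolding g_def Tup_def
    by (simp add: sneg normal_ordered_ftriple wprod_eq)
  have "vertex_mode l ?v (int (sum_list ms) - int t - 1) (ftriple [] [] f) = Sum_any g"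
    unfolding vertex_mode_def g_def ..
  also have "\<dots> = sum g (?i ` Tup)"
    by (rule Sum_any.expand_superset) (use fin sub in auto)
  also have "\<dots> = (\<Sum>ts\<in>Tup. scl (wprod (map (\<lambda>m t. of_int (int t - 1) gchoose (m - 1)) ms) ts) (mono_vec \<sigma> ts f))"
    by (simp add: sum.reindex[OF inj] gi)
  finally show ?thesis by (simp add: Tup_def)
qed

text \<open>Binomial factors are exchanged for delta factors one position at a time, from the left;
  after the last exchange a single monomial is left.\<close>

lemma mono_vec_in_span:
  assumes "length \<sigma> = length ts" "charge \<sigma> = 0"
  shows "mono_vec \<sigma> ts f \<in> fock.span {vertex_mode l v N (ftriple [] [] f) | v N. v \<in> V_words}" (is "_ \<in> ?V")
proof -
  define n where "n = length \<sigma>"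
  define t where "t = sum_list ts"
  define \<beta> where "\<beta> m = (\<lambda>t. (of_int (int t - 1) :: complex) gchoose (m - 1))" for m
  define \<delta> :: "nat \<Rightarrow> nat \<Rightarrow> complex" where "\<delta> t = (\<lambda>u. if u = t then 1 else 0)" for t
  define W where "W \<phi>s = (\<Sum>us | length us = n \<and> sum_list us = t. scl (wprod \<phi>s us) (mono_vec \<sigma> us f))" for \<phi>s
  \<comment> \<open>The levels \<open>ms\<close> stay universally quantified, because an exchange
    calls the induction hypothesis with one more binomial factor, of every level
    \<open>Suc m\<close> up to degree \<open>t\<close>.\<close>
  have "\<forall>ms::nat list. length ss + length ms = n \<longrightarrow> (\<forall>m\<in>set ms. m \<ge> 1) \<longrightarrow> W (map \<delta> ss @ map \<beta> ms) \<in> ?V" for ss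
  proof (induction ss rule: rev_induct)
    case Nil
    have "W (map \<beta> ms) \<in> ?V" if "length ms = n" "\<forall>m\<in>set ms. m \<ge> 1" for ms :: "nat list"
    proof -
      have "W (map \<beta> ms) = vertex_mode l (zip \<sigma> ms) (int (sum_list ms) - int t - 1) (ftriple [] [] f)"
        using that vertex_mode_ftriple[of \<sigma> ms l t f] by (simp add: W_def n_def \<beta>_def[abs_def])
      moreover have "zip \<sigma> ms \<in> V_words"
        using that assms by (auto simp: V_words_def valid_nword_def n_def dest: set_zip_rightD)
      ultimately show ?thesis by (auto intro!: fock.span_base)
    qed
    then show ?case by simp
  next
    case (snoc s ss)
    show ?case
    proof (intro allI impI)
      fix ms :: "nat list" assume ms: "length (ss @ [s]) + length ms = n" "\<forall>m\<in>set ms. m \<ge> 1"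
      obtain \<gamma> where \<gamma>: "\<And>u. u \<le> t \<Longrightarrow> (\<Sum>m\<le>t. \<gamma> m * ((of_int (int u - 1) :: complex) gchoose m)) = \<delta> s u"
        by (rule gbinomial_interpolation[of t "\<delta> s"]) blast
      have "W (map \<delta> (ss @ [s]) @ map \<beta> ms) = (\<Sum>us | length us = n \<and> sum_list us = t.
          scl (\<Sum>m\<le>t. \<gamma> m * wprod (map \<delta> ss @ \<beta> (Suc m) # map \<beta> ms) us) (mono_vec \<sigma> us f))"
        unfolding W_def
      proof (intro sum.cong refl, goal_cases)
        case (1 us)
        then have us: "length us = n" "sum_list us = t" by auto
        \<comment> \<open>No entry of a tuple with sum \<open>t\<close> exceeds \<open>t\<close>, so
          interpolation at the nodes up to \<open>t\<close> is exact on all tuples that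
          occur.\<close>
        have "us ! length ss \<le> t"
          using us ms member_le_sum_list[of "us ! length ss" us] by auto
        then have "wprod (map \<delta> ss @ \<delta> s # map \<beta> ms) us = (\<Sum>m\<le>t. \<gamma> m * wprod (map \<delta> ss @ \<beta> (Suc m) # map \<beta> ms) us)"
          using us ms \<gamma>[of "us ! length ss"]
          by (intro wprod_coordinate[of us "map \<delta> ss" "map \<beta> ms" "\<delta> s" \<gamma> "\<lambda>m. \<beta> (Suc m)"]) (auto simp: \<beta>_def)
        then show ?case by simp
      qed
      also have "\<dots> = (\<Sum>m\<le>t. scl (\<gamma> m) (W (map \<delta> ss @ map \<beta> (Suc m # ms))))"
        unfolding W_def fock.scale_sum_left fock.scale_sum_right fock.scale_scale
        by (subst sum.swap) simp
      also have "\<dots> \<in> ?V"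
      proof (intro fock.span_sum fock.span_scale)
        show "W (map \<delta> ss @ map \<beta> (Suc m # ms)) \<in> ?V" for m
          using ms by (intro snoc.IH[rule_format]) auto
      qed
      finally show "W (map \<delta> (ss @ [s]) @ map \<beta> ms) \<in> ?V" .
    qed
  qed
  from this[of ts] have "W (map \<delta> ts) \<in> ?V" using assms by (simp add: n_def)
  also have "W (map \<delta> ts) = (\<Sum>us | length us = n \<and> sum_list us = t. if us = ts then mono_vec \<sigma> us f else 0)"
    unfolding W_def
  proof (intro sum.cong refl, goal_cases)
    case (1 us)
    then show ?case
      using wprod_delta[of ts us] assms by (auto simp: \<delta>_def[abs_def] n_def fock.scale_zero_left)
  qed
  also have "\<dots> = mono_vec \<sigma> ts f"
    using finite_compositions[of n t] assms by (simp add: sum.delta n_def t_def)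
  finally show ?thesis .
qed

lemma ftriple_in_span:
  assumes "valid_nword a" "charge (map fst a) + charge b = 0"
  shows "ftriple a b f \<in> fock.span {vertex_mode l v N (ftriple [] [] f) | v N. v \<in> V_words}"
proof -
  have "mono_vec (map fst a @ b) (map snd a @ replicate (length b) 0) f = ftriple a b f"
  proof -
    have "filter (\<lambda>(s, t). t > 0) a = a" "filter (\<lambda>(s, t). t = 0) a = []"
      using assms(1) by (auto simp: valid_nword_def filter_id_conv filter_empty_conv)
    moreover have "filter (\<lambda>(s, t). t > 0) (zip b (replicate (length b) (0::nat))) = []"
      "map fst (filter (\<lambda>(s, t). t = 0) (zip b (replicate (length b) (0::nat)))) = b"
      by (induction b) auto
    ultimately show ?thesis by (simp add: mono_vec_def zip_map_fst_snd)
  qed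
  then show ?thesis
    using mono_vec_in_span[of "map fst a @ b" "map snd a @ replicate (length b) 0" f l] assms(2) by simp
qed

section \<open>The kernels\<close>

lemma generated_submodule_least: "graded_submodule l N \<Longrightarrow> G \<subseteq> N \<Longrightarrow> generated_submodule l G \<subseteq> N"
  by (auto simp: generated_submodule_def)

lemma generated_submodule_superset: "G \<subseteq> generated_submodule l G"
  by (auto simp: generated_submodule_def)

lemma subspace_generated_submodule: "fock.subspace (generated_submodule l G)"
  unfolding generated_submodule_def
  by (rule fock.subspace_Inter) (auto simp: graded_submodule_def)

lemma subspace_kernel3: "fock.subspace (kernel3 R l K lam P f)"
  unfolding kernel3_def by (rule subspace_generated_submodule)

lemma kernel3_superset: "R \<union> gens1 K lam f \<union> gens2 f \<union> gens3 P f \<subseteq> kernel3 R l K lam P f"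
proof -
  have "R \<union> gens1 K lam f \<subseteq> kernel1 R l K lam f"
    unfolding kernel1_def by (rule generated_submodule_superset)
  moreover have "kernel1 R l K lam f \<union> gens2 f \<subseteq> kernel2 R l K lam f"
    unfolding kernel2_def by (rule generated_submodule_superset)
  moreover have "kernel2 R l K lam f \<union> gens3 P f \<subseteq> kernel3 R l K lam P f"
    unfolding kernel3_def by (rule generated_submodule_superset)
  ultimately show ?thesis by (meson Un_least Un_subset_iff order_trans)
qed

text \<open>For an upper bound the chain of three generated submodules collapses to the union of all
  their generators.\<close>

lemma kernel3_least:
  assumes "graded_submodule l N" "R \<union> gens1 K lam f \<union> gens2 f \<union> gens3 P f \<subseteq> N"
  shows "kernel3 R l K lam P f \<subseteq> N"
  unfolding kernel3_def kernel2_def kernel1_def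
  using assms by (intro generated_submodule_least Un_least) auto

text \<open>At charge zero this will be the preimage of the module; the other charges are
  intermediate stations of single modes. The elements of \<open>R\<close> represent zero and so
  belong to every member.\<close>

definition charged :: "'m fock set \<Rightarrow> ('m \<Rightarrow> complex) \<Rightarrow> int \<Rightarrow> 'm fock set" where
  "charged R f n = fock.span (R \<union> {ftriple a b f | a b. valid_nword a \<and> charge (map fst a) + charge b = n})"

lemma ftriple_charged:
  "valid_nword a \<Longrightarrow> charge (map fst a) + charge b = n \<Longrightarrow> ftriple a b f \<in> charged R f n"
  unfolding charged_def by (intro fock.span_base) blast

lemma subspace_charged: "fock.subspace (charged R f n)"
  by (simp add: charged_def)

lemmas charged_closed = fock.subspace_sum[OF subspace_charged] fock.subspace_scale[OF subspace_charged]
  fock.subspace_diff[OF subspace_charged]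

lemma charge_straight_word [simp]: "charge (straight_word n) = n"
  by (auto simp: straight_word_def)

lemma charge_mset: "mset v = mset w \<Longrightarrow> charge v = charge w"
  unfolding charge_def by (metis mset_map sum_mset_sum_list)

lemma charge_permute_list:
  "\<tau> permutes {..<length a} \<Longrightarrow> charge (map fst (permute_list \<tau> a)) = charge (map fst a)"
  by (rule charge_mset) simp

lemma valid_nword_mset: "mset a = mset a' \<Longrightarrow> valid_nword a \<longleftrightarrow> valid_nword a'"
  unfolding valid_nword_def by (metis set_mset_mset)

lemma gens_charged: "gens1 K lam f \<union> gens2 f \<union> gens3 P f \<subseteq> charged R f 0"
proof (intro Un_least subsetI)
  fix y assume "y \<in> gens1 K lam f"
  then show "y \<in> charged R f 0"
    by (auto simp: gens1_def intro!: charged_closed ftriple_charged)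
next
  fix y assume "y \<in> gens2 f"
  then obtain a b \<tau> where y: "y = ftriple a b f - ftriple (permute_list \<tau> a) b f" "valid_nword a"
     "charge (map fst a) + charge b = 0" "\<tau> permutes {..<length a}"
    by (auto simp: gens2_def)
  then show "y \<in> charged R f 0"
    using valid_nword_mset[of "permute_list \<tau> a" a] charge_permute_list[OF y(4)]
    by (auto intro!: charged_closed ftriple_charged)
next
  fix y assume "y \<in> gens3 P f"
  then obtain s r k ts us where y: "even r" "r \<ge> k + P" "r div 2 \<le> k" "length ts = r div 2" "length us = k - r div 2"
      "\<forall>t\<in>set ts \<union> set us. t \<ge> 1"
      "y = ftriple (map (Pair s) ts @ map (Pair (neg s)) us) (replicate (r - k) (neg s)) f"
    by (auto simp: gens3_def sorted_monomials_def)
  have "map fst (map (Pair s) ts @ map (Pair (neg s)) us) = replicate (r div 2) s @ replicate (k - r div 2) (neg s)"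
    using y by (simp add: o_def map_replicate_const)
  moreover have "valid_nword (map (Pair s) ts @ map (Pair (neg s)) us)" using y(6) by (auto simp: valid_nword_def)
  moreover have "int (r div 2) * sval s - int (k - r div 2) * sval s - int (r - k) * sval s = 0"
    using y(1-3) by (auto elim!: evenE simp: of_nat_diff algebra_simps)
  ultimately show "y \<in> charged R f 0"
    unfolding y(7) by (intro ftriple_charged) (simp_all del: map_append)
qed

definition homog :: "nat \<Rightarrow> 'm fock set" where
  "homog n = {y. \<forall>k\<in>Poly_Mapping.keys y. wt k = n}"

lemma subspace_homog: "fock.subspace (homog n)"
  unfolding fock.subspace_def
proof (intro conjI ballI allI)
  show "0 \<in> homog n" by (simp add: homog_def)
  show "x + y \<in> homog n" if "x \<in> homog n" "y \<in> homog n" for x y :: "'a fock"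
    using that Poly_Mapping.keys_add[of x y] by (auto simp: homog_def)
  show "scl z x \<in> homog n" if "x \<in> homog n" for x :: "'a fock" and z
    using that by (auto simp: in_keys_iff homog_def)
qed

lemmas homog_closed = fock.subspace_sum[OF subspace_homog] fock.subspace_scale[OF subspace_homog]
  fock.subspace_diff[OF subspace_homog]

lemma homogeneousI: "y \<in> homog n \<Longrightarrow> homogeneous y"
  by (auto simp: homogeneous_def homog_def)

lemma ftriple_homog: "ftriple a b u \<in> homog (sum_list (map snd a))"
  by (simp add: wt_def homog_def)

section \<open>The module as the neutral part\<close>

definition linear_rel :: "nword \<Rightarrow> sign list \<Rightarrow> complex \<Rightarrow> complex \<Rightarrow> ('m \<Rightarrow> complex) \<Rightarrow> ('m \<Rightarrow> complex) \<Rightarrow> 'm fock" where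
  "linear_rel a b z z' u u' = ftriple a b (\<lambda>x. z * u x + z' * u' x) - scl z (ftriple a b u) - scl z' (ftriple a b u')"

definition action_rel :: "nword \<Rightarrow> sign list \<Rightarrow> nat \<Rightarrow> (sign list \<Rightarrow> complex) \<Rightarrow> ('m \<Rightarrow> complex) \<Rightarrow> ('m \<Rightarrow> complex) \<Rightarrow> 'm fock" where
  "action_rel a b k \<xi> u u' = (\<Sum>w | length w = k. scl (\<xi> w) (ftriple a (b @ w) u)) - ftriple a b u'"

context
  fixes A :: "'m::topological_space chart set" and g :: "'m metric" and c0 :: "'m chart" and p :: 'm
    and e1 e2 :: "real^2" and U :: "'m set"
begin

definition action_data where
  "action_data k \<xi> u u' \<longleftrightarrow> (\<exists>X. parallel_section A g k X \<and>
        (\<forall>I. length I = k \<longrightarrow> X c0 p I = (\<Sum>w | length w = k. \<xi> w * word_tensor e1 e2 w I)) \<and>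
        u \<in> smooth_functions A U \<and> u' \<in> smooth_functions A U \<and> acts_to A g U k X u u')"

lemma tensor_relations_eq: "tensor_relations A g c0 p e1 e2 U =
    {linear_rel a b z z' u u' | a b z z' u u'. valid_nword a \<and> u \<in> smooth_functions A U \<and> u' \<in> smooth_functions A U} \<union>
    {action_rel a b k \<xi> u u' | a b k \<xi> u u'. valid_nword a \<and> action_data k \<xi> u u'}"
  unfolding tensor_relations_def linear_rel_def action_rel_def action_data_def by blast

lemma tensor_relations_homog: "y \<in> tensor_relations A g c0 p e1 e2 U \<Longrightarrow> \<exists>n. y \<in> homog n"
proof -
  assume "y \<in> tensor_relations A g c0 p e1 e2 U"
  then consider (s) a b z z' u u' where "y = linear_rel a b z z' u u'" | (t) a b k \<xi> u u' where "y = action_rel a b k \<xi> u u'"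
    unfolding tensor_relations_eq by blast
  then show ?thesis
  proof cases
    case s
    then show ?thesis unfolding linear_rel_def
      by (intro exI[of _ "sum_list (map snd a)"])
        (auto simp only: intro!: homog_closed ftriple_homog)
  next
    case t
    then show ?thesis unfolding action_rel_def
      by (intro exI[of _ "sum_list (map snd a)"])
        (auto simp only: intro!: homog_closed ftriple_homog)
  qed
qed

abbreviation (input) "Rel \<equiv> tensor_relations A g c0 p e1 e2 U"

text \<open>By \<open>h_mode_ftriple\<close> a mode sends a tensor relation to a combination of
  relations of the same shape with new words on the left, and a monomial to monomials of shifted
  charge.\<close>

lemma charged_stable: "y \<in> charged Rel f n \<Longrightarrow> h_mode l s m y \<in> charged Rel f (n + sval s)"
proof -
  assume y: "y \<in> charged Rel f n"
  note sub = subspace_charged[of Rel f "n + sval s"]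
  have "h_mode l s m y \<in> charged Rel f (n + sval s)"
    if yb: "y \<in> Rel \<union> {ftriple a b f | a b. valid_nword a \<and> charge (map fst a) + charge b = n}" for y
  proof -
    obtain a where a: "valid_nword a"
      and cases: "(\<exists>b z z' u u'. y = linear_rel a b z z' u u' \<and> u \<in> smooth_functions A U \<and> u' \<in> smooth_functions A U) \<or>
        (\<exists>b k \<xi> u u'. y = action_rel a b k \<xi> u u' \<and> action_data k \<xi> u u') \<or>
        (\<exists>b. y = ftriple a b f \<and> charge (map fst a) + charge b = n)"
      using yb unfolding tensor_relations_eq by blast
    obtain I c a' pre where I: "finite (I::nat set)" "\<And>i. i \<in> I \<Longrightarrow> valid_nword (a' i)"
      "\<And>i. i \<in> I \<Longrightarrow> charge (map fst (a' i)) + charge pre = charge (map fst a) + sval s"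
      "\<And>b (u :: 'm \<Rightarrow> complex). h_mode l s m (ftriple a b u) = (\<Sum>i\<in>I. scl c (ftriple (a' i) (pre @ b) u))"
      by (rule h_mode_ftriple[OF a, of s l m]) blast
    note lin = lin_diff[OF lin_h_mode] lin_scl[OF lin_h_mode] lin_sum[OF lin_h_mode] I(4)
      fock.scale_right_diff_distrib sum_subtractf fock.scale_sum_right
    from cases consider (s) b z z' u u' where "y = linear_rel a b z z' u u'" "u \<in> smooth_functions A U" "u' \<in> smooth_functions A U"
      | (t) b k \<xi> u u' where "y = action_rel a b k \<xi> u u'" "action_data k \<xi> u u'"
      | (f) b where "y = ftriple a b f" "charge (map fst a) + charge b = n"
      by blast
    then show ?thesis
    proof cases
      case s
      have "h_mode l s m y = (\<Sum>i\<in>I. scl c (linear_rel (a' i) (pre @ b) z z' u u'))"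
        unfolding s(1) linear_rel_def by (simp add: lin mult.commute)
      moreover have "linear_rel (a' i) (pre @ b) z z' u u' \<in> charged Rel f (n + sval s)" if "i \<in> I" for i
        unfolding charged_def using s I(2)[OF that] by (intro fock.span_base) (auto simp: tensor_relations_eq)
      ultimately show ?thesis by (auto intro!: charged_closed)
    next
      case t
      have "h_mode l s m y = (\<Sum>i\<in>I. scl c (action_rel (a' i) (pre @ b) k \<xi> u u'))"
        unfolding t(1) action_rel_def by (simp add: lin mult.commute) (rule sum.swap)
      moreover have "action_rel (a' i) (pre @ b) k \<xi> u u' \<in> charged Rel f (n + sval s)" if "i \<in> I" for i
        unfolding charged_def using t I(2)[OF that] by (intro fock.span_base) (auto simp: tensor_relations_eq)
      ultimately show ?thesis by (auto intro!: charged_closed)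
    next
      case f
      have "ftriple (a' i) (pre @ b) f \<in> charged Rel f (n + sval s)" if "i \<in> I" for i
        using I(2,3)[OF that] f(2) by (intro ftriple_charged) auto
      then show ?thesis unfolding f(1) I(4) by (auto intro!: charged_closed)
    qed
  qed
  then show "h_mode l s m y \<in> charged Rel f (n + sval s)"
    using lin_span[OF lin_h_mode sub _ y[unfolded charged_def]] by blast
qed

lemma graded_submodule_charged: "graded_submodule l (charged Rel f 0)"
proof (rule graded_submoduleI[where N = "charged Rel f", OF subspace_charged charged_stable])
  let ?B = "Rel \<union> {ftriple a b f | a b. valid_nword a \<and> charge (map fst a) + charge b = 0}"
  have "?B \<subseteq> {y \<in> charged Rel f 0. homogeneous y}"
    using tensor_relations_homog homogeneousI homogeneousI[OF ftriple_homog]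
    by (auto simp: charged_def intro: fock.span_base)
  then show "charged Rel f 0 \<subseteq> fock.span {y \<in> charged Rel f 0. homogeneous y}"
    unfolding charged_def[of Rel f] by (rule fock.span_mono)
qed

text \<open>One inclusion is stability under neutral products of modes; the other is the
  interpolation argument behind \<open>ftriple_in_span\<close>.\<close>

lemma VU_eq_charged: "VU Rel l f = charged Rel f 0"
proof
  have "vertex_mode l v N (ftriple [] [] f) \<in> charged Rel f 0" if "v \<in> V_words" for v N
    by (rule vertex_mode_stable[where N = "charged Rel f", OF subspace_charged charged_stable ftriple_charged that]) simp_all
  then show "VU Rel l f \<subseteq> charged Rel f 0"
    unfolding VU_def by (intro fock.span_minimal subspace_charged) (auto simp: charged_def intro: fock.span_base)
  have "ftriple a b f \<in> VU Rel l f" if "valid_nword a" "charge (map fst a) + charge b = 0" for a b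
    using ftriple_in_span[OF that, of f l] fock.span_mono[OF Un_upper2] unfolding VU_def by blast
  then show "charged Rel f 0 \<subseteq> VU Rel l f"
    unfolding charged_def by (intro fock.span_minimal) (auto simp: VU_def intro: fock.span_base)
qed

lemma kernel3_le_VU: "kernel3 Rel l K lam P f \<subseteq> VU Rel l f"
  unfolding VU_eq_charged
  using gens_charged[of K lam f P Rel] fock.span_superset[of "Rel \<union> _"]
  by (intro kernel3_least graded_submodule_charged) (auto simp: charged_def)

end

section \<open>Reduction to the sorted monomials\<close>

lemma sort_nword:
  fixes a :: nword
  assumes "valid_nword a"
  obtains ts us \<tau> where "sorted_wrt (\<ge>) ts" "sorted_wrt (\<ge>) us" "\<forall>t\<in>set ts \<union> set us. t \<ge> 1"
    "\<tau> permutes {..<length a}" "permute_list \<tau> a = map (Pair s) ts @ map (Pair (neg s)) us"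
    "length a = length ts + length us" "charge (map fst a) = (int (length ts) - int (length us)) * sval s"
proof -
  define srt where "srt s = rev (sort (map snd (filter (\<lambda>x. fst x = s) a)))" for s
  have sorted: "sorted_wrt (\<ge>) (srt s)" for s
    unfolding srt_def sorted_wrt_rev by (simp add: sorted_sort)
  have ms: "mset (map (Pair s) (srt s)) = mset (filter (\<lambda>x. fst x = s) a)" for s
  proof -
    have "map (Pair s) (map snd (filter (\<lambda>x. fst x = s) a)) = filter (\<lambda>x. fst x = s) a"
      by (auto intro!: map_idI)
    then show ?thesis unfolding srt_def by (metis mset_map mset_rev mset_sort)
  qed
  have "(\<lambda>x. \<not> fst x = s) = (\<lambda>x::sign \<times> nat. fst x = neg s)" using neq_iff_neg by (auto simp: fun_eq_iff)
  then have m: "mset (map (Pair s) (srt s) @ map (Pair (neg s)) (srt (neg s))) = mset a"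
    unfolding mset_append ms using multiset_partition[of "mset a" "\<lambda>x. fst x = s"] by simp
  obtain \<tau> where \<tau>: "\<tau> permutes {..<length a}" "permute_list \<tau> a = map (Pair s) (srt s) @ map (Pair (neg s)) (srt (neg s))"
    using mset_eq_permutation[OF m] by metis
  have "\<forall>t\<in>set (srt s) \<union> set (srt (neg s)). t \<ge> 1" using assms by (auto simp: srt_def valid_nword_def)
  moreover have "length a = length (srt s) + length (srt (neg s))" using mset_eq_length[OF m] by simp
  moreover have "charge (map fst a) = charge (map fst (map (Pair s) (srt s) @ map (Pair (neg s)) (srt (neg s))))"
    by (rule charge_mset) (metis m mset_map)
  then have "charge (map fst a) = (int (length (srt s)) - int (length (srt (neg s)))) * sval s"
    by (simp add: o_def map_replicate_const algebra_simps)
  ultimately show thesis using that sorted \<tau> by blast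
qed

definition basis_set :: "nat \<Rightarrow> ('m \<Rightarrow> complex) \<Rightarrow> 'm fock set" where
  "basis_set P f = (\<Union>{sorted_monomials f Plus r r | r. even r} \<union>
     \<Union>{sorted_monomials f Plus r k | r k. even r \<and> r + 1 \<le> k + P \<and> r div 2 \<le> k \<and> k + 1 \<le> r} \<union>
     \<Union>{sorted_monomials f Minus r k | r k. even r \<and> r + 1 \<le> k + P \<and> r div 2 \<le> k \<and> k + 1 \<le> r})"

text \<open>The three families become one, with \<open>n\<close> for the number \<open>r - k\<close>
  of zero modes. Without zero modes the two signs give the same monomials up to order, so
  \<open>n = 0\<close> is tied to \<open>Plus\<close>.\<close>

lemma basis_set_form:
  "basis_set P f = {ftriple (map (Pair s) ts @ map (Pair (neg s)) us) (replicate n (neg s)) f | s ts us n.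
     sorted_wrt (\<ge>) ts \<and> sorted_wrt (\<ge>) us \<and> (\<forall>t\<in>set ts \<union> set us. t \<ge> 1) \<and>
     length ts = length us + n \<and> (n = 0 \<longrightarrow> s = Plus) \<and> (n = 0 \<or> n < P)}" (is "_ = ?B")
proof
  show "basis_set P f \<subseteq> ?B"
  proof
    fix y assume "y \<in> basis_set P f"
    then obtain s r k ts us where y: "y = ftriple (map (Pair s) ts @ map (Pair (neg s)) us) (replicate (r - k) (neg s)) f"
      "length ts = r div 2" "length us = k - r div 2" "sorted_wrt (\<ge>) ts" "sorted_wrt (\<ge>) us" "\<forall>t\<in>set ts \<union> set us. t \<ge> 1"
      "even r" "r = k \<and> s = Plus \<or> r + 1 \<le> k + P \<and> r div 2 \<le> k \<and> k + 1 \<le> r"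
      unfolding basis_set_def sorted_monomials_def by blast
    have "length ts = length us + (r - k)" "r - k = 0 \<longrightarrow> s = Plus" "r - k = 0 \<or> r - k < P"
      using y(2,3,7,8) by (auto elim!: evenE)
    then show "y \<in> ?B"
      unfolding mem_Collect_eq using y
      by (intro exI[of _ s] exI[of _ ts] exI[of _ us] exI[of _ "r - k"]) auto
  qed
  show "?B \<subseteq> basis_set P f"
  proof
    fix y assume "y \<in> ?B"
    then obtain s ts us n where y: "y = ftriple (map (Pair s) ts @ map (Pair (neg s)) us) (replicate n (neg s)) f"
      "sorted_wrt (\<ge>) ts" "sorted_wrt (\<ge>) us" "\<forall>t\<in>set ts \<union> set us. t \<ge> 1"
      "length ts = length us + n" "n = 0 \<longrightarrow> s = Plus" "n = 0 \<or> n < P"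
      by blast
    define r k where "r = 2 * length ts" and "k = r - n"
    have "y \<in> sorted_monomials f s r k"
      unfolding sorted_monomials_def mem_Collect_eq
      by (intro exI[of _ ts] exI[of _ us]) (use y in \<open>auto simp: r_def k_def\<close>)
    moreover have "even r" "r + 1 \<le> k + P \<and> r div 2 \<le> k \<and> k + 1 \<le> r \<or> k = r \<and> s = Plus"
      using y(5-7) by (auto simp: r_def k_def)
    ultimately show "y \<in> basis_set P f"
      unfolding basis_set_def by (cases s) blast+
  qed
qed

text \<open>\<open>gens1\<close> straightens the zero modes, \<open>gens2\<close> sorts the negative
  modes, and \<open>gens3\<close> removes the result if at least \<open>P\<close> zero modes remain
  and there is at least one.\<close>

lemma ftriple_reduce:
  assumes a: "valid_nword a" "charge (map fst a) + charge b = 0"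
    and M: "fock.subspace M" "gens1 K lam f \<union> gens2 f \<union> gens3 P f \<subseteq> M"
  shows "\<exists>x\<in>fock.span (basis_set P f). ftriple a b f - x \<in> M"
proof -
  \<comment> \<open>Opposite to the sign of the remaining zero modes: neutrality makes
    \<open>s\<close> the majority sign among the negative modes.\<close>
  define s where "s = (if charge b > 0 then Minus else Plus)"
  define n where "n = nat \<bar>charge b\<bar>"
  obtain ts us \<tau> where so: "sorted_wrt (\<ge>) ts" "sorted_wrt (\<ge>) us" "\<forall>t\<in>set ts \<union> set us. t \<ge> 1"
    "\<tau> permutes {..<length a}" "permute_list \<tau> a = map (Pair s) ts @ map (Pair (neg s)) us"
    "length a = length ts + length us" "charge (map fst a) = (int (length ts) - int (length us)) * sval s"
    by (rule sort_nword[OF a(1)])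
  have sw: "straight_word (charge b) = replicate n (neg s)"
    by (auto simp: straight_word_def s_def n_def)
  have len: "length ts = length us + n"
    using so(7) a(2) by (auto simp: n_def s_def split: if_splits)
  let ?y = "ftriple (map (Pair s) ts @ map (Pair (neg s)) us) (replicate n (neg s)) f"
  let ?c = "Cconst K lam b"
  have "ftriple a b f - scl ?c (ftriple a (straight_word (charge b)) f) \<in> M"
    using M(2) a by (auto simp: gens1_def)
  moreover have "ftriple a (straight_word (charge b)) f - ?y \<in> M"
  proof -
    have "charge (map fst a) + charge (straight_word (charge b)) = 0" using a(2) by simp
    then show ?thesis
      using M(2) a(1) so(4) unfolding so(5)[symmetric] sw[symmetric] gens2_def by blast
  qed
  ultimately have "(ftriple a b f - scl ?c (ftriple a (straight_word (charge b)) f)) +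
      scl ?c (ftriple a (straight_word (charge b)) f - ?y) \<in> M"
    by (intro fock.subspace_add[OF M(1)] fock.subspace_scale[OF M(1)])
  then have r: "ftriple a b f - scl ?c ?y \<in> M"
    by (simp add: fock.scale_right_diff_distrib)
  show ?thesis
  proof (cases "n = 0 \<or> n < P")
    case True
    have "n = 0 \<longrightarrow> s = Plus" by (auto simp: n_def s_def)
    then have "?y \<in> basis_set P f"
      unfolding basis_set_form mem_Collect_eq using so(1-3) len True by blast
    then show ?thesis using r by (intro bexI[of _ "scl ?c ?y"]) (auto intro: fock.span_base fock.span_scale)
  next
    case False
    have "?y \<in> sorted_monomials f s (2 * length ts) (2 * length ts - n)"
      unfolding sorted_monomials_def mem_Collect_eq
      by (intro exI[of _ ts] exI[of _ us]) (use so len in auto)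
    moreover have "even (2 * length ts)" "2 * length ts \<ge> (2 * length ts - n) + P" "2 * length ts div 2 \<le> 2 * length ts - n"
      using False len by auto
    ultimately have "?y \<in> gens3 P f" unfolding gens3_def by blast
    then have "?y \<in> M" using M(2) by blast
    then have "(ftriple a b f - scl ?c ?y) + scl ?c ?y \<in> M"
      using r by (intro fock.subspace_add[OF M(1)] fock.subspace_scale[OF M(1)])
    then show ?thesis by (intro bexI[of _ 0]) (auto intro: fock.span_zero)
  qed
qed

lemma charged_reduce:
  assumes M: "fock.subspace M" "R \<union> gens1 K lam f \<union> gens2 f \<union> gens3 P f \<subseteq> M" and y: "y \<in> charged R f 0"
  shows "\<exists>x\<in>fock.span (basis_set P f). y - x \<in> M"
  using y unfolding charged_def
proof (induction rule: fock.span_induct_alt)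
  case base
  show ?case using fock.subspace_0[OF M(1)] by (intro bexI[of _ 0]) (auto intro: fock.span_zero)
next
  case (step z b y)
  then obtain x where x: "x \<in> fock.span (basis_set P f)" "y - x \<in> M" by blast
  obtain x' where x': "x' \<in> fock.span (basis_set P f)" "b - x' \<in> M"
  proof (cases "b \<in> R")
    case True
    then show thesis using M(2) by (intro that[of 0]) (auto intro: fock.span_zero)
  next
    case False
    then show thesis using step(1) ftriple_reduce[OF _ _ M(1), of _ _ K lam f P] M(2) that by blast
  qed
  have "scl z (b - x') + (y - x) \<in> M"
    by (intro fock.subspace_add[OF M(1)] fock.subspace_scale[OF M(1)] x x')
  then show ?case using x(1) x'(1)
    by (intro bexI[of _ "scl z x' + x"])
      (auto simp: fock.scale_right_diff_distrib algebra_simps intro: fock.span_add fock.span_scale)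
qed

section \<open>The model\<close>

definition lin_eval :: "('k \<Rightarrow> complex) \<Rightarrow> ('k \<Rightarrow>\<^sub>0 complex) \<Rightarrow> complex" where
  "lin_eval \<Phi> y = (\<Sum>k\<in>Poly_Mapping.keys y. Poly_Mapping.lookup y k * \<Phi> k)"

lemma lin_eval_superset:
  "finite A \<Longrightarrow> Poly_Mapping.keys y \<subseteq> A \<Longrightarrow> lin_eval \<Phi> y = (\<Sum>k\<in>A. Poly_Mapping.lookup y k * \<Phi> k)"
  unfolding lin_eval_def by (rule sum.mono_neutral_left) (auto simp: in_keys_iff)

lemma lin_eval_add: "lin_eval \<Phi> (x + y) = lin_eval \<Phi> x + lin_eval \<Phi> y"
proof -
  let ?A = "Poly_Mapping.keys x \<union> Poly_Mapping.keys y"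
  have f: "finite ?A" by simp
  show ?thesis
    using lin_eval_superset[OF f Poly_Mapping.keys_add, of \<Phi>] lin_eval_superset[OF f, of x \<Phi>] lin_eval_superset[OF f, of y \<Phi>]
    by (simp add: lookup_add distrib_right sum.distrib)
qed

lemma lin_eval_scl: "lin_eval \<Phi> (scl z y) = z * lin_eval \<Phi> y"
proof -
  have "Poly_Mapping.keys (scl z y) \<subseteq> Poly_Mapping.keys y" by (auto simp: in_keys_iff)
  then show ?thesis
    using lin_eval_superset[of "Poly_Mapping.keys y" "scl z y" \<Phi>] by (simp add: lin_eval_def[of \<Phi> y] sum_distrib_left mult.assoc)
qed

lemma lin_eval_zero [simp]: "lin_eval \<Phi> 0 = 0"
  by (simp add: lin_eval_def)

lemma lin_eval_diff: "lin_eval \<Phi> (x - y) = lin_eval \<Phi> x - lin_eval \<Phi> y"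
  using lin_eval_add[of \<Phi> "x - y" y] by simp

lemma lin_eval_sum: "lin_eval \<Phi> (\<Sum>a\<in>I. y a) = (\<Sum>a\<in>I. lin_eval \<Phi> (y a))"
  by (induction I rule: infinite_finite_induct) (simp_all add: lin_eval_add)

lemma lin_eval_single [simp]: "lin_eval \<Phi> (Poly_Mapping.single k 1) = \<Phi> k"
  by (simp add: lin_eval_def)

lemma lin_eval_linear_extension: "lin_eval \<Phi> (linear_extension T y) = lin_eval (\<lambda>k. lin_eval \<Phi> (T k)) y"
  by (simp add: linear_extension_def lin_eval_sum lin_eval_scl) (simp add: lin_eval_def)

lemma lin_eval_cong: "(\<And>k. k \<in> Poly_Mapping.keys y \<Longrightarrow> \<Phi> k = \<Phi>' k) \<Longrightarrow> lin_eval \<Phi> y = lin_eval \<Phi>' y"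
  by (simp add: lin_eval_def)

lemma lin_eval_mult_left: "lin_eval (\<lambda>k. c * \<Phi> k) y = c * lin_eval \<Phi> y"
  by (simp add: lin_eval_def sum_distrib_left mult.left_commute)

lemma Cconst_Nil [simp]: "Cconst K lam [] = 1"
  by (simp add: Cconst_def)

lemma Cconst_Cons:
  "Cconst K lam (s # b) = (if \<bar>sval s + charge b\<bar> < \<bar>charge b\<bar>
     then - lam + of_int (\<bar>charge b\<bar> * (\<bar>charge b\<bar> - 1)) * of_real K else 1) * Cconst K lam b"
proof -
  let ?Q = "\<lambda>b. {q. q < length b \<and> \<bar>charge (drop q b)\<bar> < \<bar>charge (drop (Suc q) b)\<bar>}"
  have "?Q (s # b) = (if \<bar>sval s + charge b\<bar> < \<bar>charge b\<bar> then {0} else {}) \<union> Suc ` ?Q b"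
  proof (rule set_eqI)
    show "q \<in> ?Q (s # b) \<longleftrightarrow> q \<in> (if \<bar>sval s + charge b\<bar> < \<bar>charge b\<bar> then {0} else {}) \<union> Suc ` ?Q b" for q
      by (cases q) (auto simp: image_iff)
  qed
  then show ?thesis
    unfolding Cconst_def
    by (cases "\<bar>sval s + charge b\<bar> < \<bar>charge b\<bar>") (simp_all add: prod.reindex)
qed

lemma cop_replicate: "cop L K (replicate n s) v = v"
  by (induction n) (cases s; auto)+

lemma cop_straight_word: "cop L K (straight_word n) v = v"
  by (simp add: straight_word_def cop_replicate)

lemma count_mset_index: "count (mset a) x = card {i. i < length a \<and> a ! i = x}"
proof -
  have "{i. i < length a \<and> a ! i = x} = {i. i < length a \<and> x = a ! i}" by auto
  then show ?thesis by (simp add: count_mset count_list_eq_length_filter length_filter_conv_card)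
qed

lemma sorted_ge_unique:
  assumes "sorted_wrt (\<ge>) ts" "sorted_wrt (\<ge>) ts'" "mset ts = mset (ts' :: nat list)"
  shows "ts = ts'"
proof -
  have "sorted (rev ts)" "sorted (rev ts')" using assms by (simp_all add: sorted_wrt_rev)
  moreover have "mset (rev ts) = mset (rev ts')" using assms by simp
  ultimately have "rev ts = rev ts'" by (metis properties_for_sort)
  then show ?thesis by simp
qed

text \<open>The model forgets the order of the negative modes, yet nothing is lost on basis
  monomials: the charge of the zero modes determines the sign and their number, and the multiset
  then determines the two sorted lists.\<close>

lemma basis_set_unique:
  assumes "ftriple a b f \<in> basis_set P f" "ftriple a' b' f \<in> basis_set P f" "mset a = mset a'" "charge b = charge b'"
  shows "a = a' \<and> b = b'"
proof -
  have st: "ftriple a b f = ftriple a' b' f \<longleftrightarrow> a = a' \<and> b = b'" for a b a' b' f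
    by (auto dest: arg_cong[where f = Poly_Mapping.keys])
  obtain s ts us n where 1: "a = map (Pair s) ts @ map (Pair (neg s)) us" "b = replicate n (neg s)"
    "sorted_wrt (\<ge>) ts" "sorted_wrt (\<ge>) us" "n = 0 \<longrightarrow> s = Plus"
    using assms(1) unfolding basis_set_form st mem_Collect_eq by blast
  obtain s' ts' us' n' where 2: "a' = map (Pair s') ts' @ map (Pair (neg s')) us'" "b' = replicate n' (neg s')"
    "sorted_wrt (\<ge>) ts'" "sorted_wrt (\<ge>) us'" "n' = 0 \<longrightarrow> s' = Plus"
    using assms(2) unfolding basis_set_form st mem_Collect_eq by blast
  have n: "n = n' \<and> s = s'"
    using assms(4) 1(2,5) 2(2,5) by (cases s; cases s') auto
  have "mset (map snd (filter (\<lambda>x. fst x = t) a)) = mset (map snd (filter (\<lambda>x. fst x = t) a'))" for t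
    using assms(3) by (metis mset_filter mset_map)
  from this[of s] this[of "neg s"] have "mset ts = mset ts'" "mset us = mset us'"
    using n by (simp_all add: 1(1) 2(1) o_def filter_map)
  then show ?thesis using 1 2 n sorted_ge_unique by metis
qed

text \<open>What independence needs of the geometry: \<open>L\<close> plays the Laplacian,
  \<open>\<rho>\<close> the restriction to the chart, and \<open>T\<close> the smooth functions
  there.\<close>

locale mode_model =
  fixes Sm :: "('m \<Rightarrow> complex) set" and \<rho> :: "('m \<Rightarrow> complex) \<Rightarrow> 'x \<Rightarrow> complex"
    and L :: "('x \<Rightarrow> complex) \<Rightarrow> 'x \<Rightarrow> complex" and T :: "('x \<Rightarrow> complex) set"
    and K :: real and P :: nat and lam :: complex and f :: "'m \<Rightarrow> complex"
  assumes T_zero: "(\<lambda>y. 0) \<in> T"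
    and T_lin: "u \<in> T \<Longrightarrow> v \<in> T \<Longrightarrow> (\<lambda>y. a * u y + b * v y) \<in> T"
    and L_T: "u \<in> T \<Longrightarrow> L u \<in> T"
    and L_lin: "u \<in> T \<Longrightarrow> v \<in> T \<Longrightarrow> L (\<lambda>y. a * u y + b * v y) = (\<lambda>y. a * L u y + b * L v y)"
    and \<rho>_T: "w \<in> Sm \<Longrightarrow> \<rho> w \<in> T"
    and \<rho>_lin: "w \<in> Sm \<Longrightarrow> w' \<in> Sm \<Longrightarrow> \<rho> (\<lambda>x. a * w x + b * w' x) = (\<lambda>y. a * \<rho> w y + b * \<rho> w' y)"
    and Sm_lin: "w \<in> Sm \<Longrightarrow> w' \<in> Sm \<Longrightarrow> (\<lambda>x. a * w x + b * w' x) \<in> Sm"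
    and f_Sm: "f \<in> Sm" and f_eigen: "L (\<rho> f) = (\<lambda>y. - lam * \<rho> f y)" and f_nz: "\<exists>y. \<rho> f y \<noteq> 0"
    and lam: "lam = of_nat P * (of_nat P - 1) * of_real K" and P: "P \<ge> 1"
begin

abbreviation "cp \<equiv> cop L (of_real K)"

abbreviation "lower m v \<equiv> (\<lambda>x. L v x + of_int (\<bar>m\<bar> * (\<bar>m\<bar> - 1)) * of_real K * v x)"

lemma T_sum: "(\<And>k. k \<in> A \<Longrightarrow> F k \<in> T) \<Longrightarrow> (\<lambda>x. \<Sum>k\<in>A. c k * F k x) \<in> T"
proof (induction A rule: infinite_finite_induct)
  case (insert k A)
  then have "(\<lambda>x. c k * F k x + 1 * (\<Sum>k\<in>A. c k * F k x)) \<in> T" by (intro T_lin) auto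
  with insert show ?case by simp
qed (simp_all add: T_zero)

lemma L_zero: "L (\<lambda>y. 0) = (\<lambda>y. 0)"
  using L_lin[OF T_zero T_zero, of 0 0] by simp

lemma L_sum:
  "(\<And>k. k \<in> A \<Longrightarrow> F k \<in> T) \<Longrightarrow> L (\<lambda>x. \<Sum>k\<in>A. c k * F k x) = (\<lambda>x. \<Sum>k\<in>A. c k * L (F k) x)"
proof (induction A rule: infinite_finite_induct)
  case (insert k A)
  then have "L (\<lambda>x. c k * F k x + 1 * (\<Sum>k\<in>A. c k * F k x)) = (\<lambda>x. c k * L (F k) x + 1 * L (\<lambda>x. \<Sum>k\<in>A. c k * F k x) x)"
    by (intro L_lin T_sum) auto
  with insert show ?case by simp
qed (simp_all add: L_zero)

lemma cp_T: "u \<in> T \<Longrightarrow> cp b u \<in> T"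
proof (induction b)
  case (Cons s b)
  then show ?case using T_lin[OF L_T, of "cp b u" "cp b u" 1] by simp
qed simp

lemma cp_sum:
  assumes "\<And>k. k \<in> A \<Longrightarrow> F k \<in> T"
  shows "cp b (\<lambda>x. \<Sum>k\<in>A. c k * F k x) = (\<lambda>x. \<Sum>k\<in>A. c k * cp b (F k) x)"
proof (induction b)
  case (Cons s b)
  have "L (\<lambda>x. \<Sum>k\<in>A. c k * cp b (F k) x) = (\<lambda>x. \<Sum>k\<in>A. c k * L (cp b (F k)) x)"
    by (rule L_sum) (simp add: cp_T assms)
  then show ?case by (simp add: Cons sum_distrib_left sum.distrib distrib_left mult_ac)
qed simp

lemma cp_f: "cp b (\<rho> f) = (\<lambda>y. Cconst K lam b * \<rho> f y)"
proof (induction b)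
  case (Cons s b)
  have "L (\<lambda>y. Cconst K lam b * \<rho> f y) = (\<lambda>y. Cconst K lam b * (- lam * \<rho> f y))"
    using L_lin[OF \<rho>_T[OF f_Sm] \<rho>_T[OF f_Sm], of "Cconst K lam b" 0] by (simp add: f_eigen)
  then show ?case unfolding cop.simps Cons Cconst_Cons by (auto simp: fun_eq_iff algebra_simps)
qed simp

text \<open>The coefficient of the monomial with variables from the multiset and zero modes of
  charge \<open>n\<close>. The word \<open>b\<close> is recorded only by its charge and by the
  operator with which it acts on the function.\<close>

definition psi_term :: "(sign \<times> nat) multiset \<Rightarrow> int \<Rightarrow> 'm triple \<Rightarrow> 'x \<Rightarrow> complex" where
  "psi_term \<mu> n = (\<lambda>(a, b, u) x. if mset a = \<mu> \<and> charge b = n then cp b (\<rho> u) x else 0)"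

definition psi :: "'m fock \<Rightarrow> (sign \<times> nat) multiset \<Rightarrow> int \<Rightarrow> 'x \<Rightarrow> complex" where
  "psi y \<mu> n x = lin_eval (\<lambda>k. psi_term \<mu> n k x) y"

definition smooth_part :: "'m fock set" where
  "smooth_part = {y. \<forall>(a, b, u)\<in>Poly_Mapping.keys y. u \<in> Sm}"

text \<open>From |n| = P to P - 1 the zero mode acts by \<open>L\<close> plus P(P-1)K, and the
  kernel of this operator consists of the eigenfunctions of eigenvalue \<open>lam\<close>. Hence
  eigenfunctions and not all of \<open>T\<close> at and above the threshold.\<close>

definition E :: "int \<Rightarrow> ('x \<Rightarrow> complex) set" where
  "E n = (if \<bar>n\<bar> < int P then {\<lambda>y. 0} else {v \<in> T. L v = (\<lambda>y. - lam * v y)})"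

definition N :: "'m fock set" where
  "N = {y \<in> smooth_part. \<forall>\<mu> n. psi y \<mu> n \<in> E n}"

lemma psi_add: "psi (x + y) \<mu> n = (\<lambda>z. psi x \<mu> n z + psi y \<mu> n z)"
  and psi_diff: "psi (x - y) \<mu> n = (\<lambda>z. psi x \<mu> n z - psi y \<mu> n z)"
  and psi_scl: "psi (scl c y) \<mu> n = (\<lambda>z. c * psi y \<mu> n z)"
  and psi_zero: "psi 0 \<mu> n = (\<lambda>z. 0)"
  and psi_sum: "psi (\<Sum>a\<in>I. w a) \<mu> n = (\<lambda>z. \<Sum>a\<in>I. psi (w a) \<mu> n z)"
  and psi_ftriple: "psi (ftriple a b u) \<mu> n = (if mset a = \<mu> \<and> charge b = n then cp b (\<rho> u) else (\<lambda>z. 0))"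
  by (auto simp: psi_def fun_eq_iff lin_eval_add lin_eval_diff lin_eval_scl lin_eval_sum psi_term_def)

lemma E_zero: "(\<lambda>y. 0) \<in> E n"
  by (simp add: E_def T_zero L_zero)

lemma E_lin: "u \<in> E n \<Longrightarrow> v \<in> E n \<Longrightarrow> (\<lambda>y. a * u y + b * v y) \<in> E n"
  by (auto simp: E_def T_lin L_lin algebra_simps)

lemma subspace_smooth_part: "fock.subspace smooth_part"
  unfolding fock.subspace_def
proof (intro conjI ballI allI)
  show "x + y \<in> smooth_part" if "x \<in> smooth_part" "y \<in> smooth_part" for x y
    using that Poly_Mapping.keys_add[of x y] by (fastforce simp: smooth_part_def)
  show "scl z x \<in> smooth_part" if "x \<in> smooth_part" for x z
    using that by (fastforce simp: smooth_part_def in_keys_iff)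
qed (simp add: smooth_part_def)

lemmas smooth_part_closed = fock.subspace_sum[OF subspace_smooth_part] fock.subspace_scale[OF subspace_smooth_part]
  fock.subspace_diff[OF subspace_smooth_part]

lemma ftriple_smooth_part: "u \<in> Sm \<Longrightarrow> ftriple a b u \<in> smooth_part"
  by (simp add: smooth_part_def)

lemma subspace_N: "fock.subspace N"
  unfolding fock.subspace_def
proof (intro conjI ballI allI)
  note S = subspace_smooth_part
  show "0 \<in> N" using fock.subspace_0[OF S] by (simp add: N_def psi_zero E_zero)
  show "x + y \<in> N" if "x \<in> N" "y \<in> N" for x y
    using that fock.subspace_add[OF S, of x y] E_lin[of _ _ _ 1 1] by (simp add: N_def psi_add)
  show "scl z x \<in> N" if "x \<in> N" for x z
    using that fock.subspace_scale[OF S, of x z] E_lin[of _ _ _ z 0] by (fastforce simp: N_def psi_scl)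
qed

lemma h_mode_smooth_part: "y \<in> smooth_part \<Longrightarrow> h_mode l s n y \<in> smooth_part"
proof -
  assume y: "y \<in> smooth_part"
  note S = subspace_smooth_part
  have c: "create s m y \<in> smooth_part" if "y \<in> smooth_part" for s m y
    using that unfolding create_def linear_extension_def
    by (intro fock.subspace_sum[OF S] fock.subspace_scale[OF S]) (auto simp: smooth_part_def)
  have a: "annihilate_word l s m a b u \<in> smooth_part" if "u \<in> Sm" for s m a b u
    using that unfolding annihilate_word_eq
    by (intro fock.subspace_sum[OF S] fock.subspace_scale[OF S] ftriple_smooth_part)
  have "zero_mode s y \<in> smooth_part"
    using y unfolding zero_mode_def linear_extension_def
    by (intro fock.subspace_sum[OF S] fock.subspace_scale[OF S]) (auto simp: smooth_part_def)
  moreover have "annihilate l s m y \<in> smooth_part" for m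
    unfolding annihilate_def linear_extension_def
  proof (intro fock.subspace_sum[OF S] fock.subspace_scale[OF S])
    fix k assume "k \<in> Poly_Mapping.keys y"
    then have "snd (snd k) \<in> Sm" using y by (auto simp: smooth_part_def)
    then show "(case k of (a, b, u) \<Rightarrow> annihilate_word l s m a b u) \<in> smooth_part"
      by (cases k) (simp add: a)
  qed
  ultimately show ?thesis using c[OF y] by (simp add: h_mode_def)
qed

lemma psi_create: "psi (create s m y) \<mu> n = (if (s, m) \<in># \<mu> then psi y (\<mu> - {#(s, m)#}) n else (\<lambda>z. 0))"
proof
  fix x
  have "mset ((s, m) # a) = \<mu> \<longleftrightarrow> (s, m) \<in># \<mu> \<and> mset a = \<mu> - {#(s, m)#}" for a
    by auto
  then have *: "psi_term \<mu> n ((s, m) # a, b, u) x = (if (s, m) \<in># \<mu> then psi_term (\<mu> - {#(s, m)#}) n (a, b, u) x else 0)" for a b u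
    by (simp only: psi_term_def case_prod_conv) auto
  then show "psi (create s m y) \<mu> n x = (if (s, m) \<in># \<mu> then psi y (\<mu> - {#(s, m)#}) n else (\<lambda>z. 0)) x"
  proof -
    have "psi (create s m y) \<mu> n x = lin_eval (\<lambda>k. if (s, m) \<in># \<mu> then psi_term (\<mu> - {#(s, m)#}) n k x else 0) y"
      unfolding psi_def create_def lin_eval_linear_extension
      by (intro lin_eval_cong) (auto simp: * split: prod.split)
    then show ?thesis by (simp add: psi_def lin_eval_def)
  qed
qed

text \<open>On commuting polynomials annihilation is a partial derivative up to a constant;
  \<open>Suc (count ...)\<close> is the exponent of the variable before differentiation.\<close>

lemma psi_annihilate:
  "psi (annihilate l s m y) \<mu> n = (\<lambda>x. of_nat (Suc (count \<mu> (neg s, m))) * (of_nat m * 2 * l) * psi y (add_mset (neg s, m) \<mu>) n x)"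
proof
  fix x
  let ?c = "of_nat (Suc (count \<mu> (neg s, m))) * (of_nat m * 2 * l)"
  have "psi (annihilate_word l s m a b u) \<mu> n x = ?c * psi_term (add_mset (neg s, m) \<mu>) n (a, b, u) x" for a b u
  proof -
    let ?I = "{i. i < length a \<and> a ! i = (neg s, m)}"
    have i: "mset (remove_nth i a) = \<mu> \<longleftrightarrow> mset a = add_mset (neg s, m) \<mu>" if "i \<in> ?I" for i
      using that mset_remove_nth[of i a] by auto
    have "psi (annihilate_word l s m a b u) \<mu> n x =
      (\<Sum>i\<in>?I. of_nat m * 2 * l * (if mset a = add_mset (neg s, m) \<mu> \<and> charge b = n then cp b (\<rho> u) x else 0))"
      unfolding annihilate_word_eq psi_sum psi_scl psi_ftriple
      by (intro sum.cong refl) (auto simp: i)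
    also have "\<dots> = of_nat (count (mset a) (neg s, m)) * (of_nat m * 2 * l) * (if mset a = add_mset (neg s, m) \<mu> \<and> charge b = n then cp b (\<rho> u) x else 0)"
      by (simp add: count_mset_index)
    also have "\<dots> = ?c * psi_term (add_mset (neg s, m) \<mu>) n (a, b, u) x"
      by (auto simp: psi_term_def)
    finally show ?thesis .
  qed
  then show "psi (annihilate l s m y) \<mu> n x = ?c * psi y (add_mset (neg s, m) \<mu>) n x"
    unfolding psi_def[of y] annihilate_def unfolding psi_def lin_eval_linear_extension lin_eval_mult_left[symmetric]
    by (intro lin_eval_cong) auto
qed

lemma psi_term_T: "snd (snd k) \<in> Sm \<Longrightarrow> psi_term \<mu> n k \<in> T"
  by (cases k; cases "mset (fst k) = \<mu> \<and> charge (fst (snd k)) = n") (auto simp: psi_term_def T_zero cp_T \<rho>_T)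

lemma psi_T:
  assumes "y \<in> smooth_part"
  shows "psi y \<mu> n \<in> T" and "L (psi y \<mu> n) = (\<lambda>x. lin_eval (\<lambda>k. L (psi_term \<mu> n k) x) y)"
proof -
  have k: "psi_term \<mu> n k \<in> T" if "k \<in> Poly_Mapping.keys y" for k
    using assms that by (intro psi_term_T) (auto simp: smooth_part_def)
  have e: "psi y \<mu> n = (\<lambda>x. \<Sum>k\<in>Poly_Mapping.keys y. Poly_Mapping.lookup y k * psi_term \<mu> n k x)"
    by (simp add: psi_def[abs_def] lin_eval_def)
  show "psi y \<mu> n \<in> T" unfolding e by (rule T_sum) (rule k)
  show "L (psi y \<mu> n) = (\<lambda>x. lin_eval (\<lambda>k. L (psi_term \<mu> n k) x) y)"
    unfolding e lin_eval_def by (rule L_sum) (rule k)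
qed

text \<open>A letter that lowers the absolute charge contributes one factor to the operator. Taking
  this factor out of the sum over triples needs linearity of \<open>L\<close>, which is available on
  \<open>T\<close>; hence the restriction to \<open>smooth_part\<close>.\<close>

lemma psi_zero_mode:
  assumes "y \<in> smooth_part"
  defines "m \<equiv> \<lambda>n s. n - sval s"
  shows "psi (zero_mode s y) \<mu> n = (if \<bar>n\<bar> < \<bar>m n s\<bar>
    then lower (m n s) (psi y \<mu> (m n s))
    else psi y \<mu> (m n s))"
proof
  fix x
  let ?m = "n - sval s"
  have "psi_term \<mu> n (a, s # b, u) x = (if \<bar>n\<bar> < \<bar>?m\<bar>
    then lower ?m (psi_term \<mu> ?m (a, b, u)) x
    else psi_term \<mu> ?m (a, b, u) x)" for a b u
    by (auto simp: psi_term_def L_zero)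
  then have "psi (zero_mode s y) \<mu> n x = lin_eval (\<lambda>k. if \<bar>n\<bar> < \<bar>?m\<bar>
    then lower ?m (psi_term \<mu> ?m k) x
    else psi_term \<mu> ?m k x) y"
    unfolding psi_def zero_mode_def lin_eval_linear_extension by (intro lin_eval_cong) auto
  also have "\<dots> = (if \<bar>n\<bar> < \<bar>?m\<bar>
    then lower ?m (psi y \<mu> ?m) x
    else psi y \<mu> ?m x)"
    unfolding psi_T(2)[OF assms(1)] by (simp add: psi_def lin_eval_def distrib_left sum.distrib sum_distrib_left mult_ac)
  finally show "psi (zero_mode s y) \<mu> n x = (if \<bar>n\<bar> < \<bar>m n s\<bar>
    then lower (m n s) (psi y \<mu> (m n s))
    else psi y \<mu> (m n s)) x"
    by (simp add: m_def)
qed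

text \<open>The lowering operator from charge \<open>\<plusminus>P\<close> annihilates the eigenfunctions of eigenvalue \<open>P(P-1)K\<close>.\<close>

lemma N_stable:
  assumes y: "y \<in> N"
  shows "h_mode l s k y \<in> N"
proof -
  have ys: "y \<in> smooth_part" and E: "\<And>\<mu> n. psi y \<mu> n \<in> E n" using y by (auto simp: N_def)
  have sc: "(\<lambda>x. c * v x) \<in> E n" if "v \<in> E n" for v c n using E_lin[OF that that, of c 0] by simp
  have "psi (h_mode l s k y) \<mu> n \<in> E n" for \<mu> n
  proof -
    consider "k < 0" | "k > 0" | "k = 0" by linarith
    then show ?thesis
    proof cases
      case 1
      then show ?thesis using E E_zero by (simp add: h_mode_def psi_create)
    next
      case 2
      then show ?thesis using sc[OF E] by (simp add: h_mode_def psi_annihilate)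
    next
      case 3
      let ?m = "n - sval s"
      let ?v = "psi y \<mu> ?m"
      have v: "L ?v = (\<lambda>x. - lam * ?v x)"
        using E[of \<mu> ?m] by (auto simp: E_def L_zero split: if_splits)
      \<comment> \<open>On eigenfunctions the lowering operator is multiplication by a
        scalar.\<close>
      define c where "c = (if \<bar>n\<bar> < \<bar>?m\<bar> then of_int (\<bar>?m\<bar> * (\<bar>?m\<bar> - 1)) * of_real K - lam else 1)"
      have z: "psi (h_mode l s k y) \<mu> n = (\<lambda>x. c * ?v x)"
        using 3 v by (auto simp: h_mode_def psi_zero_mode[OF ys] c_def algebra_simps)
      consider "\<bar>?m\<bar> < int P" | "\<not> \<bar>?m\<bar> < int P" "\<bar>n\<bar> < int P" | "\<not> \<bar>?m\<bar> < int P" "\<not> \<bar>n\<bar> < int P" by blast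
      then show ?thesis
      proof cases
        case 1
        then have "?v = (\<lambda>x. 0)" using E[of \<mu> ?m] by (simp add: E_def)
        then show ?thesis unfolding z by (simp add: E_zero)
      next
        \<comment> \<open>The only crossing of the threshold: charges move by one, so the old
          absolute charge is P and the scalar is P(P-1)K - \<open>lam\<close> = 0.\<close>
        case 2
        have "\<bar>sval s\<bar> = 1" by (cases s) simp_all
        then have "\<bar>?m\<bar> = int P" using 2 by linarith
        then have "c = 0" using 2 by (simp add: c_def lam)
        then show ?thesis unfolding z by (simp add: E_zero)
      next
        case 3
        then have "E n = E ?m" by (simp add: E_def)
        then show ?thesis unfolding z using sc[OF E] by metis
      qed
    qed
  qed
  then show ?thesis using h_mode_smooth_part[OF ys] by (simp add: N_def)
qed

text \<open>The weight of a triple can be read off the multiset of its negative modes. So at each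
  multiset a homogeneous component of \<open>y\<close> has either the same coefficient as
  \<open>y\<close> or zero.\<close>

lemma N_graded: "N \<subseteq> fock.span {y \<in> N. homogeneous y}"
proof
  fix y assume y: "y \<in> N"
  define c where "c d = (\<Sum>k\<in>{k \<in> Poly_Mapping.keys y. wt k = d}. scl (Poly_Mapping.lookup y k) (Poly_Mapping.single k 1))" for d
  have wt: "wt k = sum_mset (image_mset snd (mset (fst k)))" for k :: "'m triple"
    using sum_mset_sum_list[of "map snd (fst k)"] by (cases k) (simp add: wt_def)
  have "c d \<in> N" for d
  proof -
    have s: "c d \<in> smooth_part"
      unfolding c_def using y
      by (intro smooth_part_closed)
        (auto simp: N_def smooth_part_def)
    have "psi (c d) \<mu> n = (if sum_mset (image_mset snd \<mu>) = d then psi y \<mu> n else (\<lambda>x. 0))" for \<mu> n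
    proof
      fix x
      have t: "psi_term \<mu> n k x = 0" if "wt k \<noteq> sum_mset (image_mset snd \<mu>)" for k
        using that by (cases k) (auto simp: psi_term_def wt)
      have "psi (c d) \<mu> n x = (\<Sum>k\<in>{k \<in> Poly_Mapping.keys y. wt k = d}. Poly_Mapping.lookup y k * psi_term \<mu> n k x)"
        by (simp add: psi_def c_def lin_eval_sum lin_eval_scl)
      also have "\<dots> = (if sum_mset (image_mset snd \<mu>) = d then psi y \<mu> n else (\<lambda>x. 0)) x"
      proof (cases "sum_mset (image_mset snd \<mu>) = d")
        case True
        then have "(\<Sum>k\<in>{k \<in> Poly_Mapping.keys y. wt k = d}. Poly_Mapping.lookup y k * psi_term \<mu> n k x) =
            (\<Sum>k\<in>Poly_Mapping.keys y. Poly_Mapping.lookup y k * psi_term \<mu> n k x)"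
          by (intro sum.mono_neutral_left) (auto simp: t)
        then show ?thesis using True by (simp add: psi_def lin_eval_def)
      next
        case False
        then show ?thesis by (simp add: t)
      qed
      finally show "psi (c d) \<mu> n x = (if sum_mset (image_mset snd \<mu>) = d then psi y \<mu> n else (\<lambda>x. 0)) x" .
    qed
    then show ?thesis using s y E_zero by (simp add: N_def)
  qed
  moreover have "homogeneous (c d)" for d
  proof -
    have "Poly_Mapping.single k 1 \<in> homog d" if "wt k = d" for k :: "'m triple"
      using that by (simp add: homog_def)
    then have "c d \<in> homog d" unfolding c_def
      by (intro homog_closed) auto
    then show ?thesis by (rule homogeneousI)
  qed
  ultimately have c: "c d \<in> fock.span {y \<in> N. homogeneous y}" for d by (intro fock.span_base) simp
  have "y = (\<Sum>d\<in>wt ` Poly_Mapping.keys y. c d)"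
    unfolding c_def by (subst sum.group) (simp_all add: fock_expand[symmetric])
  also have "\<dots> \<in> fock.span {y \<in> N. homogeneous y}"
    by (intro fock.span_sum c)
  finally show "y \<in> fock.span {y \<in> N. homogeneous y}" .
qed

lemma graded_submodule_N: "graded_submodule l N"
  using graded_submoduleI[of "\<lambda>_. N"] subspace_N N_stable N_graded by blast

lemma gens_N: "gens1 K lam f \<union> gens2 f \<union> gens3 P f \<subseteq> N"
proof (intro Un_least subsetI)
  note S = subspace_smooth_part
  note ft = ftriple_smooth_part[OF f_Sm]
  fix y
  show "y \<in> N" if "y \<in> gens1 K lam f"
    using that fock.subspace_diff[OF S ft fock.subspace_scale[OF S ft]]
    by (auto simp: gens1_def N_def psi_diff psi_scl psi_ftriple cop_straight_word cp_f E_zero)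
  show "y \<in> N" if "y \<in> gens2 f"
    using that fock.subspace_diff[OF S ft ft]
    by (auto simp: gens2_def N_def psi_diff psi_ftriple E_zero)
  show "y \<in> N" if y3: "y \<in> gens3 P f"
  proof -
    obtain s r k a where y: "r \<ge> k + P" "y = ftriple a (replicate (r - k) (neg s)) f"
      using y3 by (auto simp: gens3_def sorted_monomials_def)
    have "\<bar>charge (replicate (r - k) (neg s))\<bar> = int (r - k)" by (cases s) auto
    then have "\<not> \<bar>charge (replicate (r - k) (neg s))\<bar> < int P" using y(1) by linarith
    then have "\<rho> f \<in> E (charge (replicate (r - k) (neg s)))"
      unfolding E_def using \<rho>_T[OF f_Sm] f_eigen by simp
    then show ?thesis unfolding y(2) N_def using ft E_zero by (simp add: psi_ftriple cop_replicate)
  qed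
qed

text \<open>The coefficient at the multiset and charge of \<open>b\<close> sees no other basis
  element, and below the threshold \<open>N\<close> allows only the coefficient zero; it remains to
  evaluate where the restriction of \<open>f\<close> does not vanish.\<close>

lemma basis_set_independent:
  assumes F: "finite F" "F \<subseteq> basis_set P f" and s: "(\<Sum>b\<in>F. scl (z b) b) \<in> N" and b: "b \<in> F"
  shows "z b = 0"
proof -
  obtain y where y: "\<rho> f y \<noteq> 0" using f_nz by blast
  \<comment> \<open>The bound covers the monomials without zero modes too, as \<open>P\<close> is at
    least 1.\<close>
  have form: "\<exists>a n s. b = ftriple a (replicate n (neg s)) f \<and> n < P" if "b \<in> F" for b
    using that F(2) P unfolding basis_set_form by fastforce
  obtain a0 n0 s0 where b0: "b = ftriple a0 (replicate n0 (neg s0)) f" "n0 < P" using form[OF b] by blast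
  let ?c = "charge (replicate n0 (neg s0))"
  have p: "psi b' (mset a0) ?c y = (if b' = b then \<rho> f y else 0)" if b': "b' \<in> F" for b'
  proof -
    obtain a n s where e: "b' = ftriple a (replicate n (neg s)) f" using form[OF b'] by blast
    have "mset a = mset a0 \<and> charge (replicate n (neg s)) = ?c \<longleftrightarrow> b' = b"
    proof
      assume "mset a = mset a0 \<and> charge (replicate n (neg s)) = ?c"
      then have "a = a0 \<and> replicate n (neg s) = replicate n0 (neg s0)"
        using F(2) b b' unfolding e b0 by (intro basis_set_unique[where P = P and f = f]) auto
      then show "b' = b" unfolding e b0 by metis
    next
      assume "b' = b"
      then have "Poly_Mapping.keys b' = Poly_Mapping.keys b" by simp
      then have "{(a, replicate n (neg s), f)} = {(a0, replicate n0 (neg s0), f)}"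
        unfolding e b0 by (simp only: keys_single one_neq_zero if_False)
      then show "mset a = mset a0 \<and> charge (replicate n (neg s)) = ?c"
        by (metis prod.inject singleton_inject)
    qed
    then show ?thesis unfolding e psi_ftriple cop_replicate by simp
  qed
  have "\<bar>?c\<bar> < int P" using b0(2) by (cases s0) auto
  moreover have "psi (\<Sum>b\<in>F. scl (z b) b) (mset a0) ?c \<in> E ?c" using s by (simp add: N_def)
  ultimately have "psi (\<Sum>b\<in>F. scl (z b) b) (mset a0) ?c y = 0" by (simp add: E_def)
  then have "(\<Sum>b'\<in>F. z b' * psi b' (mset a0) ?c y) = 0"
    unfolding psi_sum psi_scl .
  moreover have "(\<Sum>b'\<in>F. z b' * psi b' (mset a0) ?c y) = (\<Sum>b'\<in>F. z b' * (if b' = b then \<rho> f y else 0))"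
    by (intro sum.cong refl) (simp only: p)
  ultimately show ?thesis using F(1) b y by (simp add: if_distrib[of "(*) _"] cong: if_cong)
qed

lemma linear_rel_N: "u \<in> Sm \<Longrightarrow> u' \<in> Sm \<Longrightarrow> linear_rel a b z z' u u' \<in> N"
proof -
  assume u: "u \<in> Sm" "u' \<in> Sm"
  have "cp b (\<rho> (\<lambda>x. z * u x + z' * u' x)) = (\<lambda>x. z * cp b (\<rho> u) x + z' * cp b (\<rho> u') x)"
    using cp_sum[of "{0::nat, 1}" "\<lambda>i. if i = 0 then \<rho> u else \<rho> u'" b "\<lambda>i. if i = 0 then z else z'"] u
    by (simp add: \<rho>_lin \<rho>_T)
  then have "psi (linear_rel a b z z' u u') \<mu> n = (\<lambda>x. 0)" for \<mu> n
    by (auto simp: linear_rel_def psi_diff psi_scl psi_ftriple)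
  moreover have "linear_rel a b z z' u u' \<in> smooth_part"
    unfolding linear_rel_def
    by (intro smooth_part_closed ftriple_smooth_part Sm_lin u)
  ultimately show ?thesis by (simp add: N_def E_zero)
qed

text \<open>Only neutral words \<open>w\<close> have nonzero coefficients. They do not change the
  charge of \<open>b @ w\<close>, and by \<open>cop_append\<close> their operators act on
  \<open>u\<close> first, where the sum gives \<open>u'\<close>.\<close>

lemma action_rel_N:
  assumes u: "u \<in> Sm" "u' \<in> Sm" and \<xi>: "\<And>w. length w = k \<Longrightarrow> charge w \<noteq> 0 \<Longrightarrow> \<xi> w = 0"
    and act: "\<rho> u' = (\<lambda>y. \<Sum>w | length w = k. \<xi> w * cp w (\<rho> u) y)"
  shows "action_rel a b k \<xi> u u' \<in> N"
proof -
  have c: "cp b (\<rho> u') = (\<lambda>x. \<Sum>w | length w = k. \<xi> w * cp b (cp w (\<rho> u)) x)"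
    unfolding act by (rule cp_sum) (simp add: cp_T \<rho>_T u)
  have "psi (action_rel a b k \<xi> u u') \<mu> n x = 0" for \<mu> n x
  proof -
    have "\<xi> w * psi (ftriple a (b @ w) u) \<mu> n x = (if mset a = \<mu> \<and> charge b = n then \<xi> w * cp b (cp w (\<rho> u)) x else 0)"
      if "length w = k" for w
      using \<xi>[OF that] by (cases "charge w = 0") (auto simp: psi_ftriple cop_append)
    then have "(\<Sum>w | length w = k. \<xi> w * psi (ftriple a (b @ w) u) \<mu> n x) =
      (\<Sum>w | length w = k. if mset a = \<mu> \<and> charge b = n then \<xi> w * cp b (cp w (\<rho> u)) x else 0)"
      by (intro sum.cong) auto
    then show ?thesis
      unfolding action_rel_def psi_diff psi_sum psi_scl by (auto simp: psi_ftriple c intro!: sum.neutral)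
  qed
  moreover have "action_rel a b k \<xi> u u' \<in> smooth_part"
    unfolding action_rel_def
    by (intro smooth_part_closed ftriple_smooth_part u)
  ultimately show ?thesis by (simp add: N_def E_zero fun_eq_iff[symmetric] cong: if_cong) (metis (no_types, lifting) E_zero ext)
qed

end

section \<open>Instantiation of the model at a chart\<close>

lemma cop_cong_on:
  assumes "\<And>u v. (\<And>y. y \<in> S \<Longrightarrow> u y = v y) \<Longrightarrow> L u = L v" "\<And>y. y \<in> S \<Longrightarrow> u y = v y" "y \<in> S"
  shows "cop L K b u y = cop L K b v y"
  using assms(3)
proof (induction b arbitrary: y)
  case (Cons s b)
  have "L (cop L K b u) = L (cop L K b v)" by (rule assms(1)) (rule Cons.IH)
  then show ?case using Cons by simp
qed (simp add: assms(2))

lemma cop_outside: "(\<And>v. L v y = 0) \<Longrightarrow> u y = 0 \<Longrightarrow> cop L K b u y = 0"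
  by (induction b) simp_all

lemma (in riemannian) smooth_functions_lin:
  assumes "open U" "u \<in> smooth_functions A U" "v \<in> smooth_functions A U"
  shows "(\<lambda>x. a * u x + b * v x) \<in> smooth_functions A U"
proof -
  have "smooth_on (snd c ` (fst c \<inter> U)) (local_rep c (\<lambda>x. a * u x + b * v x))" if "c \<in> A" for c
  proof -
    have "local_rep c (\<lambda>x. a * u x + b * v x) = (\<lambda>y. a * local_rep c u y + b * local_rep c v y)"
      by (simp add: local_rep_def fun_eq_iff)
    then show ?thesis
      using assms that open_image[OF that assms(1)]
      by (auto simp: smooth_functions_def smooth_in_chart_def intro!: smooth_on_add smooth_on_mult smooth_on_const)
  qed
  then show ?thesis using assms by (auto simp: smooth_functions_def smooth_in_chart_def)
qed

theorem theorem5p18: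
  fixes A :: "'m::{t2_space,second_countable_topology} chart set"
    and g :: "'m metric" and K :: real
    and c0 :: "'m chart" and p :: 'm and e1 e2 :: "real^2"
    and U :: "'m set" and l lam :: complex and P :: nat and f :: "'m \<Rightarrow> complex"
  assumes "riemannian_surface A g" "connected (UNIV :: 'm set)"
    and "complete_surface A g" "orientable_surface A"
    and "constant_curvature A g K" "K \<noteq> 0"
    and "c0 \<in> A" "p \<in> fst c0"
    and "gip g c0 p e1 e1 = 1" "gip g c0 p e2 e2 = 1" "gip g c0 p e1 e2 = 0"
    and "P \<ge> 1" "open U" "l \<noteq> 0"
    and "lam = of_nat P * (of_nat P - 1) * of_real K"
    and "laplace_eigenfunction A g U lam f"
  defines "R \<equiv> tensor_relations A g c0 p e1 e2 U"
  shows "basis_of_quotient (VU R l f) (kernel3 R l K lam P f)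
    (\<Union>{sorted_monomials f Plus r r | r. even r} \<union>
     \<Union>{sorted_monomials f Plus r k | r k. even r \<and> r + 1 \<le> k + P \<and> r div 2 \<le> k \<and> k + 1 \<le> r} \<union>
     \<Union>{sorted_monomials f Minus r k | r k. even r \<and> r + 1 \<le> k + P \<and> r div 2 \<le> k \<and> k + 1 \<le> r})"
proof -
  interpret const_curv A g K
    using assms(1,5,6) by unfold_locales
  note c0 = assms(7-11) and U = assms(13) and eig = assms(16)
  have fSm: "f \<in> smooth_functions A U" using eig by (simp add: laplace_eigenfunction_def)
  obtain x0 where x0: "x0 \<in> U" "f x0 \<noteq> 0" using eig by (auto simp: laplace_eigenfunction_def)
  obtain c where c: "c \<in> A" "x0 \<in> fst c" using atlas by blast
  define S where "S = snd c ` (fst c \<inter> U)"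
  \<comment> \<open>Outside \<open>S\<close> the inverse chart has no controlled values; the cut-off
    puts restrictions into \<open>T\<close>.\<close>
  define \<rho> where "\<rho> u y = (if y \<in> S then local_rep c u y else 0)" for u :: "'m \<Rightarrow> complex" and y
  define T where "T = {v :: real^2 \<Rightarrow> complex. smooth_on S v \<and> (\<forall>y. y \<notin> S \<longrightarrow> v y = 0)}"
  note lap = smooth_lap[OF c(1) U, folded S_def] lap_linear[OF c(1) U, folded S_def]
    lap_outside[OF c(1) U, folded S_def] lap_cong[OF c(1) U, folded S_def] laplace_lap[OF c(1) U, folded S_def]
  have S: "open S" unfolding S_def by (rule open_image[OF c(1) U])
  have sm: "smooth_on S (local_rep c u)" if "u \<in> smooth_functions A U" for u
    using that c(1) by (simp add: smooth_functions_def smooth_in_chart_def S_def)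
  interpret mode_model "smooth_functions A U" \<rho> "lap c U" T K P lam f
  proof
    show "(\<lambda>y. 0) \<in> T" by (simp add: T_def smooth_on_const)
    show "(\<lambda>y. a * u y + b * v y) \<in> T" if "u \<in> T" "v \<in> T" for u v a b
      using that S by (auto simp: T_def intro!: smooth_on_add smooth_on_mult smooth_on_const)
    show "lap c U u \<in> T" if "u \<in> T" for u using that lap(1,3) by (simp add: T_def)
    show "lap c U (\<lambda>y. a * u y + b * v y) = (\<lambda>y. a * lap c U u y + b * lap c U v y)" if "u \<in> T" "v \<in> T" for u v a b
      using that lap(2) by (simp add: T_def)
    show "\<rho> w \<in> T" if "w \<in> smooth_functions A U" for w
      using smooth_on_cong[OF S _ sm[OF that], of "\<rho> w"] by (simp add: T_def \<rho>_def)
    show "\<rho> (\<lambda>x. a * w x + b * w' x) = (\<lambda>y. a * \<rho> w y + b * \<rho> w' y)" for w w' a b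
      by (simp add: \<rho>_def fun_eq_iff local_rep_def)
    show "(\<lambda>x. a * w x + b * w' x) \<in> smooth_functions A U"
      if "w \<in> smooth_functions A U" "w' \<in> smooth_functions A U" for w w' a b
      by (rule smooth_functions_lin[OF U that])
    show "lap c U (\<rho> f) = (\<lambda>y. - lam * \<rho> f y)"
    proof
      fix y
      have "lap c U (\<rho> f) = lap c U (local_rep c f)" by (rule lap(4)) (simp add: \<rho>_def)
      moreover have "lap c U (local_rep c f) y = - lam * \<rho> f y" if y: "y \<in> S"
      proof -
        have "inv_chart c y \<in> fst c \<inter> U" using y c(1) by (auto simp: S_def)
        then have "- laplace_beltrami g c f (inv_chart c y) = lam * f (inv_chart c y)"
          using eig c(1) unfolding laplace_eigenfunction_def by blast
        then show ?thesis
          using lap(5)[OF sm[OF fSm] y] y by (simp add: \<rho>_def local_rep_def minus_equation_iff)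
      qed
      ultimately show "lap c U (\<rho> f) y = - lam * \<rho> f y" using lap(3) by (cases "y \<in> S") (simp_all add: \<rho>_def)
    qed
    show "\<exists>y. \<rho> f y \<noteq> 0"
      using x0 c by (intro exI[of _ "snd c x0"]) (auto simp: \<rho>_def S_def local_rep_def)
  qed (use fSm assms in simp_all)
  have "action_rel a b k \<xi> u u' \<in> N" if act: "action_data A g c0 p e1 e2 U k \<xi> u u'" for a b k \<xi> u u'
  proof -
    obtain X where X: "parallel_section A g k X"
      "\<And>I. length I = k \<Longrightarrow> X c0 p I = (\<Sum>w | length w = k. \<xi> w * word_tensor e1 e2 w I)"
      and u: "u \<in> smooth_functions A U" "u' \<in> smooth_functions A U" and a: "acts_to A g U k X u u'"
      using act unfolding action_data_def by blast
    note pa = parallel_action[OF c(1) U assms(2) X(1) c0 X(2), folded S_def]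
    have "\<rho> u' y = (\<Sum>w | length w = k. \<xi> w * cop (lap c U) (of_real K) w (\<rho> u) y)" for y
    proof (cases "y \<in> S")
      case True
      have "cop (lap c U) (of_real K) w (\<rho> u) y = cop (lap c U) (of_real K) w (local_rep c u) y" for w
        by (rule cop_cong_on[OF lap(4) _ True]) (simp_all add: \<rho>_def)
      then show ?thesis using pa(2)[OF _ a sm[OF u(1)] True] True by (simp add: \<rho>_def)
    next
      case False
      then show ?thesis using cop_outside[of "lap c U" y "\<rho> u"] lap(3) by (simp add: \<rho>_def)
    qed
    then show ?thesis using pa(1) by (intro action_rel_N u) (auto simp: fun_eq_iff)
  qed
  then have "R \<subseteq> N"
    unfolding R_def tensor_relations_eq by (auto intro: linear_rel_N)
  \<comment> \<open>This inclusion is enough: independence modulo the larger space \<open>N\<close>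
    implies independence modulo the kernel.\<close>
  then have kN: "kernel3 R l K lam P f \<subseteq> N"
    using gens_N by (intro kernel3_least graded_submodule_N) auto
  have V: "VU R l f = charged R f 0" unfolding R_def by (rule VU_eq_charged)
  have "b \<in> charged R f 0" if b: "b \<in> basis_set P f" for b
  proof -
    obtain s ts us n where y: "b = ftriple (map (Pair s) ts @ map (Pair (neg s)) us) (replicate n (neg s)) f"
      "\<forall>t\<in>set ts \<union> set us. t \<ge> 1" "length ts = length us + n"
      using b unfolding basis_set_form by blast
    show ?thesis unfolding y(1)
      by (rule ftriple_charged) (use y(2,3) in \<open>auto simp: valid_nword_def o_def map_replicate_const algebra_simps\<close>)
  qed
  then have B: "basis_set P f \<subseteq> charged R f 0" by blast
  have kV: "kernel3 R l K lam P f \<subseteq> charged R f 0"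
    using kernel3_le_VU[of A g c0 p e1 e2 U l K lam P f] V by (simp add: R_def)
  have "basis_of_quotient (VU R l f) (kernel3 R l K lam P f) (basis_set P f)"
    unfolding basis_of_quotient_def V
  proof (intro conjI ballI allI impI)
    show "\<exists>x\<in>fock.span (basis_set P f). y - x \<in> kernel3 R l K lam P f" if "y \<in> charged R f 0" for y
      by (rule charged_reduce[OF subspace_kernel3 kernel3_superset that])
    show "z b = 0"
      if "finite T \<and> T \<subseteq> basis_set P f \<and> (\<Sum>b\<in>T. scl (z b) b) \<in> kernel3 R l K lam P f" "b \<in> T" for T z b
      using that kN by (intro basis_set_independent[of T z b]) auto
  qed (rule subspace_charged subspace_kernel3 kV B)+
  then show ?thesis unfolding basis_set_def .
qed

end
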